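(* Let $G$ be a right-angled group and let $\mathcal{S}=\{s_i \mid i\in\mathcal{I}\}$ be a right-angled set of generators of $G$. Let $\psi$ be a character of $G$ such that the cyclic subgroup $\langle s_i\rangle$ is $\psi$-regular for every $i\in\mathcal{I}$. Then $b_1^\psi(G)=0$.
   Context: A group $G$ is right-angled if it is a quotient of a right-angled Artin group $A_\Gamma$, where $\Gamma=(\mathcal{I},\mathcal{E})$ is a finite connected graph, such that the image of every standard generator $\sigma_i$ ($i\in\mathcal{I}$) has infinite order in $G$. Here $A_\Gamma=\langle \sigma_i\ (i\in\mathcal{I}) \mid \sigma_i\sigma_j=\sigma_j\sigma_i \text{ for } \{i,j\}\in\mathcal{E}\rangle$. The image $\{s_i\mid i\in\mathcal{I}\}$ of the generating set $\{\sigma_i \mid i \in \mathcal{I}\}$ of $A_\Gamma$ under such a quotient map is called a right-angled set of generators of $G$. A character of a group $G$ is a function $\psi\colon G \to \mathbb{C}$ of positive type (i.e. $\sum_{i,j} c_i \overline{c_j}\,\psi(g_j^{-1}g_i) \geq 0$ for all finite families $c_i \in \mathbb{C}$, $g_i \in G$) that is constant on conjugacy classes and satisfies $\psi(1_G)=1$. A subgroup $K\leq G$ is $\psi$-regular if $\psi(k)=0$ for all $k\in K\setminus\{1\}$. The character defines a positive semi-definite inner product on $\mathbb{C}[G]$ by $\langle g,h\rangle_\psi = \psi(h^{-1}g)$; the Hilbert space obtained by dividing out null vectors and completing is $\ell^\psi(G)$, with unitary left and right $G$-actions. For a closed left-$G$-invariant subspace $V \subseteq \ell^\psi(G)^n$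 with orthogonal projection $P$ onto $V$, put $\dim_\psi(V) = \sum_{i=1}^n \langle P e_i, e_i\rangle_\psi$, where $e_i$ has $i$-th entry $1_G$ and all other entries $0$. For a group $G$ with finite generating set $S$, let $\partial_1\colon \ell^\psi(G)^S\to\ell^\psi(G)$ be the bounded left-$G$-equivariant operator with $\partial_1(g e_s) = gs-g$, and let $Z_{G,S}$ be the kernel of its restriction $\mathbb{C}[G]^S\to\mathbb{C}[G]$ to the group ring level. The first $\psi$-Betti number is $b_1^\psi(G) = \dim_\psi(\ker\partial_1)-\dim_\psi(\overline{Z_{G,S}})$, where $\overline{Z_{G,S}}$ is the closure of the image of $Z_{G,S}$ in $\ell^\psi(G)^S$ (independent of $S$). *)

theory Defs
  imports
    Complex_Main
    "HOL-Library.FuncSet"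
    "HOL-Library.Nonpos_Ints"
    "HOL-Algebra.Algebra"
    "Graph_Theory.Graph_Theory"
begin

section \<open>Right-angled Artin groups and right-angled groups\<close>

text \<open>
  A finite simple graph is a \<open>pair_graph\<close>: a finite, loop-free, symmetric arc relation, so that
  \<open>(i, j) \<in> parcs \<Gamma>\<close> says that \<open>{i, j}\<close> is an edge.  The Artin group is constructed from its
  presentation: words in the letters \<open>\<sigma>\<^sub>i\<close>, coded as \<open>(i, True)\<close>, and their formal inverses, coded
  as \<open>(i, False)\<close>, modulo the congruence generated by free cancellation and the commutation
  relations.
\<close>

inductive raag_step :: "'i pair_pre_digraph \<Rightarrow> ('i \<times> bool) list \<Rightarrow> ('i \<times> bool) list \<Rightarrow> bool"
  for \<Gamma> :: "'i pair_pre_digraph" where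
  cancel: "i \<in> pverts \<Gamma> \<Longrightarrow> raag_step \<Gamma> (u @ [(i, b), (i, \<not> b)] @ v) (u @ v)"
| commute: "(i, j) \<in> parcs \<Gamma> \<Longrightarrow>
    raag_step \<Gamma> (u @ [(i, True), (j, True)] @ v) (u @ [(j, True), (i, True)] @ v)"

definition raag_words :: "'i pair_pre_digraph \<Rightarrow> ('i \<times> bool) list set" where
  "raag_words \<Gamma> = lists (pverts \<Gamma> \<times> UNIV)"

definition raag_rel :: "'i pair_pre_digraph \<Rightarrow> (('i \<times> bool) list \<times> ('i \<times> bool) list) set" where
  "raag_rel \<Gamma> = {(u, v). u \<in> raag_words \<Gamma> \<and> v \<in> raag_words \<Gamma> \<and> equivclp (raag_step \<Gamma>) u v}"

definition raag :: "'i pair_pre_digraph \<Rightarrow> ('i \<times> bool) list set monoid" where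
  "raag \<Gamma> =
    \<lparr>carrier = raag_words \<Gamma> // raag_rel \<Gamma>,
     monoid.mult = (\<lambda>A B. raag_rel \<Gamma> `` {u @ v | u v. u \<in> A \<and> v \<in> B}),
     one = raag_rel \<Gamma> `` {[]}\<rparr>"

definition raag_gen :: "'i pair_pre_digraph \<Rightarrow> 'i \<Rightarrow> ('i \<times> bool) list set" where
  "raag_gen \<Gamma> i = raag_rel \<Gamma> `` {[(i, True)]}"

text \<open>
  The family \<open>s\<close>, indexed by the vertices of \<open>\<Gamma>\<close>, is the image of the standard generators under
  a quotient map \<open>raag \<Gamma> \<rightarrow> G\<close>; in HOL-Algebra an element has \<open>ord\<close> equal to \<open>0\<close> iff its order is
  infinite.  A group is right-angled iff it has such a family.
\<close>

definition right_angled_generators ::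
    "('a, 'b) monoid_scheme \<Rightarrow> 'i pair_pre_digraph \<Rightarrow> ('i \<Rightarrow> 'a) \<Rightarrow> bool" where
  "right_angled_generators G \<Gamma> s \<longleftrightarrow>
    pair_graph \<Gamma> \<and> Digraph_Component.connected (with_proj \<Gamma>) \<and>
    (\<exists>\<pi> \<in> epi (raag \<Gamma>) G. \<forall>i \<in> pverts \<Gamma>. s i = \<pi> (raag_gen \<Gamma> i)) \<and>
    (\<forall>i \<in> pverts \<Gamma>. group.ord G (s i) = 0)"


section \<open>Characters\<close>

definition positive_type :: "('a, 'b) monoid_scheme \<Rightarrow> ('a \<Rightarrow> complex) \<Rightarrow> bool" where
  "positive_type G \<psi> \<longleftrightarrow>
    (\<forall>(n::nat) (c :: nat \<Rightarrow> complex) (g :: nat \<Rightarrow> 'a). (\<forall>i<n. g i \<in> carrier G) \<longrightarrow>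
      (\<Sum>i<n. \<Sum>j<n. c i * cnj (c j) * \<psi> (inv\<^bsub>G\<^esub> (g j) \<otimes>\<^bsub>G\<^esub> g i)) \<in> \<real>\<^sub>\<ge>\<^sub>0)"

definition group_character :: "('a, 'b) monoid_scheme \<Rightarrow> ('a \<Rightarrow> complex) \<Rightarrow> bool" where
  "group_character G \<psi> \<longleftrightarrow>
    positive_type G \<psi> \<and>
    (\<forall>g \<in> carrier G. \<forall>h \<in> carrier G. \<psi> (h \<otimes>\<^bsub>G\<^esub> g \<otimes>\<^bsub>G\<^esub> inv\<^bsub>G\<^esub> h) = \<psi> g) \<and>
    \<psi> \<one>\<^bsub>G\<^esub> = 1"

definition regular_subgroup ::
    "('a, 'b) monoid_scheme \<Rightarrow> ('a \<Rightarrow> complex) \<Rightarrow> 'a set \<Rightarrow> bool" where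
  "regular_subgroup G \<psi> K \<longleftrightarrow> subgroup K G \<and> (\<forall>k \<in> K - {\<one>\<^bsub>G\<^esub>}. \<psi> k = 0)"


section \<open>The complex group ring with the form given by the character\<close>

definition group_ring :: "('a, 'b) monoid_scheme \<Rightarrow> ('a \<Rightarrow> complex) set" where
  "group_ring G = {x. finite {g. x g \<noteq> 0} \<and> {g. x g \<noteq> 0} \<subseteq> carrier G}"

definition gr_basis :: "'a \<Rightarrow> 'a \<Rightarrow> complex" where
  "gr_basis g = (\<lambda>k. if k = g then 1 else 0)"

definition psi_form ::
    "('a, 'b) monoid_scheme \<Rightarrow> ('a \<Rightarrow> complex) \<Rightarrow> ('a \<Rightarrow> complex) \<Rightarrow> ('a \<Rightarrow> complex) \<Rightarrow> complex" where
  "psi_form G \<psi> x y =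
    (\<Sum>g | x g \<noteq> 0. \<Sum>h | y h \<noteq> 0. x g * cnj (y h) * \<psi> (inv\<^bsub>G\<^esub> h \<otimes>\<^bsub>G\<^esub> g))"

definition psi_seminorm ::
    "('a, 'b) monoid_scheme \<Rightarrow> ('a \<Rightarrow> complex) \<Rightarrow> ('a \<Rightarrow> complex) \<Rightarrow> real" where
  "psi_seminorm G \<psi> x = sqrt (Re (psi_form G \<psi> x x))"

text \<open>The linear extension of \<open>g e\<^sub>t \<mapsto> g t - g\<close> to tuples of group ring elements.\<close>

definition gr_boundary ::
    "('a, 'b) monoid_scheme \<Rightarrow> 'a set \<Rightarrow> ('a \<Rightarrow> 'a \<Rightarrow> complex) \<Rightarrow> 'a \<Rightarrow> complex" where
  "gr_boundary G T x = (\<lambda>k. \<Sum>t\<in>T. \<Sum>g | x t g \<noteq> 0.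
      x t g * (gr_basis (g \<otimes>\<^bsub>G\<^esub> t) k - gr_basis g k))"

definition gr_cycles :: "('a, 'b) monoid_scheme \<Rightarrow> 'a set \<Rightarrow> ('a \<Rightarrow> 'a \<Rightarrow> complex) set" where
  "gr_cycles G T = {z \<in> T \<rightarrow>\<^sub>E group_ring G. gr_boundary G T z = (\<lambda>k. 0)}"


section \<open>The Hilbert space \<open>\<ell>\<^sup>\<psi>(G)\<close> and its finite powers\<close>

text \<open>
  Null vectors are divided out and the form is completed in one step: elements are Cauchy
  sequences in the group ring modulo sequences whose seminorm tends to \<open>0\<close>.
\<close>

definition psi_cauchy ::
    "('a, 'b) monoid_scheme \<Rightarrow> ('a \<Rightarrow> complex) \<Rightarrow> (nat \<Rightarrow> 'a \<Rightarrow> complex) set" where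
  "psi_cauchy G \<psi> = {x. (\<forall>n. x n \<in> group_ring G) \<and>
    (\<forall>e>0. \<exists>N. \<forall>m\<ge>N. \<forall>n\<ge>N. psi_seminorm G \<psi> (\<lambda>g. x m g - x n g) < e)}"

definition psi_null_rel ::
    "('a, 'b) monoid_scheme \<Rightarrow> ('a \<Rightarrow> complex) \<Rightarrow>
      ((nat \<Rightarrow> 'a \<Rightarrow> complex) \<times> (nat \<Rightarrow> 'a \<Rightarrow> complex)) set" where
  "psi_null_rel G \<psi> = {(x, y). x \<in> psi_cauchy G \<psi> \<and> y \<in> psi_cauchy G \<psi> \<and>
    (\<lambda>n. psi_seminorm G \<psi> (\<lambda>g. x n g - y n g)) \<longlonglongrightarrow> 0}"

type_synonym 'a lpsi_elem = "(nat \<Rightarrow> 'a \<Rightarrow> complex) set"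

definition lpsi :: "('a, 'b) monoid_scheme \<Rightarrow> ('a \<Rightarrow> complex) \<Rightarrow> 'a lpsi_elem set" where
  "lpsi G \<psi> = psi_cauchy G \<psi> // psi_null_rel G \<psi>"

definition lpsi_class ::
    "('a, 'b) monoid_scheme \<Rightarrow> ('a \<Rightarrow> complex) \<Rightarrow> (nat \<Rightarrow> 'a \<Rightarrow> complex) \<Rightarrow> 'a lpsi_elem" where
  "lpsi_class G \<psi> x = psi_null_rel G \<psi> `` {x}"

definition lpsi_rep :: "'a lpsi_elem \<Rightarrow> nat \<Rightarrow> 'a \<Rightarrow> complex" where
  "lpsi_rep \<xi> = (SOME x. x \<in> \<xi>)"

definition lpsi_of ::
    "('a, 'b) monoid_scheme \<Rightarrow> ('a \<Rightarrow> complex) \<Rightarrow> ('a \<Rightarrow> complex) \<Rightarrow> 'a lpsi_elem" where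
  "lpsi_of G \<psi> x = lpsi_class G \<psi> (\<lambda>n. x)"

definition lpsi_inner ::
    "('a, 'b) monoid_scheme \<Rightarrow> ('a \<Rightarrow> complex) \<Rightarrow> 'a lpsi_elem \<Rightarrow> 'a lpsi_elem \<Rightarrow> complex" where
  "lpsi_inner G \<psi> \<xi> \<eta> = lim (\<lambda>n. psi_form G \<psi> (lpsi_rep \<xi> n) (lpsi_rep \<eta> n))"

definition lpsi_diff ::
    "('a, 'b) monoid_scheme \<Rightarrow> ('a \<Rightarrow> complex) \<Rightarrow> 'a lpsi_elem \<Rightarrow> 'a lpsi_elem \<Rightarrow> 'a lpsi_elem" where
  "lpsi_diff G \<psi> \<xi> \<eta> = lpsi_class G \<psi> (\<lambda>n g. lpsi_rep \<xi> n g - lpsi_rep \<eta> n g)"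

text \<open>The direct sum of copies of \<open>\<ell>\<^sup>\<psi>(G)\<close> indexed by \<open>T\<close> consists of extensional functions on \<open>T\<close>.\<close>

definition lpsi_pow ::
    "('a, 'b) monoid_scheme \<Rightarrow> ('a \<Rightarrow> complex) \<Rightarrow> 't set \<Rightarrow> ('t \<Rightarrow> 'a lpsi_elem) set" where
  "lpsi_pow G \<psi> T = (T \<rightarrow>\<^sub>E lpsi G \<psi>)"

definition lpsi_pow_inner ::
    "('a, 'b) monoid_scheme \<Rightarrow> ('a \<Rightarrow> complex) \<Rightarrow> 't set \<Rightarrow>
      ('t \<Rightarrow> 'a lpsi_elem) \<Rightarrow> ('t \<Rightarrow> 'a lpsi_elem) \<Rightarrow> complex" where
  "lpsi_pow_inner G \<psi> T \<xi> \<eta> = (\<Sum>t\<in>T. lpsi_inner G \<psi> (\<xi> t) (\<eta> t))"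

definition lpsi_pow_diff ::
    "('a, 'b) monoid_scheme \<Rightarrow> ('a \<Rightarrow> complex) \<Rightarrow> 't set \<Rightarrow>
      ('t \<Rightarrow> 'a lpsi_elem) \<Rightarrow> ('t \<Rightarrow> 'a lpsi_elem) \<Rightarrow> ('t \<Rightarrow> 'a lpsi_elem)" where
  "lpsi_pow_diff G \<psi> T \<xi> \<eta> = (\<lambda>t\<in>T. lpsi_diff G \<psi> (\<xi> t) (\<eta> t))"

definition lpsi_pow_norm ::
    "('a, 'b) monoid_scheme \<Rightarrow> ('a \<Rightarrow> complex) \<Rightarrow> 't set \<Rightarrow> ('t \<Rightarrow> 'a lpsi_elem) \<Rightarrow> real" where
  "lpsi_pow_norm G \<psi> T \<xi> = sqrt (Re (lpsi_pow_inner G \<psi> T \<xi> \<xi>))"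

definition lpsi_pow_of ::
    "('a, 'b) monoid_scheme \<Rightarrow> ('a \<Rightarrow> complex) \<Rightarrow> 't set \<Rightarrow>
      ('t \<Rightarrow> 'a \<Rightarrow> complex) \<Rightarrow> ('t \<Rightarrow> 'a lpsi_elem)" where
  "lpsi_pow_of G \<psi> T x = (\<lambda>t\<in>T. lpsi_of G \<psi> (x t))"

definition lpsi_unit ::
    "('a, 'b) monoid_scheme \<Rightarrow> ('a \<Rightarrow> complex) \<Rightarrow> 't set \<Rightarrow> 't \<Rightarrow> ('t \<Rightarrow> 'a lpsi_elem)" where
  "lpsi_unit G \<psi> T i =
    lpsi_pow_of G \<psi> T (\<lambda>t. if t = i then gr_basis \<one>\<^bsub>G\<^esub> else (\<lambda>k. 0))"

definition lpsi_closure ::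
    "('a, 'b) monoid_scheme \<Rightarrow> ('a \<Rightarrow> complex) \<Rightarrow> 't set \<Rightarrow>
      ('t \<Rightarrow> 'a lpsi_elem) set \<Rightarrow> ('t \<Rightarrow> 'a lpsi_elem) set" where
  "lpsi_closure G \<psi> T A = {\<xi> \<in> lpsi_pow G \<psi> T.
    \<forall>e>0. \<exists>\<eta>\<in>A. lpsi_pow_norm G \<psi> T (lpsi_pow_diff G \<psi> T \<xi> \<eta>) < e}"


section \<open>Dimension and the first Betti number\<close>

definition lpsi_proj ::
    "('a, 'b) monoid_scheme \<Rightarrow> ('a \<Rightarrow> complex) \<Rightarrow> 't set \<Rightarrow>
      ('t \<Rightarrow> 'a lpsi_elem) set \<Rightarrow> ('t \<Rightarrow> 'a lpsi_elem) \<Rightarrow> ('t \<Rightarrow> 'a lpsi_elem)" where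
  "lpsi_proj G \<psi> T V \<xi> =
    (THE p. p \<in> V \<and> (\<forall>v\<in>V. lpsi_pow_inner G \<psi> T (lpsi_pow_diff G \<psi> T \<xi> p) v = 0))"

text \<open>
  The dimension is kept as the defining complex sum; for a closed subspace its value is real
  and nonnegative.
\<close>

definition psi_dim ::
    "('a, 'b) monoid_scheme \<Rightarrow> ('a \<Rightarrow> complex) \<Rightarrow> 't set \<Rightarrow> ('t \<Rightarrow> 'a lpsi_elem) set \<Rightarrow> complex" where
  "psi_dim G \<psi> T V =
    (\<Sum>i\<in>T. lpsi_pow_inner G \<psi> T (lpsi_proj G \<psi> T V (lpsi_unit G \<psi> T i)) (lpsi_unit G \<psi> T i))"

text \<open>
  The extension by continuity of \<^const>\<open>gr_boundary\<close>: since \<open>\<psi>\<close> is a class function, that operator is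
  bounded, so applying it termwise to representing Cauchy sequences is well defined.
\<close>

definition lpsi_boundary ::
    "('a, 'b) monoid_scheme \<Rightarrow> ('a \<Rightarrow> complex) \<Rightarrow> 'a set \<Rightarrow> ('a \<Rightarrow> 'a lpsi_elem) \<Rightarrow> 'a lpsi_elem" where
  "lpsi_boundary G \<psi> T \<xi> = lpsi_class G \<psi> (\<lambda>n. gr_boundary G T (\<lambda>t. lpsi_rep (\<xi> t) n))"

definition psi_betti1 :: "('a, 'b) monoid_scheme \<Rightarrow> ('a \<Rightarrow> complex) \<Rightarrow> 'a set \<Rightarrow> complex" where
  "psi_betti1 G \<psi> T =
    psi_dim G \<psi> T {\<xi> \<in> lpsi_pow G \<psi> T. lpsi_boundary G \<psi> T \<xi> = lpsi_of G \<psi> (\<lambda>k. 0)}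
    - psi_dim G \<psi> T (lpsi_closure G \<psi> T (lpsi_pow_of G \<psi> T ` gr_cycles G T))"

end

theory Submission
  imports Defs "HOL-Library.Function_Algebras"
begin

text \<open>
  The two subspaces whose dimensions are compared are in fact equal.

  Since \<open>\<Gamma>\<close> is connected, some walk \<open>a 0, \<dots>, a m\<close> of generators visits all vertices, and
  neighbours on the walk commute.  The \<open>m + 1\<close> generators and the \<open>m\<close> commutation relations give a
  complex \<open>\<complex>[G]\<^sup>m \<rightarrow> \<complex>[G]\<^sup>m\<^sup>+\<^sup>1 \<rightarrow> \<complex>[G]\<close> of Euler characteristic \<open>0\<close>, so the outgoing map
  together with the adjoint of the incoming one is a square matrix \<open>D\<close> over the group ring, with
  \<open>D\<^sup>*D\<close> the Laplacian in the middle degree.  Regularity of the subgroups \<open>\<langle>a i\<rangle>\<close> makes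
  \<open>1 - a i\<close>, and hence \<open>D\<^sup>*\<close>, injective on the completion.  The powers of \<open>1 - r DD\<^sup>*\<close> therefore
  converge strongly to \<open>0\<close>, and so do those of \<open>1 - r D\<^sup>*D\<close>, because both have the same trace.
  Every power of \<open>1 - r D\<^sup>*D\<close> is the identity modulo cycles and multiples of the boundary, so an
  element of the kernel of the boundary map is a limit of cycles of the group ring.
\<close>

section \<open>Semi-inner products\<close>

text \<open>All analysis takes place on finitely supported functions with a seminorm; the completion
  enters only through Cauchy sequences, and neither a projection nor a dimension is ever computed.
  The obstacle is that the projection onto harmonic tuples leaves the group ring; a finite power of
  the heat operator does not, and this is what produces cycles of the group ring. Injectivity of
  \<open>1 - a i\<close> comes from averaging: a vector almost fixed by \<open>a i\<close> is close
  to its mean over the first \<open>N\<close> powers of \<open>a i\<close>, while the mean of a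
  group ring element has norm of order 1/sqrt N. The adjoint of the square matrix inherits
  injectivity because its two blocks have orthogonal images: one is detected in a single coordinate,
  the other is bidiagonal along the walk with entries \<open>1 - a k\<close> up to sign, so back
  substitution applies. Using every commutation relation instead of those along a walk would in
  general not give a square matrix. The walk may repeat vertices, and the Betti number refers to a
  different generating set; bounded lifts in both directions transfer the approximation.\<close>

instantiation "fun" :: (type, real_vector) real_vector
begin

definition scaleR_fun :: "real \<Rightarrow> ('a \<Rightarrow> 'b) \<Rightarrow> 'a \<Rightarrow> 'b" where
  "scaleR_fun r f = (\<lambda>x. r *\<^sub>R f x)"

instance
  by standard (auto simp: scaleR_fun_def fun_eq_iff algebra_simps)

end

lemma scaleR_fun_apply [simp]: "(r *\<^sub>R f) x = r *\<^sub>R f x"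
  by (simp add: scaleR_fun_def)

lemma sum_fun_apply [simp]: "(\<Sum>i\<in>I. f i) x = (\<Sum>i\<in>I. f i x)"
  by (induction I rule: infinite_finite_induct) auto

text \<open>A form on a subset instead of a type class: the group ring and the tuples over it become
  two instances of one theory, and null vectors need not be divided out. Real scalars suffice, since
  the real part of the form determines the seminorm.\<close>

locale semi_inner =
  fixes V :: "'v::real_vector set" and ip :: "'v \<Rightarrow> 'v \<Rightarrow> real"
  assumes V_subspace: "subspace V"
    and ip_add_left: "\<And>x y z. x \<in> V \<Longrightarrow> y \<in> V \<Longrightarrow> z \<in> V \<Longrightarrow> ip (x + y) z = ip x z + ip y z"
    and ip_scale_left: "\<And>r x y. x \<in> V \<Longrightarrow> y \<in> V \<Longrightarrow> ip (r *\<^sub>R x) y = r * ip x y"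
    and ip_sym: "\<And>x y. x \<in> V \<Longrightarrow> y \<in> V \<Longrightarrow> ip x y = ip y x"
    and ip_nonneg: "\<And>x. x \<in> V \<Longrightarrow> 0 \<le> ip x x"
begin

lemma V_zero [simp]: "0 \<in> V"
  and V_add [simp]: "x \<in> V \<Longrightarrow> y \<in> V \<Longrightarrow> x + y \<in> V"
  and V_scale [simp]: "x \<in> V \<Longrightarrow> r *\<^sub>R x \<in> V"
  and V_diff [simp]: "x \<in> V \<Longrightarrow> y \<in> V \<Longrightarrow> x - y \<in> V"
  and V_minus [simp]: "x \<in> V \<Longrightarrow> - x \<in> V"
  and V_sum: "(\<And>i. i \<in> I \<Longrightarrow> f i \<in> V) \<Longrightarrow> sum f I \<in> V"
  using V_subspace by (auto simp: subspace_0 subspace_add subspace_scale subspace_diff subspace_neg subspace_sum)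

definition nrm :: "'v \<Rightarrow> real" where
  "nrm x = sqrt (ip x x)"

lemma ip_add_right: "x \<in> V \<Longrightarrow> y \<in> V \<Longrightarrow> z \<in> V \<Longrightarrow> ip z (x + y) = ip z x + ip z y"
  using ip_add_left ip_sym by simp

lemma ip_scale_right: "x \<in> V \<Longrightarrow> y \<in> V \<Longrightarrow> ip y (r *\<^sub>R x) = r * ip y x"
  using ip_scale_left ip_sym by simp

lemma ip_diff_left: "x \<in> V \<Longrightarrow> y \<in> V \<Longrightarrow> z \<in> V \<Longrightarrow> ip (x - y) z = ip x z - ip y z"
  using ip_add_left[of "x - y" y z] by simp

lemma ip_diff_right: "x \<in> V \<Longrightarrow> y \<in> V \<Longrightarrow> z \<in> V \<Longrightarrow> ip z (x - y) = ip z x - ip z y"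
  using ip_diff_left ip_sym by simp

lemma ip_zero_left [simp]: "x \<in> V \<Longrightarrow> ip 0 x = 0"
  using ip_scale_left[of x x 0] by simp

lemma ip_zero_right [simp]: "x \<in> V \<Longrightarrow> ip x 0 = 0"
  using ip_scale_right[of x x 0] by simp

lemmas ip_simps = ip_add_left ip_add_right ip_diff_left ip_diff_right ip_scale_left ip_scale_right

lemma nrm_nonneg [simp]: "x \<in> V \<Longrightarrow> 0 \<le> nrm x"
  by (simp add: nrm_def ip_nonneg)

lemma nrm_sq: "x \<in> V \<Longrightarrow> (nrm x)\<^sup>2 = ip x x"
  by (simp add: nrm_def ip_nonneg)

lemma nrm_zero [simp]: "nrm 0 = 0"
  by (simp add: nrm_def)

lemma nrm_scale: "x \<in> V \<Longrightarrow> nrm (r *\<^sub>R x) = \<bar>r\<bar> * nrm x"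
  by (simp add: nrm_def ip_simps real_sqrt_mult flip: mult.assoc)

lemma ip_cauchy_schwarz_sq:
  assumes "x \<in> V" "y \<in> V"
  shows "(ip x y)\<^sup>2 \<le> ip x x * ip y y"
proof -
  have q: "0 \<le> ip x x + 2 * t * ip x y + t\<^sup>2 * ip y y" for t
  proof -
    have "0 \<le> ip (x + t *\<^sub>R y) (x + t *\<^sub>R y)"
      using assms by (intro ip_nonneg) auto
    then show ?thesis
      using assms ip_sym[of x y] by (simp add: ip_simps power2_eq_square algebra_simps)
  qed
  show ?thesis
  proof (cases "ip y y = 0")
    case True
    have "ip x y = 0"
    proof (rule ccontr)
      assume "ip x y \<noteq> 0"
      \<comment> \<open>At this value of \<open>t\<close> the quadratic equals -1.\<close>
      then show False
        using q[of "- (ip x x + 1) / (2 * ip x y)"] True by (simp add: field_simps)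
    qed
    then show ?thesis using True by simp
  next
    case False
    then have "0 < ip y y" using ip_nonneg[OF assms(2)] by simp
    \<comment> \<open>The minimum of the quadratic in \<open>t\<close>.\<close>
    moreover have "0 \<le> ip x x - (ip x y)\<^sup>2 / ip y y"
      using q[of "- ip x y / ip y y"] False by (simp add: power2_eq_square field_simps)
    ultimately show ?thesis by (simp add: field_simps)
  qed
qed

lemma ip_le_nrm: "x \<in> V \<Longrightarrow> y \<in> V \<Longrightarrow> ip x y \<le> nrm x * nrm y"
  unfolding nrm_def real_sqrt_mult[symmetric]
  by (rule real_le_rsqrt[OF ip_cauchy_schwarz_sq])

lemma nrm_triangle:
  assumes "x \<in> V" "y \<in> V"
  shows "nrm (x + y) \<le> nrm x + nrm y"
proof (rule power2_le_imp_le)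
  show "(nrm (x + y))\<^sup>2 \<le> (nrm x + nrm y)\<^sup>2"
    using assms ip_le_nrm[OF assms] ip_sym[of x y]
    by (simp add: nrm_sq ip_simps power2_sum)
qed (use assms in simp)

lemma nrm_diff_commute: "x \<in> V \<Longrightarrow> y \<in> V \<Longrightarrow> nrm (x - y) = nrm (y - x)"
  using nrm_scale[of "y - x" "-1"] by simp

lemma nrm_triangle_diff: "x \<in> V \<Longrightarrow> y \<in> V \<Longrightarrow> nrm (x - y) \<le> nrm x + nrm y"
  using nrm_triangle[of x "(-1) *\<^sub>R y"] nrm_scale[of y "-1"] by simp

lemma nrm_triangle_sub: "x \<in> V \<Longrightarrow> y \<in> V \<Longrightarrow> nrm x \<le> nrm (x - y) + nrm y"
  using nrm_triangle[of "x - y" y] by simp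

lemma nrm_sum: "(\<And>i. i \<in> I \<Longrightarrow> f i \<in> V) \<Longrightarrow> nrm (sum f I) \<le> (\<Sum>i\<in>I. nrm (f i))"
proof (induction I rule: infinite_finite_induct)
  case (insert i I)
  then have "nrm (f i + sum f I) \<le> nrm (f i) + nrm (sum f I)"
    by (intro nrm_triangle V_sum) auto
  with insert show ?case by simp
qed auto

lemma ip_sum_left:
  "(\<And>i. i \<in> I \<Longrightarrow> f i \<in> V) \<Longrightarrow> z \<in> V \<Longrightarrow> ip (sum f I) z = (\<Sum>i\<in>I. ip (f i) z)"
  by (induction I rule: infinite_finite_induct) (auto simp: ip_simps V_sum)

lemma ip_sum_right:
  "(\<And>i. i \<in> I \<Longrightarrow> f i \<in> V) \<Longrightarrow> z \<in> V \<Longrightarrow> ip z (sum f I) = (\<Sum>i\<in>I. ip z (f i))"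
  by (induction I rule: infinite_finite_induct) (auto simp: ip_simps V_sum)

definition cauchy :: "(nat \<Rightarrow> 'v) \<Rightarrow> bool" where
  "cauchy x \<longleftrightarrow> (\<forall>n. x n \<in> V) \<and> (\<forall>e>0. \<exists>N. \<forall>m\<ge>N. \<forall>n\<ge>N. nrm (x m - x n) < e)"

lemma cauchy_V [simp]: "cauchy x \<Longrightarrow> x n \<in> V"
  by (simp add: cauchy_def)

text \<open>In the completion of \<open>V\<close> this says that the extension of \<open>M\<close> is injective.\<close>

definition cauchy_injective :: "('v \<Rightarrow> 'v) \<Rightarrow> bool" where
  "cauchy_injective M \<longleftrightarrow>
    (\<forall>x. cauchy x \<longrightarrow> (\<lambda>n. nrm (M (x n))) \<longlonglongrightarrow> 0 \<longrightarrow> (\<lambda>n. nrm (x n)) \<longlonglongrightarrow> 0)"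

lemma tendsto_sandwich_nrm:
  assumes "\<And>n. x n \<in> V" "\<And>n. nrm (x n) \<le> f n" "f \<longlonglongrightarrow> 0"
  shows "(\<lambda>n. nrm (x n)) \<longlonglongrightarrow> 0"
  using tendsto_sandwich[of "\<lambda>_. 0" "\<lambda>n. nrm (x n)" sequentially f 0] assms by auto

text \<open>Components outside \<open>I\<close> are required to lie in \<open>V\<close> but are
  invisible to the form, hence null directions.\<close>

lemma semi_inner_tuple:
  "semi_inner {x :: 'i \<Rightarrow> 'v. \<forall>i. x i \<in> V} (\<lambda>x y. \<Sum>i\<in>I. ip (x i) (y i))"
proof
  show "subspace {x :: 'i \<Rightarrow> 'v. \<forall>i. x i \<in> V}"
    by (rule subspaceI) auto
qed (auto simp: ip_simps sum.distrib sum_distrib_left ip_nonneg intro!: sum_nonneg sum.cong ip_sym)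

end

section \<open>Powers of 1 - M'M without spectral theory\<close>

locale adjoint_pair = semi_inner +
  fixes M M' :: "'a \<Rightarrow> 'a"
  assumes M_linear: "linear M" and M'_linear: "linear M'"
    and M_V [simp]: "\<And>x. x \<in> V \<Longrightarrow> M x \<in> V" and M'_V [simp]: "\<And>x. x \<in> V \<Longrightarrow> M' x \<in> V"
    and adjoint: "\<And>x y. x \<in> V \<Longrightarrow> y \<in> V \<Longrightarrow> ip (M x) y = ip x (M' y)"
    and M'_contraction: "\<And>x. x \<in> V \<Longrightarrow> nrm (M' x) \<le> nrm x"
begin

definition C :: "'a \<Rightarrow> 'a" where
  "C x = x - M' (M x)"

lemma C_V [simp]: "x \<in> V \<Longrightarrow> C x \<in> V"
  by (simp add: C_def)

lemma C_pow_V [simp]: "x \<in> V \<Longrightarrow> (C ^^ n) x \<in> V"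
  by (induction n) auto

lemma linear_C: "linear C"
  by (rule linearI)
    (simp_all add: C_def linear_add[OF M_linear] linear_add[OF M'_linear]
      linear_scale[OF M_linear] linear_scale[OF M'_linear] algebra_simps)

lemma linear_C_pow: "linear (C ^^ n)"
proof (induction n)
  case (Suc n)
  then show ?case using linear_compose[OF Suc linear_C] by (simp only: funpow.simps)
qed (simp add: id_def linear_ident)

lemma adjoint': "x \<in> V \<Longrightarrow> y \<in> V \<Longrightarrow> ip (M' x) y = ip x (M y)"
  using adjoint ip_sym by simp

lemma C_symmetric: "x \<in> V \<Longrightarrow> y \<in> V \<Longrightarrow> ip (C x) y = ip x (C y)"
  by (simp add: C_def ip_simps adjoint adjoint')

lemma C_pow_symmetric: "x \<in> V \<Longrightarrow> y \<in> V \<Longrightarrow> ip ((C ^^ n) x) y = ip x ((C ^^ n) y)"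
proof (induction n arbitrary: x y)
  case (Suc n)
  then show ?case using Suc.IH[of x "C y"] by (simp add: C_symmetric funpow_swap1)
qed simp

lemma ip_C: "x \<in> V \<Longrightarrow> ip (C x) x = (nrm x)\<^sup>2 - (nrm (M x))\<^sup>2"
  by (simp add: C_def ip_simps adjoint' nrm_sq)

text \<open>Expanding the square of \<open>x - M' (M x)\<close> gives the cross term -2 |M x|^2, and
  the contraction \<open>M'\<close> lets the last term eat only one |M x|^2.\<close>

lemma C_decrease:
  assumes "x \<in> V"
  shows "(nrm (C x))\<^sup>2 \<le> (nrm x)\<^sup>2 - (nrm (M x))\<^sup>2"
proof -
  have "(nrm (M' (M x)))\<^sup>2 \<le> (nrm (M x))\<^sup>2"
    using M'_contraction[of "M x"] assms by (intro power_mono) auto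
  then show ?thesis
    using assms adjoint[of x "M x"] adjoint'[of "M x" x] by (simp add: nrm_sq C_def ip_simps)
qed

lemma C_contraction:
  assumes "x \<in> V"
  shows "nrm (C x) \<le> nrm x"
proof (rule power2_le_imp_le)
  show "(nrm (C x))\<^sup>2 \<le> (nrm x)\<^sup>2"
    using C_decrease[OF assms] zero_le_power2[of "nrm (M x)"] by linarith
qed (simp add: assms)

lemma C_pow_contraction: "x \<in> V \<Longrightarrow> nrm ((C ^^ n) x) \<le> nrm x"
proof (induction n)
  case (Suc n)
  then show ?case using C_contraction[of "(C ^^ n) x"] by simp
qed simp

text \<open>All distances between powers are expressed by the moments \<open>q n\<close>, so
  convergence of \<open>q\<close> is enough. The even moments are squared norms and decrease; an odd
  moment differs from the preceding even one by a squared defect |M y|^2, which is dominated by a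
  difference of consecutive even moments and so tends to 0.\<close>

lemma C_pow_cauchy:
  assumes "x \<in> V"
  shows "cauchy (\<lambda>n. (C ^^ n) x)" and "(\<lambda>n. nrm (M ((C ^^ n) x))) \<longlonglongrightarrow> 0"
proof -
  let ?y = "\<lambda>n. (C ^^ n) x"
  define q where "q n = ip (?y n) x" for n
  have ip_y: "ip (?y m) (?y n) = q (m + n)" for m n
    using assms C_pow_symmetric[of "?y m" x n] by (simp add: q_def funpow_add add.commute[of m n])
  have even: "q (2 * n) = (nrm (?y n))\<^sup>2" for n
    using assms ip_y[of n n] by (simp add: nrm_sq mult_2)
  have odd: "q (2 * n + 1) = (nrm (?y n))\<^sup>2 - (nrm (M (?y n)))\<^sup>2" for n
    using assms ip_y[of "Suc n" n] ip_C[of "?y n"] by (simp add: mult_2)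
  have step: "(nrm (M (?y n)))\<^sup>2 \<le> q (2 * n) - q (2 * Suc n)" for n
    using C_decrease[of "?y n"] assms unfolding even by simp
  have "decseq (\<lambda>n. q (2 * n))"
  proof (rule decseq_SucI)
    show "q (2 * Suc n) \<le> q (2 * n)" for n
      using step[of n] zero_le_power2[of "nrm (M (?y n))"] by linarith
  qed
  then obtain l where l: "(\<lambda>n. q (2 * n)) \<longlonglongrightarrow> l"
    by (rule decseq_convergent[of _ 0]) (simp_all add: even)
  have "(\<lambda>n. q (2 * n) - q (2 * Suc n)) \<longlonglongrightarrow> l - l"
    using l LIMSEQ_Suc[OF l] by (rule tendsto_diff)
  then have M2: "(\<lambda>n. (nrm (M (?y n)))\<^sup>2) \<longlonglongrightarrow> 0"
    by (intro tendsto_sandwich[of "\<lambda>_. 0" "\<lambda>n. (nrm (M (?y n)))\<^sup>2" sequentially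
          "\<lambda>n. q (2 * n) - q (2 * Suc n)" 0]) (use step in auto)
  then show "(\<lambda>n. nrm (M (?y n))) \<longlonglongrightarrow> 0"
    using tendsto_real_sqrt[OF M2] assms by simp
  have "(\<lambda>n. q (2 * n + 1)) \<longlonglongrightarrow> l - 0"
    using tendsto_diff[OF l M2] unfolding odd even .
  then have l': "(\<lambda>n. q (2 * n + 1)) \<longlonglongrightarrow> l" by simp
  have lim: "q \<longlonglongrightarrow> l"
  proof (rule LIMSEQ_I)
    fix e :: real assume "e > 0"
    obtain N1 where N1: "\<And>n. n \<ge> N1 \<Longrightarrow> norm (q (2 * n) - l) < e"
      using LIMSEQ_D[OF l \<open>e > 0\<close>] by blast
    obtain N2 where N2: "\<And>n. n \<ge> N2 \<Longrightarrow> norm (q (2 * n + 1) - l) < e"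
      using LIMSEQ_D[OF l' \<open>e > 0\<close>] by blast
    have "norm (q n - l) < e" if "n \<ge> 2 * max N1 N2" for n
    proof (cases "even n")
      case True
      then show ?thesis using N1[of "n div 2"] that by auto
    next
      case False
      then show ?thesis using N2[of "n div 2"] that by (auto elim!: oddE)
    qed
    then show "\<exists>N. \<forall>n\<ge>N. norm (q n - l) < e" by blast
  qed
  show "cauchy ?y"
    unfolding cauchy_def
  proof safe
    fix e :: real assume "e > 0"
    \<comment> \<open>The squared distance is q(2m) - 2 q(m+n) + q(2n): the limits cancel, and the
      absolute values of the coefficients add up to 4.\<close>
    then have "e\<^sup>2 / 4 > 0" by simp
    then obtain N where N: "\<And>n. n \<ge> N \<Longrightarrow> \<bar>q n - l\<bar> < e\<^sup>2 / 4"
      using LIMSEQ_D[OF lim, of "e\<^sup>2 / 4"] by auto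
    have "nrm (?y m - ?y n) < e" if "m \<ge> N" "n \<ge> N" for m n
    proof (rule power_less_imp_less_base)
      have "(nrm (?y m - ?y n))\<^sup>2 = q (m + m) - 2 * q (m + n) + q (n + n)"
        using assms by (simp add: nrm_sq ip_simps ip_y add.commute)
      then show "(nrm (?y m - ?y n))\<^sup>2 < e\<^sup>2"
        using N[of "m + m"] N[of "m + n"] N[of "n + n"] that by linarith
    qed (use \<open>e > 0\<close> in simp)
    then show "\<exists>N. \<forall>m\<ge>N. \<forall>n\<ge>N. nrm (?y m - ?y n) < e" by blast
  qed (use assms in simp)
qed

lemma C_pow_tendsto:
  "cauchy_injective M \<Longrightarrow> x \<in> V \<Longrightarrow> (\<lambda>n. nrm ((C ^^ n) x)) \<longlonglongrightarrow> 0"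
  using C_pow_cauchy unfolding cauchy_injective_def by blast

end

section \<open>The group ring with the semi-inner product of a character\<close>

locale character_group = group G for G :: "('a, 'b) monoid_scheme" (structure) +
  fixes \<psi> :: "'a \<Rightarrow> complex"
  assumes character: "group_character G \<psi>"
begin

abbreviation GR :: "('a \<Rightarrow> complex) set" where
  "GR \<equiv> group_ring G"

definition ipr :: "('a \<Rightarrow> complex) \<Rightarrow> ('a \<Rightarrow> complex) \<Rightarrow> real" where
  "ipr x y = Re (psi_form G \<psi> x y)"

lemma psi_one: "\<psi> \<one> = 1"
  using character by (simp add: group_character_def)

lemma psi_conj: "g \<in> carrier G \<Longrightarrow> h \<in> carrier G \<Longrightarrow> \<psi> (h \<otimes> g \<otimes> inv h) = \<psi> g"
  using character by (simp add: group_character_def)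

lemma psi_positive:
  "(\<And>i. i < n \<Longrightarrow> g i \<in> carrier G) \<Longrightarrow>
    (\<Sum>i<n. \<Sum>j<n. c i * cnj (c j) * \<psi> (inv (g j) \<otimes> g i)) \<in> \<real>\<^sub>\<ge>\<^sub>0" for n :: nat
  using character by (auto simp: group_character_def positive_type_def)

text \<open>Positivity on the pair \<open>\<one>\<close>, \<open>g\<close> with coefficients 1,
  \<open>z\<close> forces a vanishing imaginary part. The choice \<open>z = 1\<close> compares the
  imaginary parts of \<psi> at \<open>g\<close> and its inverse, \<open>z = \<i>\<close> the real
  parts.\<close>

lemma psi_inv:
  assumes g: "g \<in> carrier G"
  shows "\<psi> (inv g) = cnj (\<psi> g)"
proof -
  have "Im (1 + cnj z * \<psi> (inv g) + (z * \<psi> g + z * cnj z)) = 0" for z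
  proof -
    have "(\<Sum>i<(2::nat). \<Sum>j<(2::nat). (if i = 0 then 1 else z) * cnj (if j = 0 then 1 else z)
        * \<psi> (inv (if j = 0 then \<one> else g) \<otimes> (if i = 0 then \<one> else g))) \<in> \<real>\<^sub>\<ge>\<^sub>0"
      using g by (intro psi_positive[where c = "\<lambda>i. if i = 0 then 1 else z"
            and g = "\<lambda>i. if i = 0 then \<one> else g"]) auto
    then have "1 + cnj z * \<psi> (inv g) + (z * \<psi> g + z * cnj z) \<in> \<real>\<^sub>\<ge>\<^sub>0"
      using g by (simp add: numeral_2_eq_2 psi_one)
    then show ?thesis
      by (simp add: complex_nonneg_Reals_iff)
  qed
  from this[of 1] this[of \<i>] show ?thesis
    by (simp add: complex_eq_iff)
qed

lemma GR_finite: "x \<in> GR \<Longrightarrow> finite {g. x g \<noteq> 0}"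
  and GR_carrier: "x \<in> GR \<Longrightarrow> g \<notin> carrier G \<Longrightarrow> x g = 0"
  and GR_nonzero: "x \<in> GR \<Longrightarrow> x g \<noteq> 0 \<Longrightarrow> g \<in> carrier G"
  and GR_supp: "x \<in> GR \<Longrightarrow> {g. x g \<noteq> 0} \<subseteq> carrier G"
  by (auto simp: group_ring_def)

lemma GR_I: "finite A \<Longrightarrow> A \<subseteq> carrier G \<Longrightarrow> (\<And>g. g \<notin> A \<Longrightarrow> x g = 0) \<Longrightarrow> x \<in> GR"
  unfolding group_ring_def using finite_subset[of "{g. x g \<noteq> 0}" A] by blast

text \<open>The supports over which \<open>psi_form\<close> sums change under addition; finite
  supersets provide a common range of summation.\<close>

lemma psi_form_eq:
  assumes "finite A" "finite B" "\<And>g. g \<notin> A \<Longrightarrow> x g = 0" "\<And>g. g \<notin> B \<Longrightarrow> y g = 0"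
  shows "psi_form G \<psi> x y = (\<Sum>g\<in>A. \<Sum>h\<in>B. x g * cnj (y h) * \<psi> (inv h \<otimes> g))"
proof -
  have "(\<Sum>h | y h \<noteq> 0. x g * cnj (y h) * \<psi> (inv h \<otimes> g))
      = (\<Sum>h\<in>B. x g * cnj (y h) * \<psi> (inv h \<otimes> g))" for g
    using assms(2,4) by (intro sum.mono_neutral_left) auto
  moreover have "(\<Sum>g | x g \<noteq> 0. \<Sum>h\<in>B. x g * cnj (y h) * \<psi> (inv h \<otimes> g))
      = (\<Sum>g\<in>A. \<Sum>h\<in>B. x g * cnj (y h) * \<psi> (inv h \<otimes> g))"
    using assms(1,3) by (intro sum.mono_neutral_left) auto
  ultimately show ?thesis
    by (simp add: psi_form_def)
qed

lemma psi_form_add: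
  assumes "x \<in> GR" "y \<in> GR" "z \<in> GR"
  shows "psi_form G \<psi> (x + y) z = psi_form G \<psi> x z + psi_form G \<psi> y z"
proof -
  define A B where "A = {g. x g \<noteq> 0} \<union> {g. y g \<noteq> 0}" and "B = {g. z g \<noteq> 0}"
  have "finite A" "finite B" using assms GR_finite by (auto simp: A_def B_def)
  moreover have "\<And>g. g \<notin> A \<Longrightarrow> x g = 0" "\<And>g. g \<notin> A \<Longrightarrow> y g = 0" "\<And>g. g \<notin> B \<Longrightarrow> z g = 0"
    by (auto simp: A_def B_def)
  ultimately show ?thesis
    by (simp add: psi_form_eq[of A B] algebra_simps sum.distrib)
qed

lemma psi_form_scale:
  assumes "x \<in> GR" "y \<in> GR"
  shows "psi_form G \<psi> (\<lambda>g. c * x g) (\<lambda>g. d * y g) = c * cnj d * psi_form G \<psi> x y"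
proof -
  define A B where "A = {g. x g \<noteq> 0}" and "B = {g. y g \<noteq> 0}"
  have "finite A" "finite B" using assms GR_finite by (auto simp: A_def B_def)
  moreover have "\<And>g. g \<notin> A \<Longrightarrow> x g = 0" "\<And>g. g \<notin> B \<Longrightarrow> y g = 0"
    by (auto simp: A_def B_def)
  ultimately show ?thesis
    by (simp add: psi_form_eq[of A B] sum_distrib_left mult_ac)
qed

lemma psi_form_swap:
  assumes "x \<in> GR" "y \<in> GR"
  shows "psi_form G \<psi> y x = cnj (psi_form G \<psi> x y)"
proof -
  have "\<psi> (inv g \<otimes> h) = cnj (\<psi> (inv h \<otimes> g))" if "x g \<noteq> 0" "y h \<noteq> 0" for g h
  proof -
    have gh: "g \<in> carrier G" "h \<in> carrier G" using that assms GR_carrier by blast+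
    then show ?thesis using psi_inv[of "inv h \<otimes> g"] by (simp add: inv_mult_group)
  qed
  then show ?thesis
    unfolding psi_form_def
    by (subst sum.swap) (auto intro!: sum.cong simp: mult_ac)
qed

text \<open>\<open>positive_type\<close> speaks of families indexed by an initial segment of the
  naturals, so the support is enumerated.\<close>

lemma psi_form_nonneg:
  assumes "x \<in> GR"
  shows "psi_form G \<psi> x x \<in> \<real>\<^sub>\<ge>\<^sub>0"
proof -
  let ?A = "{g. x g \<noteq> 0}"
  obtain f where f: "bij_betw f {0..<card ?A} ?A"
    using ex_bij_betw_nat_finite[OF GR_finite[OF assms]] by blast
  have "f i \<in> carrier G" if "i < card ?A" for i
    using bij_betw_apply[OF f, of i] that GR_supp[OF assms] by auto
  then have "(\<Sum>i<card ?A. \<Sum>j<card ?A. x (f i) * cnj (x (f j)) * \<psi> (inv (f j) \<otimes> f i)) \<in> \<real>\<^sub>\<ge>\<^sub>0"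
    by (rule psi_positive[where c = "\<lambda>i. x (f i)"])
  also have "(\<Sum>i<card ?A. \<Sum>j<card ?A. x (f i) * cnj (x (f j)) * \<psi> (inv (f j) \<otimes> f i))
      = psi_form G \<psi> x x"
    unfolding psi_form_def lessThan_atLeast0
    by (simp add: sum.reindex_bij_betw[OF f, where g = "\<lambda>h. x _ * cnj (x h) * \<psi> (inv h \<otimes> _)"]
        sum.reindex_bij_betw[OF f, where g = "\<lambda>g. \<Sum>h\<in>?A. x g * cnj (x h) * \<psi> (inv h \<otimes> g)"])
  finally show ?thesis .
qed

lemma subspace_GR: "subspace GR"
proof (rule subspaceI)
  fix x y :: "'a \<Rightarrow> complex" assume "x \<in> GR" "y \<in> GR"
  then show "x + y \<in> GR"
    by (intro GR_I[of "{g. x g \<noteq> 0} \<union> {g. y g \<noteq> 0}"]) (auto simp: GR_finite dest: GR_nonzero)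
next
  fix x :: "'a \<Rightarrow> complex" and r :: real assume "x \<in> GR"
  then show "r *\<^sub>R x \<in> GR"
    by (intro GR_I[of "{g. x g \<noteq> 0}"]) (auto simp: GR_finite dest: GR_nonzero)
qed (auto intro: GR_I[of "{}"])

sublocale gr: semi_inner GR ipr
proof
  show "subspace GR" by (rule subspace_GR)
next
  fix r :: real and x y assume "x \<in> GR" "y \<in> GR"
  moreover have "r *\<^sub>R x = (\<lambda>g. complex_of_real r * x g)"
    by (auto simp: scaleR_conv_of_real)
  ultimately show "ipr (r *\<^sub>R x) y = r * ipr x y"
    using psi_form_scale[of x y "complex_of_real r" 1] by (simp add: ipr_def)
next
  fix x y assume "x \<in> GR" "y \<in> GR"
  then show "ipr x y = ipr y x"
    using psi_form_swap[of x y] by (simp add: ipr_def)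
next
  fix x assume "x \<in> GR"
  then show "0 \<le> ipr x x"
    using psi_form_nonneg[of x] by (simp add: ipr_def complex_nonneg_Reals_iff)
qed (simp add: ipr_def psi_form_add)

lemma psi_seminorm_eq: "psi_seminorm G \<psi> x = gr.nrm x"
  by (simp add: psi_seminorm_def gr.nrm_def ipr_def)

text \<open>The vector space structure in use is real; complex scalars are still required because
  the group elements span the group ring only over the complex numbers.\<close>

definition cscale :: "complex \<Rightarrow> ('a \<Rightarrow> complex) \<Rightarrow> 'a \<Rightarrow> complex" where
  "cscale c x = (\<lambda>g. c * x g)"

lemma cscale_GR [simp]: "x \<in> GR \<Longrightarrow> cscale c x \<in> GR"
  by (intro GR_I[of "{g. x g \<noteq> 0}"]) (auto simp: cscale_def GR_finite dest: GR_nonzero)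

lemma nrm_cscale:
  assumes "x \<in> GR"
  shows "gr.nrm (cscale c x) = cmod c * gr.nrm x"
proof -
  obtain r where "psi_form G \<psi> x x = complex_of_real r"
    using psi_form_nonneg[OF assms] by (auto elim: nonneg_Reals_cases)
  then have "ipr (cscale c x) (cscale c x) = (cmod c)\<^sup>2 * ipr x x"
    using psi_form_scale[OF assms assms, of c c]
    by (simp add: ipr_def cscale_def complex_norm_square[symmetric])
  then show ?thesis
    by (simp add: gr.nrm_def real_sqrt_mult)
qed

lemma gr_basis_GR [simp]: "g \<in> carrier G \<Longrightarrow> gr_basis g \<in> GR"
  by (intro GR_I[of "{g}"]) (auto simp: gr_basis_def)

lemma psi_form_basis:
  assumes "g \<in> carrier G" "h \<in> carrier G"
  shows "psi_form G \<psi> (gr_basis g) (gr_basis h) = \<psi> (inv h \<otimes> g)"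
  by (subst psi_form_eq[of "{g}" "{h}"]) (auto simp: gr_basis_def)

lemma GR_induct [consumes 1, case_names zero add basis]:
  assumes "x \<in> GR" and "P 0"
    and "\<And>x y. x \<in> GR \<Longrightarrow> y \<in> GR \<Longrightarrow> P x \<Longrightarrow> P y \<Longrightarrow> P (x + y)"
    and "\<And>g c. g \<in> carrier G \<Longrightarrow> P (cscale c (gr_basis g))"
  shows "P x"
proof -
  have "x' \<in> GR \<Longrightarrow> {g. x' g \<noteq> 0} \<subseteq> A \<Longrightarrow> P x'" if "finite A" "A \<subseteq> carrier G" for A x'
    using that
  proof (induction A arbitrary: x' rule: finite_induct)
    case empty
    then have "x' = 0" by auto
    then show ?case using assms(2) by (simp only:)
  next
    case (insert a A)
    let ?y = "x' - cscale (x' a) (gr_basis a)"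
    have a: "cscale (x' a) (gr_basis a) \<in> GR" using insert.prems by simp
    have "?y \<in> GR" using a insert.prems by (intro gr.V_diff)
    moreover have "{g. ?y g \<noteq> 0} \<subseteq> A"
      using insert.prems by (auto simp: cscale_def gr_basis_def)
    ultimately have "P ?y" using insert by blast
    then have "P (?y + cscale (x' a) (gr_basis a))"
      using a \<open>?y \<in> GR\<close> insert.prems by (intro assms(3,4)) auto
    then show ?case by simp
  qed
  then show ?thesis using assms(1) GR_finite GR_supp by blast
qed

section \<open>Left and right translations\<close>

definition move :: "('a \<Rightarrow> 'a) \<Rightarrow> ('a \<Rightarrow> complex) \<Rightarrow> 'a \<Rightarrow> complex" where
  "move p x = (\<lambda>k. if k \<in> carrier G then x (p k) else 0)"

lemma linear_move: "linear (move p)"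
  by (rule linearI) (auto simp: move_def)

lemma move_cscale: "move p (cscale c x) = cscale c (move p x)"
  by (auto simp: move_def cscale_def)

lemma bij_betw_move:
  assumes "bij_betw p (carrier G) (carrier G)" "x \<in> GR"
  shows "bij_betw p {k. move p x k \<noteq> 0} {k. x k \<noteq> 0}"
proof -
  have "p ` {k. move p x k \<noteq> 0} = {k. x k \<noteq> 0}"
  proof
    show "{k. x k \<noteq> 0} \<subseteq> p ` {k. move p x k \<noteq> 0}"
    proof
      fix k assume k: "k \<in> {k. x k \<noteq> 0}"
      then have "k \<in> carrier G" using assms(2) GR_carrier by blast
      then obtain l where "l \<in> carrier G" "k = p l"
        using assms(1) by (auto simp: bij_betw_def)
      then show "k \<in> p ` {k. move p x k \<noteq> 0}" using k by (auto simp: move_def)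
    qed
  qed (auto simp: move_def)
  moreover have "{k. move p x k \<noteq> 0} \<subseteq> carrier G" by (auto simp: move_def)
  ultimately show ?thesis
    using assms(1) by (auto simp: bij_betw_def intro: inj_on_subset)
qed

lemma move_GR:
  assumes "bij_betw p (carrier G) (carrier G)" "x \<in> GR"
  shows "move p x \<in> GR"
  using bij_betw_finite[OF bij_betw_move[OF assms]] assms(2)
  by (auto simp: group_ring_def move_def)

lemma psi_form_move:
  assumes p: "bij_betw p (carrier G) (carrier G)"
    and inv: "\<And>g h. g \<in> carrier G \<Longrightarrow> h \<in> carrier G \<Longrightarrow> \<psi> (inv (p h) \<otimes> p g) = \<psi> (inv h \<otimes> g)"
    and x: "x \<in> GR" and y: "y \<in> GR"
  shows "psi_form G \<psi> (move p x) (move p y) = psi_form G \<psi> x y"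
proof -
  have "psi_form G \<psi> x y = (\<Sum>k | move p x k \<noteq> 0. \<Sum>l | move p y l \<noteq> 0.
      x (p k) * cnj (y (p l)) * \<psi> (inv (p l) \<otimes> p k))"
    unfolding psi_form_def
    by (subst sum.reindex_bij_betw[OF bij_betw_move[OF p x], symmetric],
        subst sum.reindex_bij_betw[OF bij_betw_move[OF p y], symmetric]) simp
  also have "\<dots> = psi_form G \<psi> (move p x) (move p y)"
    unfolding psi_form_def by (intro sum.cong) (auto simp: move_def inv split: if_splits)
  finally show ?thesis by simp
qed

text \<open>Pulling functions back along the inverse pushes basis elements forward, so this is right
  multiplication by \<open>g\<close> in the group ring.\<close>

definition R :: "'a \<Rightarrow> ('a \<Rightarrow> complex) \<Rightarrow> 'a \<Rightarrow> complex" where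
  "R g = move (\<lambda>k. k \<otimes> inv g)"

definition L :: "'a \<Rightarrow> ('a \<Rightarrow> complex) \<Rightarrow> 'a \<Rightarrow> complex" where
  "L g = move (\<lambda>k. inv g \<otimes> k)"

lemma bij_R: "g \<in> carrier G \<Longrightarrow> bij_betw (\<lambda>k. k \<otimes> g) (carrier G) (carrier G)"
  by (rule bij_betwI[where g = "\<lambda>k. k \<otimes> inv g"]) (auto simp: m_assoc)

lemma bij_L: "g \<in> carrier G \<Longrightarrow> bij_betw (\<lambda>k. g \<otimes> k) (carrier G) (carrier G)"
  by (rule bij_betwI[where g = "\<lambda>k. inv g \<otimes> k"]) (auto simp flip: m_assoc)

lemma R_GR [simp]: "g \<in> carrier G \<Longrightarrow> x \<in> GR \<Longrightarrow> R g x \<in> GR"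
  unfolding R_def by (intro move_GR bij_R) auto

lemma L_GR [simp]: "g \<in> carrier G \<Longrightarrow> x \<in> GR \<Longrightarrow> L g x \<in> GR"
  unfolding L_def by (intro move_GR bij_L) auto

lemma linear_R: "linear (R g)" and linear_L: "linear (L g)"
  unfolding R_def L_def by (rule linear_move)+

lemma l_inv_cancel: "g \<in> carrier G \<Longrightarrow> h \<in> carrier G \<Longrightarrow> inv g \<otimes> (g \<otimes> h) = h"
  by (simp flip: m_assoc)

lemma R_one [simp]: "x \<in> GR \<Longrightarrow> R \<one> x = x"
  by (auto simp: R_def move_def GR_carrier)

lemma R_R: "g \<in> carrier G \<Longrightarrow> h \<in> carrier G \<Longrightarrow> R h (R g x) = R (g \<otimes> h) x"
  by (auto simp: R_def move_def inv_mult_group m_assoc)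

lemma R_L: "g \<in> carrier G \<Longrightarrow> h \<in> carrier G \<Longrightarrow> R h (L g x) = L g (R h x)"
  by (auto simp: R_def L_def move_def m_assoc)

lemma R_basis: "g \<in> carrier G \<Longrightarrow> h \<in> carrier G \<Longrightarrow> R h (gr_basis g) = gr_basis (g \<otimes> h)"
  by (auto simp: R_def move_def gr_basis_def fun_eq_iff inv_solve_right m_assoc)

lemma L_basis: "g \<in> carrier G \<Longrightarrow> h \<in> carrier G \<Longrightarrow> L g (gr_basis h) = gr_basis (g \<otimes> h)"
  by (auto simp: L_def move_def gr_basis_def fun_eq_iff inv_solve_left' m_assoc)

lemma R_cscale: "R g (cscale c x) = cscale c (R g x)"
  by (simp add: R_def move_cscale)

text \<open>The translation turns the argument of \<psi> into a conjugate, so right translations are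
  isometric because \<psi> is a class function.\<close>

lemma ipr_R:
  assumes "g \<in> carrier G" "x \<in> GR" "y \<in> GR"
  shows "ipr (R g x) (R g y) = ipr x y"
proof -
  have "\<psi> (inv (h \<otimes> inv g) \<otimes> (k \<otimes> inv g)) = \<psi> (inv h \<otimes> k)"
    if "k \<in> carrier G" "h \<in> carrier G" for h k
    using psi_conj[of "inv h \<otimes> k" g] that assms(1) by (simp add: inv_mult_group m_assoc)
  then show ?thesis
    unfolding R_def ipr_def using assms by (subst psi_form_move) (auto intro: bij_R)
qed

text \<open>Here the translating element cancels inside \<open>inv h \<otimes> k\<close> before
  \<psi> is applied.\<close>

lemma ipr_L:
  assumes "g \<in> carrier G" "x \<in> GR" "y \<in> GR"
  shows "ipr (L g x) (L g y) = ipr x y"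
proof -
  have "\<psi> (inv (inv g \<otimes> h) \<otimes> (inv g \<otimes> k)) = \<psi> (inv h \<otimes> k)"
    if "k \<in> carrier G" "h \<in> carrier G" for h k
    using that assms(1) by (simp add: inv_mult_group m_assoc inv_solve_left flip: m_assoc[of g])
  then show ?thesis
    unfolding L_def ipr_def using assms by (subst psi_form_move) (auto intro: bij_L)
qed

lemma nrm_R: "g \<in> carrier G \<Longrightarrow> x \<in> GR \<Longrightarrow> gr.nrm (R g x) = gr.nrm x"
  by (simp add: gr.nrm_def ipr_R)

lemma R_adjoint:
  assumes "g \<in> carrier G" "x \<in> GR" "y \<in> GR"
  shows "ipr (R g x) y = ipr x (R (inv g) y)"
  using ipr_R[of "inv g" "R g x" y] assms by (simp add: R_R)

text \<open>Telescoping: a^(k+1) - 1 = (a^k - 1) a + (a - 1), with right translation by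
  \<open>a\<close> isometric.\<close>

lemma nrm_R_pow_diff:
  fixes k :: nat
  assumes a: "a \<in> carrier G" and x: "x \<in> GR"
  shows "gr.nrm (R (a [^] k) x - x) \<le> real k * gr.nrm (R a x - x)"
proof (induction k)
  case (Suc k)
  have "R (a [^] Suc k) x - x = R a (R (a [^] k) x - x) + (R a x - x)"
    using a by (simp add: linear_diff[OF linear_R] R_R)
  then have "gr.nrm (R (a [^] Suc k) x - x)
      \<le> gr.nrm (R a (R (a [^] k) x - x)) + gr.nrm (R a x - x)"
    using a x by (simp only:) (intro gr.nrm_triangle gr.V_diff R_GR; simp)
  also have "gr.nrm (R a (R (a [^] k) x - x)) = gr.nrm (R (a [^] k) x - x)"
    using a x by (intro nrm_R) auto
  also have "\<dots> + gr.nrm (R a x - x) \<le> real (Suc k) * gr.nrm (R a x - x)"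
    using Suc.IH unfolding of_nat_Suc distrib_right mult_1 by linarith
  finally show ?case .
next
  case 0
  have "R (a [^] (0::nat)) x - x = 0" using x by simp
  then show ?case by (simp only: gr.nrm_zero)
qed

section \<open>Averages over powers and injectivity of a - 1\<close>

definition psum :: "'a \<Rightarrow> nat \<Rightarrow> ('a \<Rightarrow> complex) \<Rightarrow> 'a \<Rightarrow> complex" where
  "psum a N x = (\<Sum>k<N. R (a [^] k) x)"

lemma psum_GR [simp]: "a \<in> carrier G \<Longrightarrow> x \<in> GR \<Longrightarrow> psum a N x \<in> GR"
  unfolding psum_def by (intro gr.V_sum) simp

lemma psum_add: "psum a N (x + y) = psum a N x + psum a N y"
  unfolding psum_def by (simp add: linear_add[OF linear_R] sum.distrib)

lemma psum_diff: "psum a N (x - y) = psum a N x - psum a N y"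
  unfolding psum_def by (simp add: linear_diff[OF linear_R] sum_subtractf)

lemma nrm_psum_le:
  assumes "a \<in> carrier G" "x \<in> GR"
  shows "gr.nrm (psum a N x) \<le> real N * gr.nrm x"
proof -
  have "gr.nrm (psum a N x) \<le> (\<Sum>k<N. gr.nrm (R (a [^] k) x))"
    unfolding psum_def using assms by (intro gr.nrm_sum) simp
  also have "\<dots> = real N * gr.nrm x"
    using assms by (simp add: nrm_R)
  finally show ?thesis .
qed

text \<open>The translates of a group element by the powers of \<open>a\<close> are orthonormal, so a sum of \<open>N\<close> of
  them has norm \<open>sqrt N\<close>.\<close>

lemma nrm_psum_average:
  assumes a: "a \<in> carrier G"
    and orth: "\<And>k l :: nat. k \<noteq> l \<Longrightarrow> \<psi> (inv (a [^] l) \<otimes> a [^] k) = 0"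
    and x: "x \<in> GR"
  shows "(\<lambda>N. gr.nrm (psum a N x) / real N) \<longlonglongrightarrow> 0"
  using x
proof (induction rule: GR_induct)
  case zero
  have "psum a N 0 = 0" for N by (simp add: psum_def linear_0[OF linear_R])
  then show ?case by (simp only: gr.nrm_zero) simp
next
  case (add x y)
  have le: "gr.nrm (psum a N (x + y)) / real N
      \<le> gr.nrm (psum a N x) / real N + gr.nrm (psum a N y) / real N" for N
    using gr.nrm_triangle[of "psum a N x" "psum a N y"] a add.hyps
    by (simp add: psum_add add_divide_distrib[symmetric] divide_right_mono)
  have "0 \<le> gr.nrm (psum a N (x + y)) / real N" for N
    using a add.hyps by simp
  then show ?case
    by (intro tendsto_sandwich[OF _ _ tendsto_const tendsto_add_zero[OF add.IH]] always_eventually allI le)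
next
  case (basis g c)
  have e: "ipr (R (a [^] k) (gr_basis g)) (R (a [^] l) (gr_basis g)) = (if k = l then 1 else 0)"
    for k l :: nat
  proof -
    have "\<psi> (inv (g \<otimes> a [^] l) \<otimes> (g \<otimes> a [^] k)) = \<psi> (inv (a [^] l) \<otimes> a [^] k)"
      using a basis by (simp add: inv_mult_group m_assoc l_inv_cancel)
    then show ?thesis
      using a basis orth[of k l] psi_one by (auto simp: R_basis ipr_def psi_form_basis)
  qed
  have "ipr (psum a N (gr_basis g)) (psum a N (gr_basis g)) = real N" for N
    unfolding psum_def using a basis
    by (subst gr.ip_sum_left) (auto simp: gr.ip_sum_right gr.V_sum e)
  then have n: "gr.nrm (psum a N (gr_basis g)) = sqrt (real N)" for N
    by (simp add: gr.nrm_def)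
  have "psum a N (cscale c (gr_basis g)) = cscale c (psum a N (gr_basis g))" for N
    unfolding psum_def R_cscale by (simp add: fun_eq_iff cscale_def sum_distrib_left)
  \<comment> \<open>For \<open>N = 0\<close> both sides are 0 by the convention on division by
    zero.\<close>
  moreover have "sqrt (real N) / real N = 1 / sqrt (real N)" for N
    by (cases "N = 0") (simp_all add: field_simps)
  ultimately have "gr.nrm (psum a N (cscale c (gr_basis g))) / real N
      = cmod c * (1 / sqrt (real N))" for N
    using a basis by (simp only: nrm_cscale psum_GR gr_basis_GR n flip: times_divide_eq_right)
  moreover have "(\<lambda>N. cmod c * (1 / sqrt (real N))) \<longlonglongrightarrow> 0"
    unfolding times_divide_eq_right mult_1_right
    by (intro tendsto_divide_0[OF tendsto_const] filterlim_at_top_imp_at_infinity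
        filterlim_compose[OF sqrt_at_top] filterlim_real_sequentially)
  ultimately show ?case by simp
qed

text \<open>A mean ergodic argument: \<open>N\<close> times \<open>y n\<close> is close to its sum
  over \<open>N\<close> powers because \<open>y n\<close> is almost invariant; that sum is close to
  the one for the fixed element \<open>y N0\<close>, whose average is small by orthogonality. Each
  of the three errors gets \<open>e / 3\<close>.\<close>

lemma cauchy_injective_R:
  assumes a: "a \<in> carrier G"
    and orth: "\<And>k l :: nat. k \<noteq> l \<Longrightarrow> \<psi> (inv (a [^] l) \<otimes> a [^] k) = 0"
  shows "gr.cauchy_injective (\<lambda>x. R a x - x)"
  unfolding gr.cauchy_injective_def
proof (intro allI impI)
  fix y assume y: "gr.cauchy y" and d: "(\<lambda>n. gr.nrm (R a (y n) - y n)) \<longlonglongrightarrow> 0"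
  show "(\<lambda>n. gr.nrm (y n)) \<longlonglongrightarrow> 0"
  proof (rule LIMSEQ_I)
    fix e :: real assume "e > 0"
    then have e: "e / 3 > 0" by simp
    obtain N0 where N0: "\<And>m n. m \<ge> N0 \<Longrightarrow> n \<ge> N0 \<Longrightarrow> gr.nrm (y m - y n) < e / 3"
      using y e unfolding gr.cauchy_def by blast
    have yV: "y n \<in> GR" for n using y by simp
    obtain N1 where N1: "\<And>N. N \<ge> N1 \<Longrightarrow> \<bar>gr.nrm (psum a N (y N0)) / real N\<bar> < e / 3"
      using LIMSEQ_D[OF nrm_psum_average[OF a orth yV[of N0]] e] by auto
    \<comment> \<open>The length is fixed, and positive, before \<open>n\<close> is chosen, so the
      threshold for almost invariance may depend on it.\<close>
    define N where "N = Suc N1"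
    have N: "real N > 0" by (simp add: N_def)
    have avg: "gr.nrm (psum a N (y N0)) < real N * (e / 3)"
      using N1[of N] N by (simp add: N_def field_simps)
    \<comment> \<open>Each of the \<open>N\<close> translates may be off by up to \<open>N\<close>
      times the defect of \<open>y n\<close>; after averaging one factor \<open>N\<close>
      remains.\<close>
    have "e / (3 * real N) > 0" using e N by simp
    then obtain N2 where N2: "\<And>n. n \<ge> N2 \<Longrightarrow> \<bar>gr.nrm (R a (y n) - y n)\<bar> < e / (3 * real N)"
      using LIMSEQ_D[OF d, of "e / (3 * real N)"] by auto
    have "norm (gr.nrm (y n) - 0) < e" if "n \<ge> max N0 N2" for n
    proof -
      have dn: "real N * gr.nrm (R a (y n) - y n) < e / 3"
      proof -
        have "gr.nrm (R a (y n) - y n) < e / (3 * real N)"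
          using N2[of n] that by auto
        then show ?thesis using N by (simp add: field_simps)
      qed
      have "gr.nrm (real N *\<^sub>R y n - psum a N (y n)) = gr.nrm (\<Sum>k<N. R (a [^] k) (y n) - y n)"
        using a yV gr.nrm_diff_commute[of "real N *\<^sub>R y n" "psum a N (y n)"]
        by (simp add: sum_subtractf sum_constant_scaleR psum_def[of a N "y n", symmetric]
            del: sum_constant)
      also have "\<dots> \<le> (\<Sum>k<N. gr.nrm (R (a [^] k) (y n) - y n))"
        using a yV by (intro gr.nrm_sum gr.V_diff) auto
      also have "\<dots> \<le> (\<Sum>k<N. real N * gr.nrm (R a (y n) - y n))"
      proof (rule sum_mono)
        fix k assume "k \<in> {..<N}"
        then have "real k * gr.nrm (R a (y n) - y n) \<le> real N * gr.nrm (R a (y n) - y n)"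
          using a yV by (intro mult_right_mono) auto
        then show "gr.nrm (R (a [^] k) (y n) - y n) \<le> real N * gr.nrm (R a (y n) - y n)"
          using nrm_R_pow_diff[OF a yV[of n], of k] by linarith
      qed
      also have "\<dots> = real N * (real N * gr.nrm (R a (y n) - y n))" by simp
      finally have 1: "gr.nrm (real N *\<^sub>R y n - psum a N (y n)) \<le> real N * (e / 3)"
        using dn N by (smt (verit) mult_left_mono)
      have "gr.nrm (psum a N (y n)) \<le> gr.nrm (psum a N (y n - y N0)) + gr.nrm (psum a N (y N0))"
        unfolding psum_diff using a yV by (intro gr.nrm_triangle_sub) auto
      also have "gr.nrm (psum a N (y n - y N0)) \<le> real N * (e / 3)"
        using nrm_psum_le[of a "y n - y N0" N] N0[of n N0] that a yV N
        by (smt (verit) gr.V_diff max.boundedE mult_left_mono order_refl)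
      finally have 2: "gr.nrm (psum a N (y n)) < real N * (e / 3) + real N * (e / 3)"
        using avg by linarith
      have "real N * gr.nrm (y n) = gr.nrm (real N *\<^sub>R y n)"
        using yV by (simp add: gr.nrm_scale)
      also have "\<dots> \<le> gr.nrm (real N *\<^sub>R y n - psum a N (y n)) + gr.nrm (psum a N (y n))"
        using a yV by (intro gr.nrm_triangle_sub) auto
      finally have "real N * gr.nrm (y n) < real N * e"
        using 1 2 by (simp add: algebra_simps)
      then show ?thesis using N yV by simp
    qed
    then show "\<exists>N. \<forall>n\<ge>N. norm (gr.nrm (y n) - 0) < e" by blast
  qed
qed

end

section \<open>Matrices over the group ring and their trace\<close>

text \<open>The index type stays open, since the theory is instantiated both at \<open>{..m}\<close>
  and at a generating set of the group.\<close>

locale group_ring_tuples = character_group +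
  fixes I :: "'i set"
  assumes finite_I: "finite I"
begin

definition tuples :: "('i \<Rightarrow> 'a \<Rightarrow> complex) set" where
  "tuples = {x. \<forall>i. x i \<in> GR}"

definition ipt :: "('i \<Rightarrow> 'a \<Rightarrow> complex) \<Rightarrow> ('i \<Rightarrow> 'a \<Rightarrow> complex) \<Rightarrow> real" where
  "ipt x y = (\<Sum>i\<in>I. ipr (x i) (y i))"

sublocale tp: semi_inner tuples ipt
  unfolding tuples_def ipt_def by (rule gr.semi_inner_tuple)

lemma tuplesI: "(\<And>i. x i \<in> GR) \<Longrightarrow> x \<in> tuples"
  and tuplesD [simp]: "x \<in> tuples \<Longrightarrow> x i \<in> GR"
  by (auto simp: tuples_def)

lemma nrm_tuple_sq: "x \<in> tuples \<Longrightarrow> (tp.nrm x)\<^sup>2 = (\<Sum>i\<in>I. (gr.nrm (x i))\<^sup>2)"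
  by (simp add: tp.nrm_sq ipt_def gr.nrm_sq)

lemma nrm_component_le:
  assumes "x \<in> tuples" "i \<in> I"
  shows "gr.nrm (x i) \<le> tp.nrm x"
proof (rule power2_le_imp_le)
  show "(gr.nrm (x i))\<^sup>2 \<le> (tp.nrm x)\<^sup>2"
    unfolding nrm_tuple_sq[OF assms(1)] using assms finite_I by (intro member_le_sum) auto
qed (use assms in simp)

lemma nrm_tuple_le:
  assumes "x \<in> tuples"
  shows "tp.nrm x \<le> (\<Sum>i\<in>I. gr.nrm (x i))"
proof (rule power2_le_imp_le)
  have "(\<Sum>i\<in>J. (gr.nrm (x i))\<^sup>2) \<le> (\<Sum>i\<in>J. gr.nrm (x i))\<^sup>2" for J
  proof (induction J rule: infinite_finite_induct)
    case (insert j J)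
    have "0 \<le> 2 * gr.nrm (x j) * (\<Sum>i\<in>J. gr.nrm (x i))"
      using assms by (intro mult_nonneg_nonneg sum_nonneg) auto
    with insert show ?case by (simp add: power2_sum)
  qed auto
  then show "(tp.nrm x)\<^sup>2 \<le> (\<Sum>i\<in>I. gr.nrm (x i))\<^sup>2"
    using assms by (simp add: nrm_tuple_sq)
qed (use assms in \<open>auto intro: sum_nonneg\<close>)

lemma cscale_zero [simp]: "cscale c 0 = 0"
  by (rule ext) (simp add: cscale_def)

definition single :: "'i \<Rightarrow> ('a \<Rightarrow> complex) \<Rightarrow> 'i \<Rightarrow> 'a \<Rightarrow> complex" where
  "single i y = (\<lambda>k. if k = i then y else 0)"

lemma single_tuples [simp]: "y \<in> GR \<Longrightarrow> single i y \<in> tuples"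
  by (intro tuplesI) (simp add: single_def)

lemma single_same [simp]: "single i y i = y"
  by (simp add: single_def)

lemma single_add: "single i (x + y) = single i x + single i y"
  by (rule ext) (simp add: single_def)

lemma linear_single: "linear (single i)"
  by (rule linearI) (simp_all add: single_def fun_eq_iff)

lemma ipt_single:
  assumes "x \<in> tuples" "y \<in> GR" "i \<in> I"
  shows "ipt x (single i y) = ipr (x i) y" "ipt (single i y) x = ipr y (x i)"
proof -
  have "ipt x (single i y) = (\<Sum>k\<in>I. if k = i then ipr (x i) y else 0)"
    unfolding ipt_def using assms by (intro sum.cong) (auto simp: single_def)
  then show "ipt x (single i y) = ipr (x i) y" using assms finite_I by simp
  then show "ipt (single i y) x = ipr y (x i)"
    using assms tp.ip_sym[of x "single i y"] gr.ip_sym[of "x i" y] by simp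
qed

lemma nrm_single: "y \<in> GR \<Longrightarrow> i \<in> I \<Longrightarrow> tp.nrm (single i y) = gr.nrm y"
  using ipt_single(1)[of "single i y" y i] by (simp add: tp.nrm_def gr.nrm_def)

definition unit_tuple :: "'i \<Rightarrow> 'i \<Rightarrow> 'a \<Rightarrow> complex" where
  "unit_tuple i = single i (gr_basis \<one>)"

lemma unit_tuples [simp]: "unit_tuple i \<in> tuples"
  by (simp add: unit_tuple_def)

section \<open>Left-equivariant maps and matrices\<close>

definition ltr :: "'a \<Rightarrow> ('i \<Rightarrow> 'a \<Rightarrow> complex) \<Rightarrow> 'i \<Rightarrow> 'a \<Rightarrow> complex" where
  "ltr g x = (\<lambda>i. L g (x i))"

definition tcs :: "complex \<Rightarrow> ('i \<Rightarrow> 'a \<Rightarrow> complex) \<Rightarrow> 'i \<Rightarrow> 'a \<Rightarrow> complex" where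
  "tcs c x = (\<lambda>i. cscale c (x i))"

lemma ltr_tuples [simp]: "g \<in> carrier G \<Longrightarrow> x \<in> tuples \<Longrightarrow> ltr g x \<in> tuples"
  by (intro tuplesI) (simp add: ltr_def)

lemma tcs_tuples [simp]: "x \<in> tuples \<Longrightarrow> tcs c x \<in> tuples"
  by (intro tuplesI) (simp add: tcs_def)

lemma nrm_ltr:
  assumes "g \<in> carrier G" "x \<in> tuples"
  shows "tp.nrm (ltr g x) = tp.nrm x"
  using assms by (simp add: tp.nrm_def ipt_def ltr_def ipr_L)

lemma nrm_tcs:
  assumes "x \<in> tuples"
  shows "tp.nrm (tcs c x) = cmod c * tp.nrm x"
proof (rule power2_eq_imp_eq)
  show "(tp.nrm (tcs c x))\<^sup>2 = (cmod c * tp.nrm x)\<^sup>2"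
    unfolding nrm_tuple_sq[OF tcs_tuples[OF assms]] power_mult_distrib nrm_tuple_sq[OF assms]
    using assms by (simp add: sum_distrib_left tcs_def nrm_cscale power_mult_distrib)
qed (use assms in simp_all)

text \<open>Linearity over the complex group ring, split into its generators: additivity, left
  translations and complex scalars. It is the class in which powers and compositions of matrices
  stay.\<close>

definition equivariant :: "(('i \<Rightarrow> 'a \<Rightarrow> complex) \<Rightarrow> 'i \<Rightarrow> 'a \<Rightarrow> complex) \<Rightarrow> bool" where
  "equivariant Y \<longleftrightarrow> linear Y \<and> (\<forall>x\<in>tuples. Y x \<in> tuples)
    \<and> (\<forall>g\<in>carrier G. \<forall>x. Y (ltr g x) = ltr g (Y x)) \<and> (\<forall>c x. Y (tcs c x) = tcs c (Y x))"

lemma equivariant_comp: "equivariant Y \<Longrightarrow> equivariant Z \<Longrightarrow> equivariant (\<lambda>x. Y (Z x))"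
  unfolding equivariant_def using linear_compose[of Z Y] by (auto simp: o_def)

lemma linear_ltr: "linear (ltr g)"
  by (rule linearI) (simp_all add: ltr_def linear_add[OF linear_L] linear_scale[OF linear_L] fun_eq_iff)

lemma linear_tcs: "linear (tcs c)"
  by (rule linearI) (simp_all add: tcs_def cscale_def fun_eq_iff algebra_simps)

lemma equivariant_add:
  assumes "equivariant Y" "equivariant Z"
  shows "equivariant (\<lambda>x. Y x + Z x)"
  using assms linear_compose_add[of Y Z] unfolding equivariant_def
  by (simp add: linear_add[OF linear_ltr] linear_add[OF linear_tcs])

lemma equivariant_scale:
  assumes "equivariant Y"
  shows "equivariant (\<lambda>x. r *\<^sub>R Y x)"
  using assms linear_compose_scale_right[of Y r] unfolding equivariant_def
  by (simp add: linear_scale[OF linear_ltr] linear_scale[OF linear_tcs])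

lemma equivariant_zero: "equivariant (\<lambda>x. 0)"
  unfolding equivariant_def
  by (simp add: linear_0[OF linear_ltr] linear_0[OF linear_tcs] linear_zero)

lemma equivariant_id: "equivariant (\<lambda>x. x)"
  unfolding equivariant_def by (simp add: linear_ident)

lemma equivariant_id_diff: "equivariant Y \<Longrightarrow> equivariant (\<lambda>x. x - Y x)"
  using equivariant_add[OF equivariant_id equivariant_scale[of Y "-1"]] by simp

lemma equivariant_funpow:
  assumes "equivariant Y"
  shows "equivariant (Y ^^ n)"
proof (induction n)
  case (Suc n)
  then show ?case using equivariant_comp[OF assms Suc] by (simp only: funpow.simps comp_def)
next
  case 0
  then show ?case using equivariant_id by (simp only: funpow.simps id_def)
qed

text \<open>\<open>elem i j g\<close> is right multiplication by the matrix with single entry \<open>g\<close> at \<open>(i, j)\<close>;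
  \<open>gr_op A A'\<close> says that \<open>A\<close> is right multiplication by a matrix over \<open>\<real>[G]\<close> and \<open>A'\<close> its
  adjoint.\<close>

definition elem :: "'i \<Rightarrow> 'i \<Rightarrow> 'a \<Rightarrow> ('i \<Rightarrow> 'a \<Rightarrow> complex) \<Rightarrow> 'i \<Rightarrow> 'a \<Rightarrow> complex" where
  "elem i j g x = single j (R g (x i))"

inductive gr_op :: "(('i \<Rightarrow> 'a \<Rightarrow> complex) \<Rightarrow> 'i \<Rightarrow> 'a \<Rightarrow> complex)
    \<Rightarrow> (('i \<Rightarrow> 'a \<Rightarrow> complex) \<Rightarrow> 'i \<Rightarrow> 'a \<Rightarrow> complex) \<Rightarrow> bool" where
  gr_op_elem: "i \<in> I \<Longrightarrow> j \<in> I \<Longrightarrow> g \<in> carrier G \<Longrightarrow> gr_op (elem i j g) (elem j i (inv g))"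
| gr_op_zero: "gr_op (\<lambda>x. 0) (\<lambda>x. 0)"
| gr_op_add: "gr_op A A' \<Longrightarrow> gr_op B B' \<Longrightarrow> gr_op (\<lambda>x. A x + B x) (\<lambda>x. A' x + B' x)"
| gr_op_scale: "gr_op A A' \<Longrightarrow> gr_op (\<lambda>x. r *\<^sub>R A x) (\<lambda>x. r *\<^sub>R A' x)"

lemma gr_op_diff: "gr_op A A' \<Longrightarrow> gr_op B B' \<Longrightarrow> gr_op (\<lambda>x. A x - B x) (\<lambda>x. A' x - B' x)"
  using gr_op_add[OF _ gr_op_scale[of B B' "-1"], of A A'] by simp

lemma gr_op_sum:
  "finite K \<Longrightarrow> (\<And>k. k \<in> K \<Longrightarrow> gr_op (A k) (A' k)) \<Longrightarrow>
    gr_op (\<lambda>x. \<Sum>k\<in>K. A k x) (\<lambda>x. \<Sum>k\<in>K. A' k x)"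
  by (induction K rule: finite_induct) (auto intro: gr_op_zero gr_op_add)

text \<open>Because of this symmetry, everything proved about the first component of the relation
  holds for the adjoint as well.\<close>

lemma gr_op_swap: "gr_op A A' \<Longrightarrow> gr_op A' A"
proof (induction rule: gr_op.induct)
  case (gr_op_elem i j g)
  then show ?case using gr_op.gr_op_elem[of j i "inv g"] by simp
qed (blast intro: gr_op.intros)+

lemma equivariant_elem:
  assumes "g \<in> carrier G"
  shows "equivariant (elem i j g)"
proof -
  have "linear (elem i j g)"
    by (rule linearI)
      (simp_all add: elem_def linear_add[OF linear_R] linear_scale[OF linear_R]
        linear_add[OF linear_single] linear_scale[OF linear_single])
  moreover have "elem i j g (ltr h x) = ltr h (elem i j g x)" if "h \<in> carrier G" for h x
    using assms that by (auto simp: elem_def single_def ltr_def R_L linear_0[OF linear_L] fun_eq_iff)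
  moreover have "elem i j g (tcs c x) = tcs c (elem i j g x)" for c x
    by (rule ext) (simp add: elem_def single_def tcs_def R_cscale)
  ultimately show ?thesis
    using assms by (simp add: equivariant_def elem_def)
qed

lemma gr_op_equivariant: "gr_op A A' \<Longrightarrow> equivariant A"
  by (induction rule: gr_op.induct)
    (blast intro: equivariant_elem equivariant_zero equivariant_add equivariant_scale)+

lemma gr_op_linear: "gr_op A A' \<Longrightarrow> linear A"
  and gr_op_tuples: "gr_op A A' \<Longrightarrow> x \<in> tuples \<Longrightarrow> A x \<in> tuples"
  using gr_op_equivariant unfolding equivariant_def by blast+

lemma gr_op_adjoint:
  assumes "gr_op A A'" and x: "x \<in> tuples" and y: "y \<in> tuples"
  shows "ipt (A x) y = ipt x (A' y)"
  using assms(1)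
proof (induction rule: gr_op.induct)
  case (gr_op_elem i j g)
  then show ?case using x y by (simp add: elem_def ipt_single R_adjoint)
next
  case (gr_op_add A A' B B')
  then have "A x \<in> tuples" "B x \<in> tuples" "A' y \<in> tuples" "B' y \<in> tuples"
    using x y by (blast intro: gr_op_tuples gr_op_swap)+
  then show ?case using x y gr_op_add.IH
    by (simp only: tp.ip_add_left tp.ip_add_right)
next
  case (gr_op_scale A A' r)
  then have "A x \<in> tuples" "A' y \<in> tuples"
    using x y by (blast intro: gr_op_tuples gr_op_swap)+
  then show ?case using x y gr_op_scale.IH
    by (simp only: tp.ip_scale_left tp.ip_scale_right)
qed (simp only: tp.ip_zero_left[OF y] tp.ip_zero_right[OF x])

lemma gr_op_bounded:
  assumes "gr_op A A'"
  shows "\<exists>B\<ge>0. \<forall>x\<in>tuples. tp.nrm (A x) \<le> B * tp.nrm x"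
  using assms
proof (induction rule: gr_op.induct)
  case (gr_op_elem i j g)
  then have "\<forall>x\<in>tuples. tp.nrm (elem i j g x) \<le> 1 * tp.nrm x"
    by (simp add: elem_def nrm_single nrm_R nrm_component_le)
  then show ?case by (intro exI[of _ 1]) simp
next
  case gr_op_zero
  then show ?case by (intro exI[of _ 0]) (simp only: tp.nrm_zero mult_zero_left order_refl simp_thms ball_triv)
next
  case (gr_op_add A A' B B')
  then obtain b c where bc: "b \<ge> 0" "c \<ge> 0"
    and b: "\<And>x. x \<in> tuples \<Longrightarrow> tp.nrm (A x) \<le> b * tp.nrm x"
    and c: "\<And>x. x \<in> tuples \<Longrightarrow> tp.nrm (B x) \<le> c * tp.nrm x" by blast
  have "tp.nrm (A x + B x) \<le> (b + c) * tp.nrm x" if "x \<in> tuples" for x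
    using tp.nrm_triangle[OF gr_op_tuples[OF gr_op_add.hyps(1) that]
        gr_op_tuples[OF gr_op_add.hyps(2) that]] b[OF that] c[OF that]
    unfolding distrib_right by linarith
  moreover have "0 \<le> b + c" using bc by simp
  ultimately show ?case by blast
next
  case (gr_op_scale A A' r)
  then obtain b where b: "b \<ge> 0" "\<And>x. x \<in> tuples \<Longrightarrow> tp.nrm (A x) \<le> b * tp.nrm x" by blast
  have "tp.nrm (r *\<^sub>R A x) \<le> \<bar>r\<bar> * b * tp.nrm x" if "x \<in> tuples" for x
    using mult_left_mono[OF b(2)[OF that], of "\<bar>r\<bar>"]
    unfolding tp.nrm_scale[OF gr_op_tuples[OF gr_op_scale.hyps that]] by (simp add: mult.assoc)
  moreover have "0 \<le> \<bar>r\<bar> * b" using b(1) by simp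
  ultimately show ?case by blast
qed

section \<open>The trace and its cyclicity\<close>

definition trace :: "(('i \<Rightarrow> 'a \<Rightarrow> complex) \<Rightarrow> 'i \<Rightarrow> 'a \<Rightarrow> complex) \<Rightarrow> real" where
  "trace Y = (\<Sum>i\<in>I. ipt (Y (unit_tuple i)) (unit_tuple i))"

lemma trace_add:
  assumes "\<And>x. x \<in> tuples \<Longrightarrow> Y x \<in> tuples" "\<And>x. x \<in> tuples \<Longrightarrow> Z x \<in> tuples"
  shows "trace (\<lambda>x. Y x + Z x) = trace Y + trace Z"
  using assms by (simp add: trace_def tp.ip_add_left sum.distrib)

lemma trace_diff:
  assumes "\<And>x. x \<in> tuples \<Longrightarrow> Y x \<in> tuples" "\<And>x. x \<in> tuples \<Longrightarrow> Z x \<in> tuples"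
  shows "trace (\<lambda>x. Y x - Z x) = trace Y - trace Z"
  using assms by (simp add: trace_def tp.ip_diff_left sum_subtractf)

lemma trace_scale:
  assumes "\<And>x. x \<in> tuples \<Longrightarrow> Y x \<in> tuples"
  shows "trace (\<lambda>x. r *\<^sub>R Y x) = r * trace Y"
  using assms by (simp add: trace_def tp.ip_scale_left sum_distrib_left)

text \<open>Both sides reduce to the same entry of \<open>Y\<close>, paired with the inverse of
  \<open>g\<close>: on the left by taking the adjoint of the right translation, on the right by
  pulling a left translation through \<open>Y\<close>.\<close>

lemma trace_elem_commute:
  assumes ij: "i \<in> I" "j \<in> I" and g: "g \<in> carrier G" and Y: "equivariant Y"
  shows "trace (\<lambda>x. elem i j g (Y x)) = trace (\<lambda>x. Y (elem i j g x))"
proof -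
  have YV: "Y x \<in> tuples" if "x \<in> tuples" for x
    using Y that by (simp add: equivariant_def)
  have Y0: "Y 0 = 0" using Y by (simp add: equivariant_def linear_0)
  have "ipt (elem i j g (Y (unit_tuple k))) (unit_tuple k)
      = (if k = j then ipr (Y (unit_tuple j) i) (gr_basis (inv g)) else 0)" if "k \<in> I" for k
  proof -
    have "ipt (elem i j g (Y (unit_tuple k))) (unit_tuple k)
        = ipr (single j (R g (Y (unit_tuple k) i)) k) (gr_basis \<one>)"
      using that g YV[of "unit_tuple k"]
      by (simp add: elem_def unit_tuple_def[of k] ipt_single)
    also have "\<dots> = (if k = j then ipr (Y (unit_tuple j) i) (gr_basis (inv g)) else 0)"
      using g YV[of "unit_tuple j"] by (simp add: single_def R_adjoint R_basis)
    finally show ?thesis .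
  qed
  then have l: "trace (\<lambda>x. elem i j g (Y x)) = ipr (Y (unit_tuple j) i) (gr_basis (inv g))"
    using ij finite_I by (simp add: trace_def)
  have "ipt (Y (elem i j g (unit_tuple k))) (unit_tuple k)
      = (if k = i then ipr (Y (unit_tuple j) i) (gr_basis (inv g)) else 0)" if "k \<in> I" for k
  proof (cases "k = i")
    case True
    \<comment> \<open>At the identity, right and left multiplication by \<open>g\<close> agree; the
      left one commutes with \<open>Y\<close>.\<close>
    have "elem i j g (unit_tuple i) = ltr g (unit_tuple j)"
      using g by (auto simp: elem_def unit_tuple_def ltr_def single_def R_basis L_basis
          linear_0[OF linear_L] fun_eq_iff)
    then have "ipt (Y (elem i j g (unit_tuple k))) (unit_tuple k)
        = ipt (ltr g (Y (unit_tuple j))) (unit_tuple i)"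
      using True Y g by (simp add: equivariant_def)
    also have "\<dots> = ipr (L g (Y (unit_tuple j) i)) (L g (gr_basis (inv g)))"
      using ij g YV[of "unit_tuple j"]
      by (simp add: unit_tuple_def[of i] ipt_single) (simp add: ltr_def L_basis)
    finally show ?thesis using True g YV[of "unit_tuple j"] by (simp add: ipr_L)
  next
    case False
    then have "elem i j g (unit_tuple k) = 0"
      by (auto simp: elem_def unit_tuple_def single_def linear_0[OF linear_R] fun_eq_iff)
    then show ?thesis using False Y0 by simp
  qed
  then have "trace (\<lambda>x. Y (elem i j g x)) = ipr (Y (unit_tuple j) i) (gr_basis (inv g))"
    using ij finite_I by (simp add: trace_def)
  with l show ?thesis by simp
qed

text \<open>Only one factor has to be a matrix, which allows induction on it; the other is merely
  equivariant and will later contain powers.\<close>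

lemma trace_commute:
  assumes "gr_op A A'" and Y: "equivariant Y"
  shows "trace (\<lambda>x. A (Y x)) = trace (\<lambda>x. Y (A x))"
  using assms(1)
proof (induction rule: gr_op.induct)
  case (gr_op_elem i j g)
  then show ?case using Y by (intro trace_elem_commute)
next
  case gr_op_zero
  have "Y 0 = 0" using Y by (simp add: equivariant_def linear_0)
  then show ?case by (simp only: zero_fun_def[symmetric])
next
  case (gr_op_add A A' B B')
  have YV: "Y x \<in> tuples" if "x \<in> tuples" for x
    using Y that by (simp add: equivariant_def)
  have lin: "linear Y" using Y by (simp add: equivariant_def)
  note AB = gr_op_tuples[OF gr_op_add.hyps(1)] gr_op_tuples[OF gr_op_add.hyps(2)]
  have "trace (\<lambda>x. A (Y x) + B (Y x)) = trace (\<lambda>x. A (Y x)) + trace (\<lambda>x. B (Y x))"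
    by (intro trace_add AB YV)
  also have "\<dots> = trace (\<lambda>x. Y (A x)) + trace (\<lambda>x. Y (B x))"
    by (simp only: gr_op_add.IH)
  also have "\<dots> = trace (\<lambda>x. Y (A x + B x))"
    unfolding linear_add[OF lin] by (intro trace_add[symmetric] AB YV)
  finally show ?case .
next
  case (gr_op_scale A A' r)
  have YV: "Y x \<in> tuples" if "x \<in> tuples" for x
    using Y that by (simp add: equivariant_def)
  have lin: "linear Y" using Y by (simp add: equivariant_def)
  note AV = gr_op_tuples[OF gr_op_scale.hyps]
  have "trace (\<lambda>x. r *\<^sub>R A (Y x)) = r * trace (\<lambda>x. A (Y x))"
    by (intro trace_scale AV YV)
  also have "\<dots> = r * trace (\<lambda>x. Y (A x))"
    by (simp only: gr_op_scale.IH)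
  also have "\<dots> = trace (\<lambda>x. Y (r *\<^sub>R A x))"
    unfolding linear_scale[OF lin] by (intro trace_scale[symmetric] AV YV)
  finally show ?case .
qed

lemma tendsto_nrm_add:
  assumes "(\<lambda>n. tp.nrm (x n)) \<longlonglongrightarrow> 0" "(\<lambda>n. tp.nrm (y n)) \<longlonglongrightarrow> 0"
    and "\<And>n. x n \<in> tuples" "\<And>n. y n \<in> tuples"
  shows "(\<lambda>n. tp.nrm (x n + y n)) \<longlonglongrightarrow> 0"
  by (rule tp.tendsto_sandwich_nrm[OF _ tp.nrm_triangle tendsto_add_zero[OF assms(1,2)]])
    (use assms in simp_all)

text \<open>Equivariance carries convergence from the units to their left translates and complex
  multiples, and finite sums of these give every tuple supported on \<open>I\<close>.\<close>

lemma tendsto_from_units: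
  assumes Y: "\<And>n. equivariant (Y n)"
    and contr: "\<And>n x. x \<in> tuples \<Longrightarrow> tp.nrm (Y n x) \<le> tp.nrm x"
    and unit: "\<And>i. i \<in> I \<Longrightarrow> (\<lambda>n. tp.nrm (Y n (unit_tuple i))) \<longlonglongrightarrow> 0"
    and x: "x \<in> tuples"
  shows "(\<lambda>n. tp.nrm (Y n x)) \<longlonglongrightarrow> 0"
proof -
  have YV: "Y n x \<in> tuples" if "x \<in> tuples" for x n
    using Y[of n] that by (simp add: equivariant_def)
  have lin: "linear (Y n)" for n using Y by (simp add: equivariant_def)
  have sgl: "(\<lambda>n. tp.nrm (Y n (single i y))) \<longlonglongrightarrow> 0" if "y \<in> GR" "i \<in> I" for i y
    using that(1)
  proof (induction rule: GR_induct)
    case zero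
    have "Y n (single i 0) = 0" for n
      by (simp only: linear_0[OF linear_single] linear_0[OF lin])
    then show ?case by (simp only: tp.nrm_zero tendsto_const)
  next
    case (add x y)
    then show ?case
      unfolding single_add linear_add[OF lin] by (intro tendsto_nrm_add) (auto intro: YV)
  next
    case (basis g c)
    have s: "single i (cscale c (gr_basis g)) = tcs c (ltr g (unit_tuple i))"
      using basis by (auto simp: single_def tcs_def ltr_def unit_tuple_def L_basis fun_eq_iff
          cscale_def linear_0[OF linear_L])
    have "tp.nrm (Y n (single i (cscale c (gr_basis g)))) = cmod c * tp.nrm (Y n (unit_tuple i))"
      for n
    proof -
      have "Y n (tcs c (ltr g (unit_tuple i))) = tcs c (ltr g (Y n (unit_tuple i)))"
        using Y[of n] basis by (simp add: equivariant_def)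
      then show ?thesis
        unfolding s using basis YV by (simp add: nrm_tcs nrm_ltr)
    qed
    then show ?case using tendsto_mult_right_zero[OF unit[OF that(2)]] by simp
  qed
  define z where "z = (\<Sum>i\<in>I. single i (x i))"
  have zV: "z \<in> tuples" unfolding z_def using x by (intro tp.V_sum) simp
  have "(x - z) i = 0" if "i \<in> I" for i
    using that finite_I by (simp add: z_def single_def if_distrib[of "\<lambda>f. f _"] cong: if_cong)
  \<comment> \<open>\<open>x\<close> and \<open>z\<close> may differ outside \<open>I\<close>; that
    difference is a null vector, and contractions keep it null.\<close>
  then have "tp.nrm (x - z) = 0"
    by (simp add: tp.nrm_def ipt_def)
  then have 1: "(\<lambda>n. tp.nrm (Y n (x - z))) \<longlonglongrightarrow> 0"
    using contr[of "x - z"] x zV YV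
    by (intro tp.tendsto_sandwich_nrm[where f = "\<lambda>_. 0"]) auto
  have "(\<lambda>n. tp.nrm (\<Sum>i\<in>J. Y n (single i (x i)))) \<longlonglongrightarrow> 0" if "J \<subseteq> I" for J
    using finite_subset[OF that finite_I] that
  proof (induction J rule: finite_induct)
    case empty
    show ?case by (simp only: sum.empty tp.nrm_zero tendsto_const)
  next
    case (insert i J)
    have V: "Y n (single j (x j)) \<in> tuples" for n j using x by (intro YV) simp
    have "i \<in> I" "J \<subseteq> I" using insert.prems by auto
    then show ?case
      unfolding sum.insert[OF insert.hyps]
      by (intro tendsto_nrm_add sgl insert.IH tp.V_sum V) (simp_all add: x)
  qed
  from this[OF order_refl] have 2: "(\<lambda>n. tp.nrm (Y n z)) \<longlonglongrightarrow> 0"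
    unfolding z_def linear_sum[OF lin] .
  have "Y n x = Y n (x - z) + Y n z" for n
    using linear_add[OF lin[of n], of "x - z" z] by simp
  then show ?thesis using tendsto_nrm_add[OF 1 2] YV x zV by simp
qed

lemma gr_op_adjoint_pair:
  assumes "gr_op A A'" and "\<And>x. x \<in> tuples \<Longrightarrow> tp.nrm (A' x) \<le> tp.nrm x"
  shows "adjoint_pair tuples ipt A A'"
proof (intro adjoint_pair.intro adjoint_pair_axioms.intro)
  show "semi_inner tuples ipt" by (rule tp.semi_inner_axioms)
  show "linear A" "linear A'"
    using assms(1) by (blast intro: gr_op_linear gr_op_swap)+
  show "A x \<in> tuples" "A' x \<in> tuples" if "x \<in> tuples" for x
    using assms(1) that by (blast intro: gr_op_tuples gr_op_swap)+
  show "ipt (A x) y = ipt x (A' y)" if "x \<in> tuples" "y \<in> tuples" for x y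
    using assms(1) that by (rule gr_op_adjoint)
  show "tp.nrm (A' x) \<le> tp.nrm x" if "x \<in> tuples" for x
    using that by (rule assms(2))
qed

text \<open>Here the trace replaces the dimension theory of Hilbert modules: a square matrix whose adjoint
  is injective on the completion is itself injective.\<close>

lemma adjoint_powers_tendsto:
  assumes op: "gr_op A A'"
    and contr: "\<And>x. x \<in> tuples \<Longrightarrow> tp.nrm (A x) \<le> tp.nrm x"
      "\<And>x. x \<in> tuples \<Longrightarrow> tp.nrm (A' x) \<le> tp.nrm x"
    and inj: "tp.cauchy_injective A" and x: "x \<in> tuples"
  shows "(\<lambda>n. tp.nrm (((\<lambda>x. x - A (A' x)) ^^ n) x)) \<longlonglongrightarrow> 0"
proof -
  note op' = gr_op_swap[OF op]
  interpret p: adjoint_pair tuples ipt A A'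
    using op contr(2) by (rule gr_op_adjoint_pair)
  interpret q: adjoint_pair tuples ipt A' A
    using op' contr(1) by (rule gr_op_adjoint_pair)
  have qC: "(\<lambda>x. x - A (A' x)) = q.C" by (simp add: q.C_def fun_eq_iff)
  note eqA = gr_op_equivariant[OF op] and eqA' = gr_op_equivariant[OF op']
  have eq_q: "equivariant q.C"
    unfolding qC[symmetric] by (rule equivariant_id_diff[OF equivariant_comp[OF eqA eqA']])
  have inter: "A ((p.C ^^ n) y) = (q.C ^^ n) (A y)" for n y
  proof (induction n arbitrary: y)
    case (Suc n)
    have "A (p.C y) = q.C (A y)" for y
      by (simp only: p.C_def q.C_def linear_diff[OF p.M_linear])
    then show ?case using Suc by simp
  qed simp
  \<comment> \<open>Intertwining moves the powers of \<open>p.C\<close> past \<open>A\<close>, so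
    the newly split off term has trace of \<open>A' q^n A\<close>, and cyclicity turns this into the
    trace of \<open>q^n A A'\<close>.\<close>
  have tr: "trace (p.C ^^ n) = trace (q.C ^^ n)" for n
  proof (induction n)
    case (Suc n)
    have "trace (p.C ^^ Suc n) = trace (\<lambda>x. (p.C ^^ n) x - A' ((q.C ^^ n) (A x)))"
      by (simp only: funpow.simps comp_def p.C_def[of "(p.C ^^ n) _"] inter)
    also have "\<dots> = trace (p.C ^^ n) - trace (\<lambda>x. A' ((q.C ^^ n) (A x)))"
      by (rule trace_diff) simp_all
    also have "trace (\<lambda>x. A' ((q.C ^^ n) (A x))) = trace (\<lambda>x. (q.C ^^ n) (A (A' x)))"
      using trace_commute[OF op' equivariant_comp[OF equivariant_funpow[OF eq_q] eqA]] .
    also have "trace (p.C ^^ n) - \<dots> = trace (\<lambda>x. (q.C ^^ n) x - (q.C ^^ n) (A (A' x)))"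
      unfolding Suc by (rule trace_diff[symmetric]) simp_all
    also have "\<dots> = trace (q.C ^^ Suc n)"
      unfolding funpow_Suc_right comp_def
      by (simp only: q.C_def[of "_"] linear_diff[OF q.linear_C_pow])
    finally show ?case .
  qed simp
  \<comment> \<open>Even powers of a symmetric operator have a sum of squares as trace, so equality
    of traces transfers convergence on the units.\<close>
  have p_sq: "trace (p.C ^^ (n + n)) = (\<Sum>i\<in>I. (tp.nrm ((p.C ^^ n) (unit_tuple i)))\<^sup>2)" for n
    unfolding trace_def
    by (intro sum.cong) (simp_all add: funpow_add p.C_pow_symmetric tp.nrm_sq)
  have q_sq: "trace (q.C ^^ (n + n)) = (\<Sum>i\<in>I. (tp.nrm ((q.C ^^ n) (unit_tuple i)))\<^sup>2)" for n
    unfolding trace_def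
    by (intro sum.cong) (simp_all add: funpow_add q.C_pow_symmetric tp.nrm_sq)
  have "(\<lambda>n. trace (p.C ^^ (n + n))) \<longlonglongrightarrow> (\<Sum>i\<in>I. 0\<^sup>2)"
    unfolding p_sq by (intro tendsto_sum tendsto_power p.C_pow_tendsto inj unit_tuples)
  then have lim: "(\<lambda>n. trace (q.C ^^ (n + n))) \<longlonglongrightarrow> 0"
    by (simp add: tr)
  have unit: "(\<lambda>n. tp.nrm ((q.C ^^ n) (unit_tuple i))) \<longlonglongrightarrow> 0" if "i \<in> I" for i
  proof -
    have "(tp.nrm ((q.C ^^ n) (unit_tuple i)))\<^sup>2 \<le> trace (q.C ^^ (n + n))" for n
      unfolding q_sq using that finite_I by (intro member_le_sum) auto
    then have "(\<lambda>n. (tp.nrm ((q.C ^^ n) (unit_tuple i)))\<^sup>2) \<longlonglongrightarrow> 0"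
      by (intro tendsto_sandwich[OF _ _ tendsto_const lim] always_eventually allI) auto
    from tendsto_real_sqrt[OF this] show ?thesis by simp
  qed
  show ?thesis
    unfolding qC
    by (rule tendsto_from_units[OF equivariant_funpow[OF eq_q] q.C_pow_contraction unit x])
qed

end

section \<open>The boundary map of a family of group elements\<close>

context group_ring_tuples
begin

text \<open>Indexed by a family and not by a set of group elements, because a walk may visit the
  same element several times.\<close>

definition bd :: "('i \<Rightarrow> 'a) \<Rightarrow> ('i \<Rightarrow> 'a \<Rightarrow> complex) \<Rightarrow> 'a \<Rightarrow> complex" where
  "bd a x = (\<Sum>i\<in>I. R (a i) (x i) - x i)"

lemma linear_bd: "linear (bd a)"
proof (rule linearI)
  show "bd a (x + y) = bd a x + bd a y" for x y
    unfolding bd_def sum.distrib[symmetric]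
    by (simp only: plus_fun_apply[of x y] linear_add[OF linear_R] add_diff_add)
  show "bd a (r *\<^sub>R x) = r *\<^sub>R bd a x" for r x
    unfolding bd_def scaleR_sum_right
    by (simp only: scaleR_fun_apply[of r x] linear_scale[OF linear_R] scaleR_diff_right)
qed

lemma bd_GR: "(\<And>i. i \<in> I \<Longrightarrow> a i \<in> carrier G) \<Longrightarrow> x \<in> tuples \<Longrightarrow> bd a x \<in> GR"
  unfolding bd_def by (intro gr.V_sum gr.V_diff R_GR tuplesD) auto

lemma nrm_R_diff_le: "g \<in> carrier G \<Longrightarrow> x \<in> GR \<Longrightarrow> gr.nrm (R g x - x) \<le> 2 * gr.nrm x"
  using gr.nrm_triangle_diff[of "R g x" x] by (simp add: nrm_R)

lemma nrm_bd_le: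
  assumes a: "\<And>i. i \<in> I \<Longrightarrow> a i \<in> carrier G" and x: "x \<in> tuples"
  shows "gr.nrm (bd a x) \<le> 2 * real (card I) * tp.nrm x"
proof -
  have "gr.nrm (bd a x) \<le> (\<Sum>i\<in>I. gr.nrm (R (a i) (x i) - x i))"
    unfolding bd_def using a x by (intro gr.nrm_sum gr.V_diff R_GR tuplesD) auto
  also have "\<dots> \<le> (\<Sum>i\<in>I. 2 * tp.nrm x)"
  proof (rule sum_mono)
    fix i assume i: "i \<in> I"
    have "gr.nrm (R (a i) (x i) - x i) \<le> 2 * gr.nrm (x i)"
      using a[OF i] x by (intro nrm_R_diff_le) auto
    also have "\<dots> \<le> 2 * tp.nrm x"
      using nrm_component_le[OF x i] by simp
    finally show "gr.nrm (R (a i) (x i) - x i) \<le> 2 * tp.nrm x" .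
  qed
  also have "\<dots> = 2 * real (card I) * tp.nrm x" by simp
  finally show ?thesis .
qed

lemma bd_single:
  assumes "i \<in> I"
  shows "bd a (single i y) = R (a i) y - y"
proof -
  have "bd a (single i y) = (\<Sum>k\<in>I. if k = i then R (a i) y - y else 0)"
    unfolding bd_def by (intro sum.cong) (auto simp: single_def linear_0[OF linear_R])
  then show ?thesis using assms finite_I by simp
qed

end

section \<open>Paths of commuting elements\<close>

text \<open>\<open>a_orth\<close> is the form in which regularity of the cyclic subgroups and
  infinite order enter the argument.\<close>

locale commuting_path = group_ring_tuples G \<psi> "{..m}"
  for G :: "('a, 'b) monoid_scheme" (structure) and \<psi> and m :: nat +
  fixes a :: "nat \<Rightarrow> 'a"
  assumes a_carrier: "\<And>k. k \<le> m \<Longrightarrow> a k \<in> carrier G"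
    and a_commute: "\<And>k. k < m \<Longrightarrow> a k \<otimes> a (Suc k) = a (Suc k) \<otimes> a k"
    and a_orth: "\<And>i k l. i \<le> m \<Longrightarrow> k \<noteq> l \<Longrightarrow> \<psi> (inv (a i [^] (l::nat)) \<otimes> a i [^] (k::nat)) = 0"
begin

text \<open>The Fox derivatives of the commutator of \<open>a k\<close> and
  \<open>a (Suc k)\<close>, multiplied by \<open>w\<close>.\<close>

definition rel :: "nat \<Rightarrow> ('a \<Rightarrow> complex) \<Rightarrow> nat \<Rightarrow> 'a \<Rightarrow> complex" where
  "rel k w = single k (w - R (a (Suc k)) w) - single (Suc k) (w - R (a k) w)"

text \<open>\<open>D1\<close> is the boundary map, placed in component \<open>0\<close>, and \<open>D2\<close> maps the \<open>k\<close>-th basis vector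
  (\<open>1 \<le> k \<le> m\<close>) to the cycle given by the commutation relation of \<open>a (k - 1)\<close> and \<open>a k\<close>.
  Since \<open>D2\<close> does not use component \<open>0\<close>, \<open>\<lambda>x. D1 x + D2' x\<close> is a square matrix.\<close>

definition D1 :: "(nat \<Rightarrow> 'a \<Rightarrow> complex) \<Rightarrow> nat \<Rightarrow> 'a \<Rightarrow> complex" where
  "D1 x = (\<Sum>k\<in>{..m}. elem k 0 (a k) x - elem k 0 \<one> x)"

text \<open>\<open>inv \<one>\<close> is left unsimplified so that the summands match
  \<open>gr_op_elem\<close> literally.\<close>

definition D1' :: "(nat \<Rightarrow> 'a \<Rightarrow> complex) \<Rightarrow> nat \<Rightarrow> 'a \<Rightarrow> complex" where
  "D1' x = (\<Sum>k\<in>{..m}. elem 0 k (inv (a k)) x - elem 0 k (inv \<one>) x)"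

definition D2 :: "(nat \<Rightarrow> 'a \<Rightarrow> complex) \<Rightarrow> nat \<Rightarrow> 'a \<Rightarrow> complex" where
  "D2 x = (\<Sum>k\<in>{..<m}. (elem (Suc k) k \<one> x - elem (Suc k) k (a (Suc k)) x)
    - (elem (Suc k) (Suc k) \<one> x - elem (Suc k) (Suc k) (a k) x))"

definition D2' :: "(nat \<Rightarrow> 'a \<Rightarrow> complex) \<Rightarrow> nat \<Rightarrow> 'a \<Rightarrow> complex" where
  "D2' x = (\<Sum>k\<in>{..<m}. (elem k (Suc k) (inv \<one>) x - elem k (Suc k) (inv (a (Suc k))) x)
    - (elem (Suc k) (Suc k) (inv \<one>) x - elem (Suc k) (Suc k) (inv (a k)) x))"

lemma op_D1: "gr_op D1 D1'"
  unfolding D1_def D1'_def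
  by (rule gr_op_sum; (rule gr_op_diff)?; (rule gr_op_elem)?) (simp_all add: a_carrier)

lemma op_D2: "gr_op D2 D2'"
  unfolding D2_def D2'_def
  by (rule gr_op_sum; (rule gr_op_diff)?; (rule gr_op_diff)?; (rule gr_op_elem)?)
    (simp_all add: a_carrier)

lemmas tuples_D = gr_op_tuples[OF op_D1] gr_op_tuples[OF op_D2]
  gr_op_tuples[OF gr_op_swap[OF op_D1]] gr_op_tuples[OF gr_op_swap[OF op_D2]]

lemmas linear_D = gr_op_linear[OF op_D1] gr_op_linear[OF op_D2]
  gr_op_linear[OF gr_op_swap[OF op_D1]] gr_op_linear[OF gr_op_swap[OF op_D2]]

lemma D1_eq: "x \<in> tuples \<Longrightarrow> D1 x = single 0 (bd a x)"
  unfolding D1_def bd_def elem_def by (simp only: linear_sum[OF linear_single] linear_diff[OF linear_single] R_one tuplesD)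

lemma D2_eq: "x \<in> tuples \<Longrightarrow> D2 x = (\<Sum>k<m. rel k (x (Suc k)))"
  unfolding D2_def rel_def elem_def
  by (simp only: linear_diff[OF linear_single] R_one tuplesD)

text \<open>For commuting a and b, (1 - b)(a - 1) = (1 - a)(b - 1).\<close>

lemma bd_rel:
  assumes "k < m" "w \<in> GR"
  shows "bd a (rel k w) = 0"
  unfolding rel_def linear_diff[OF linear_bd] linear_diff[OF linear_R]
  using assms a_commute[of k]
  by (simp add: bd_single linear_diff[OF linear_R] R_R a_carrier)

lemma bd_D2:
  assumes "x \<in> tuples"
  shows "bd a (D2 x) = 0"
  unfolding D2_eq[OF assms] linear_sum[OF linear_bd] using assms by (intro sum.neutral ballI bd_rel) auto

lemma D1_D2: "x \<in> tuples \<Longrightarrow> D1 (D2 x) = 0"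
  by (simp only: D1_eq tuples_D bd_D2 linear_0[OF linear_single])

text \<open>\<open>D2'\<close> never writes to component 0, the only one that \<open>D1'\<close>
  reads. Thus sharing one index set between the two blocks creates no cross term.\<close>

lemma D1'_D2':
  assumes "x \<in> tuples"
  shows "D1' (D2' x) = 0"
proof -
  have "D2' x 0 = 0"
    unfolding D2'_def by (subst sum_fun_apply) (intro sum.neutral ballI, simp add: elem_def single_def)
  then show ?thesis
    unfolding D1'_def elem_def by (simp add: linear_0[OF linear_R])
qed

lemma D2_D1:
  assumes "x \<in> tuples"
  shows "D2 (D1 x) = 0"
proof -
  have "D1 x (Suc k) = 0" for k
    using assms by (simp add: D1_eq single_def)
  then show ?thesis
    unfolding D2_def elem_def by (simp add: linear_0[OF linear_R] linear_0[OF linear_single])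
qed

lemma D1'_component: "k \<le> m \<Longrightarrow> x \<in> tuples \<Longrightarrow> D1' x k = R (inv (a k)) (x 0) - x 0"
proof -
  assume k: "k \<le> m" and x: "x \<in> tuples"
  have "D1' x k = (\<Sum>l\<in>{..m}. if l = k then R (inv (a k)) (x 0) - x 0 else 0)"
    unfolding D1'_def
    using x by (subst sum_fun_apply) (intro sum.cong, auto simp: elem_def single_def)
  then show ?thesis using k by simp
qed

text \<open>Component \<open>Suc k\<close> occurs in relation \<open>k\<close>, as its second entry,
  and in relation \<open>Suc k\<close>, as its first. For the last relation there is no successor,
  and only the diagonal term is left.\<close>

lemma D2_component:
  assumes "k < m" "x \<in> tuples"
  shows "D2 x (Suc k) = (if Suc k < m then x (Suc (Suc k)) - R (a (Suc (Suc k))) (x (Suc (Suc k))) else 0)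
    - (x (Suc k) - R (a k) (x (Suc k)))"
proof -
  have "D2 x (Suc k) = (\<Sum>l<m. (if l = Suc k then x (Suc l) - R (a (Suc l)) (x (Suc l)) else 0)
      - (if l = k then x (Suc l) - R (a l) (x (Suc l)) else 0))"
    unfolding D2_eq[OF assms(2)]
    by (subst sum_fun_apply) (intro sum.cong, auto simp: rel_def single_def)
  then show ?thesis
    using assms(1) by (simp only: sum_subtractf sum.delta finite_lessThan lessThan_iff if_True)
qed

text \<open>Back substitution in a bidiagonal system: once component \<open>Suc (Suc k)\<close>
  tends to 0, what remains of the equation is \<open>1 - a k\<close> applied to component
  \<open>Suc k\<close>, and this map is injective.\<close>

lemma D2_cauchy_injective:
  assumes y: "tp.cauchy y" and lim: "(\<lambda>n. tp.nrm (D2 (y n))) \<longlonglongrightarrow> 0" and k: "Suc k \<le> m"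
  shows "(\<lambda>n. gr.nrm (y n (Suc k))) \<longlonglongrightarrow> 0"
  using k
\<comment> \<open>Downward in \<open>k\<close>, from the end of the walk.\<close>
proof (induction "m - k" arbitrary: k rule: less_induct)
  case less
  have yV: "y n \<in> tuples" for n using y by simp
  have cauchy_k: "gr.cauchy (\<lambda>n. y n i)" if "i \<le> m" for i
    unfolding gr.cauchy_def
  proof safe
    fix e :: real assume "e > 0"
    then obtain N where "\<And>p q. p \<ge> N \<Longrightarrow> q \<ge> N \<Longrightarrow> tp.nrm (y p - y q) < e"
      using y unfolding tp.cauchy_def by blast
    moreover have "gr.nrm (y p i - y q i) \<le> tp.nrm (y p - y q)" for p q
      using nrm_component_le[of "y p - y q" i] yV that by simp
    ultimately show "\<exists>N. \<forall>p\<ge>N. \<forall>q\<ge>N. gr.nrm (y p i - y q i) < e"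
      by (meson le_less_trans)
  qed (use yV in simp)
  define u where
    "u n = (if Suc k < m then y n (Suc (Suc k)) - R (a (Suc (Suc k))) (y n (Suc (Suc k))) else 0)" for n
  have uV: "u n \<in> GR" for n
    unfolding u_def using yV by (auto intro!: gr.V_diff R_GR a_carrier)
  have u: "(\<lambda>n. gr.nrm (u n)) \<longlonglongrightarrow> 0"
  proof (cases "Suc k < m")
    case True
    have "gr.nrm (u n) \<le> 2 * gr.nrm (y n (Suc (Suc k)))" for n
    proof -
      have "gr.nrm (u n) = gr.nrm (R (a (Suc (Suc k))) (y n (Suc (Suc k))) - y n (Suc (Suc k)))"
        unfolding u_def using True yV by (simp only: if_True) (intro gr.nrm_diff_commute; simp add: a_carrier)
      then show ?thesis
        using nrm_R_diff_le[of "a (Suc (Suc k))" "y n (Suc (Suc k))"] True yV by (simp add: a_carrier)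
    qed
    moreover have "(\<lambda>n. 2 * gr.nrm (y n (Suc (Suc k)))) \<longlonglongrightarrow> 0"
      using less(1)[of "Suc k"] True by (intro tendsto_mult_right_zero) simp
    ultimately show ?thesis
      using uV by (intro gr.tendsto_sandwich_nrm)
  next
    case False
    then have "u n = 0" for n by (simp add: u_def)
    then show ?thesis by (simp only: gr.nrm_zero tendsto_const)
  qed
  have "(\<lambda>n. gr.nrm (R (a k) (y n (Suc k)) - y n (Suc k))) \<longlonglongrightarrow> 0"
  proof (rule gr.tendsto_sandwich_nrm)
    show "R (a k) (y n (Suc k)) - y n (Suc k) \<in> GR" for n
      using yV less(2) by (intro gr.V_diff R_GR a_carrier) auto
    show "gr.nrm (R (a k) (y n (Suc k)) - y n (Suc k)) \<le> tp.nrm (D2 (y n)) + gr.nrm (u n)" for n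
    proof -
      have "R (a k) (y n (Suc k)) - y n (Suc k) = D2 (y n) (Suc k) - u n"
        using less(2) yV by (simp only: D2_component Suc_le_eq u_def) (simp add: fun_eq_iff)
      then have "gr.nrm (R (a k) (y n (Suc k)) - y n (Suc k)) \<le> gr.nrm (D2 (y n) (Suc k)) + gr.nrm (u n)"
        using gr.nrm_triangle_diff[of "D2 (y n) (Suc k)" "u n"] uV tuples_D(2)[OF yV] by simp
      then show ?thesis
        using nrm_component_le[OF tuples_D(2)[OF yV[of n]], of "Suc k"] less(2) by simp
    qed
    show "(\<lambda>n. tp.nrm (D2 (y n)) + gr.nrm (u n)) \<longlonglongrightarrow> 0"
      using lim u by (rule tendsto_add_zero)
  qed
  moreover have km: "k \<le> m" using less(2) by simp
  ultimately show ?case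
    using cauchy_injective_R[OF a_carrier[OF km] a_orth[OF km]] cauchy_k[of "Suc k"] less(2)
    unfolding gr.cauchy_injective_def by simp
qed

text \<open>Every component of \<open>D1' y\<close> only sees \<open>y 0\<close>; the one belonging
  to \<open>a 0\<close> already determines it.\<close>

lemma D1'_cauchy_injective:
  assumes y: "tp.cauchy y" and lim: "(\<lambda>n. tp.nrm (D1' (y n))) \<longlonglongrightarrow> 0"
  shows "(\<lambda>n. gr.nrm (y n 0)) \<longlonglongrightarrow> 0"
proof -
  have yV: "y n \<in> tuples" for n using y by simp
  have cauchy_0: "gr.cauchy (\<lambda>n. y n 0)"
    unfolding gr.cauchy_def
  proof safe
    fix e :: real assume "e > 0"
    then obtain N where "\<And>p q. p \<ge> N \<Longrightarrow> q \<ge> N \<Longrightarrow> tp.nrm (y p - y q) < e"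
      using y unfolding tp.cauchy_def by blast
    moreover have "gr.nrm (y p 0 - y q 0) \<le> tp.nrm (y p - y q)" for p q
      using nrm_component_le[of "y p - y q" 0] yV by simp
    ultimately show "\<exists>N. \<forall>p\<ge>N. \<forall>q\<ge>N. gr.nrm (y p 0 - y q 0) < e"
      by (meson le_less_trans)
  qed (use yV in simp)
  have a0: "a 0 \<in> carrier G" by (simp add: a_carrier)
  have "(\<lambda>n. gr.nrm (R (a 0) (y n 0) - y n 0)) \<longlonglongrightarrow> 0"
  proof (rule gr.tendsto_sandwich_nrm[OF _ _ lim])
    show "R (a 0) (y n 0) - y n 0 \<in> GR" for n
      using yV a0 by (intro gr.V_diff R_GR) auto
    show "gr.nrm (R (a 0) (y n 0) - y n 0) \<le> tp.nrm (D1' (y n))" for n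
    proof -
      \<comment> \<open>Translating by \<open>a 0\<close> replaces the inverse in the adjoint by
        \<open>a 0\<close> itself, up to sign.\<close>
      have "R (a 0) (D1' (y n) 0) = y n 0 - R (a 0) (y n 0)"
        using yV a0 by (simp only: D1'_component le0 linear_diff[OF linear_R] R_R inv_closed l_inv R_one tuplesD)
      then have "gr.nrm (D1' (y n) 0) = gr.nrm (y n 0 - R (a 0) (y n 0))"
        using nrm_R[OF a0 tuplesD[OF tuples_D(3)[OF yV]], of n 0] by simp
      also have "\<dots> = gr.nrm (R (a 0) (y n 0) - y n 0)"
        using yV a0 by (intro gr.nrm_diff_commute) auto
      finally show ?thesis
        using nrm_component_le[OF tuples_D(3)[OF yV[of n]], of 0] by simp
    qed
  qed
  then show ?thesis
    using cauchy_injective_R[OF a0 a_orth[OF le0]] cauchy_0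
    unfolding gr.cauchy_injective_def by simp
qed

text \<open>The images of the two blocks are orthogonal since the boundary of a relation vanishes.
  By Pythagoras each block tends to 0 separately, and together they control all components.\<close>

lemma adjoint_cauchy_injective: "tp.cauchy_injective (\<lambda>y. D1' y + D2 y)"
  unfolding tp.cauchy_injective_def
proof (intro allI impI)
  fix y assume y: "tp.cauchy y" and lim: "(\<lambda>n. tp.nrm (D1' (y n) + D2 (y n))) \<longlonglongrightarrow> 0"
  have yV: "y n \<in> tuples" for n using y by simp
  note V = tuples_D(3)[OF yV] tuples_D(2)[OF yV]
  have pyth: "(tp.nrm (D1' (y n) + D2 (y n)))\<^sup>2 = (tp.nrm (D1' (y n)))\<^sup>2 + (tp.nrm (D2 (y n)))\<^sup>2" for n
  proof -
    have "ipt (D1' (y n)) (D2 (y n)) = ipt (y n) (D1 (D2 (y n)))"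
      by (rule gr_op_adjoint[OF gr_op_swap[OF op_D1] yV V(2)])
    also have "\<dots> = 0" by (simp only: D1_D2[OF yV] tp.ip_zero_right[OF yV])
    finally have "ipt (D1' (y n)) (D2 (y n)) = 0" .
    then show ?thesis
      using V[of n] tp.ip_sym[OF V(1)[of n] V(2)[of n]]
      by (simp only: tp.nrm_sq tp.V_add tp.ip_add_left tp.ip_add_right)
  qed
  have "(\<lambda>n. tp.nrm (D1' (y n))) \<longlonglongrightarrow> 0"
  proof (rule tp.tendsto_sandwich_nrm[OF V(1) _ lim])
    show "tp.nrm (D1' (y n)) \<le> tp.nrm (D1' (y n) + D2 (y n))" for n
      by (rule power2_le_imp_le) (use V in \<open>simp_all add: pyth\<close>)
  qed
  note y0 = D1'_cauchy_injective[OF y this]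
  have "(\<lambda>n. tp.nrm (D2 (y n))) \<longlonglongrightarrow> 0"
  proof (rule tp.tendsto_sandwich_nrm[OF V(2) _ lim])
    show "tp.nrm (D2 (y n)) \<le> tp.nrm (D1' (y n) + D2 (y n))" for n
      by (rule power2_le_imp_le) (use V in \<open>simp_all add: pyth\<close>)
  qed
  note yS = D2_cauchy_injective[OF y this]
  have "(\<lambda>n. gr.nrm (y n k)) \<longlonglongrightarrow> 0" if "k \<in> {..m}" for k
    using y0 yS that by (cases k) auto
  then have "(\<lambda>n. \<Sum>k\<in>{..m}. gr.nrm (y n k)) \<longlonglongrightarrow> (\<Sum>k\<in>{..m}. 0)"
    by (rule tendsto_sum)
  then show "(\<lambda>n. tp.nrm (y n)) \<longlonglongrightarrow> 0"
    by (intro tp.tendsto_sandwich_nrm[OF yV nrm_tuple_le[OF yV]]) simp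
qed

section \<open>The Laplacian and its discrete heat flow\<close>

definition Lap :: "(nat \<Rightarrow> 'a \<Rightarrow> complex) \<Rightarrow> nat \<Rightarrow> 'a \<Rightarrow> complex" where
  "Lap x = D1' (D1 x) + D2 (D2' x)"

lemma Lap_tuples: "x \<in> tuples \<Longrightarrow> Lap x \<in> tuples"
  unfolding Lap_def by (intro tp.V_add tuples_D)

lemma heat_tuples: "x \<in> tuples \<Longrightarrow> ((\<lambda>x. x - r *\<^sub>R Lap x) ^^ n) x \<in> tuples"
proof (induction n)
  case (Suc n)
  then show ?case by (simp only: funpow.simps comp_def tp.V_diff tp.V_scale Lap_tuples)
qed simp

text \<open>On tuples over the group ring the Laplacian factors as \<open>A A'\<close> with square
  matrices, the cross terms being zero, so convergence follows from injectivity of \<open>A\<close>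
  by the trace argument.\<close>

lemma heat_tendsto:
  obtains r where "0 < r" and "\<And>x. x \<in> tuples \<Longrightarrow> (\<lambda>n. tp.nrm (((\<lambda>x. x - r *\<^sub>R Lap x) ^^ n) x)) \<longlonglongrightarrow> 0"
    and "\<And>n x. x \<in> tuples \<Longrightarrow> tp.nrm (((\<lambda>x. x - r *\<^sub>R Lap x) ^^ n) x) \<le> tp.nrm x"
    and "\<And>n. linear ((\<lambda>x. x - r *\<^sub>R Lap x) ^^ n)"
proof -
  define A where "A x = D1' x + D2 x" for x
  define A' where "A' x = D1 x + D2' x" for x
  have op: "gr_op A A'"
    unfolding A_def A'_def by (rule gr_op_add[OF gr_op_swap[OF op_D1] op_D2])
  obtain b where b: "b \<ge> 0" "\<And>x. x \<in> tuples \<Longrightarrow> tp.nrm (A x) \<le> b * tp.nrm x"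
    using gr_op_bounded[OF op] by blast
  obtain b' where b': "b' \<ge> 0" "\<And>x. x \<in> tuples \<Longrightarrow> tp.nrm (A' x) \<le> b' * tp.nrm x"
    using gr_op_bounded[OF gr_op_swap[OF op]] by blast
  \<comment> \<open>Makes both scaled matrices contractions; the summand 1 excludes division by
    zero. Each factor of the Laplacian carries one \<open>r\<close>, so the step size obtained is
    the square of this number.\<close>
  define r where "r = 1 / (b + b' + 1)"
  have r: "r > 0" "r * b \<le> 1" "r * b' \<le> 1"
    using b(1) b'(1) by (auto simp: r_def field_simps)
  have opr: "gr_op (\<lambda>x. r *\<^sub>R A x) (\<lambda>x. r *\<^sub>R A' x)" by (rule gr_op_scale[OF op])
  have c: "tp.nrm (r *\<^sub>R A x) \<le> tp.nrm x" if x: "x \<in> tuples" for x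
  proof -
    have "tp.nrm (r *\<^sub>R A x) = r * tp.nrm (A x)"
      unfolding tp.nrm_scale[OF gr_op_tuples[OF op x]] using r(1) by simp
    also have "\<dots> \<le> r * (b * tp.nrm x)" using b(2)[OF x] r(1) by simp
    also have "\<dots> \<le> 1 * tp.nrm x"
      unfolding mult.assoc[symmetric] using r(2) x by (intro mult_right_mono) auto
    finally show ?thesis by simp
  qed
  have c': "tp.nrm (r *\<^sub>R A' x) \<le> tp.nrm x" if x: "x \<in> tuples" for x
  proof -
    have "tp.nrm (r *\<^sub>R A' x) = r * tp.nrm (A' x)"
      unfolding tp.nrm_scale[OF gr_op_tuples[OF gr_op_swap[OF op] x]] using r(1) by simp
    also have "\<dots> \<le> r * (b' * tp.nrm x)" using b'(2)[OF x] r(1) by simp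
    also have "\<dots> \<le> 1 * tp.nrm x"
      unfolding mult.assoc[symmetric] using r(3) x by (intro mult_right_mono) auto
    finally show ?thesis by simp
  qed
  have inj: "tp.cauchy_injective (\<lambda>x. r *\<^sub>R A x)"
    unfolding tp.cauchy_injective_def
  proof (intro allI impI)
    fix y assume y: "tp.cauchy y" and lim: "(\<lambda>n. tp.nrm (r *\<^sub>R A (y n))) \<longlonglongrightarrow> 0"
    have yV: "y n \<in> tuples" for n using y by simp
    have "(\<lambda>n. inverse r * tp.nrm (r *\<^sub>R A (y n))) \<longlonglongrightarrow> 0"
      by (rule tendsto_mult_right_zero[OF lim])
    then have "(\<lambda>n. tp.nrm (A (y n))) \<longlonglongrightarrow> 0"
      unfolding tp.nrm_scale[OF gr_op_tuples[OF op yV]] using r(1) by (simp flip: mult.assoc)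
    then show "(\<lambda>n. tp.nrm (y n)) \<longlonglongrightarrow> 0"
      using adjoint_cauchy_injective y unfolding tp.cauchy_injective_def A_def by blast
  qed
  interpret q: adjoint_pair tuples ipt "\<lambda>x. r *\<^sub>R A' x" "\<lambda>x. r *\<^sub>R A x"
    using gr_op_swap[OF opr] c by (rule gr_op_adjoint_pair)
  have AA': "x - r *\<^sub>R A (r *\<^sub>R A' x) = x - r\<^sup>2 *\<^sub>R Lap x" if x: "x \<in> tuples" for x
  proof -
    have "A (A' x) = Lap x"
      unfolding A_def A'_def Lap_def linear_add[OF linear_D(3)] linear_add[OF linear_D(2)]
      by (simp only: D1'_D2'[OF x] D2_D1[OF x] add_0_left add_0_right)
    then show ?thesis
      by (simp only: linear_scale[OF gr_op_linear[OF op]] scaleR_scaleR power2_eq_square)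
  qed
  let ?C = "\<lambda>x. x - r *\<^sub>R A (r *\<^sub>R A' x)" and ?L = "\<lambda>x. x - r\<^sup>2 *\<^sub>R Lap x"
  have qC: "q.C = ?C" by (rule ext) (rule q.C_def)
  have pow: "(?L ^^ n) x = (?C ^^ n) x \<and> (?C ^^ n) x \<in> tuples" if x: "x \<in> tuples" for n x
  proof (induction n)
    case (Suc n)
    then have "?L ((?C ^^ n) x) = ?C ((?C ^^ n) x)" by (simp only: AA')
    moreover have "?C ((?C ^^ n) x) \<in> tuples"
      using Suc q.C_V[of "(?C ^^ n) x"] by (simp only: q.C_def)
    ultimately show ?case using Suc by (simp only: funpow.simps comp_def simp_thms)
  qed (use x in simp)
  show ?thesis
  proof
    show "0 < r\<^sup>2" using r by simp
    fix x assume x: "x \<in> tuples"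
    show "(\<lambda>n. tp.nrm ((?L ^^ n) x)) \<longlonglongrightarrow> 0"
      using adjoint_powers_tendsto[OF opr c c' inj x] by (simp only: pow[OF x])
    show "tp.nrm ((?L ^^ n) x) \<le> tp.nrm x" for n
      using q.C_pow_contraction[OF x, of n] by (simp only: pow[OF x] qC)
  next
    \<comment> \<open>\<open>?L\<close> and \<open>?C\<close> are only known to agree on
      \<open>tuples\<close>, whereas linearity is claimed on the whole function type; it is
      therefore shown for \<open>?L\<close> itself.\<close>
    have "linear ?L"
      unfolding Lap_def
      by (intro linear_compose_sub linear_ident linear_compose_scale_right linear_compose_add
          linear_compose[OF linear_D(1,3), unfolded comp_def] linear_compose[OF linear_D(4,2), unfolded comp_def])
    then show "linear (?L ^^ n)" for n
    proof (induction n)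
      case (Suc n)
      then show ?case using linear_compose[OF Suc.IH[OF Suc.prems] Suc.prems] by (simp only: funpow.simps)
    qed (simp only: funpow.simps id_def linear_ident)
  qed
qed

text \<open>One heat step subtracts a multiple of \<open>D2 (D2' x)\<close>, which is a cycle, and a
  multiple of \<open>D1' (D1 x)\<close>, whose norm is bounded by that of the boundary of
  \<open>x\<close>. The constant grows with \<open>n\<close>, which is harmless as \<open>n\<close>
  is fixed before the boundary is made small.\<close>

lemma modulo_cycles:
  fixes r :: real
  assumes r: "0 < r"
  shows "\<exists>K\<ge>0. \<forall>x\<in>tuples. \<exists>z\<in>tuples. bd a z = 0 \<and>
    tp.nrm (x - z - ((\<lambda>x. x - r *\<^sub>R Lap x) ^^ n) x) \<le> K * gr.nrm (bd a x)"
proof (induction n)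
  case 0
  have "tp.nrm (x - 0 - x) \<le> 0 * gr.nrm (bd a x)" for x
    by (simp only: diff_zero diff_self tp.nrm_zero mult_zero_left order_refl)
  moreover have "bd a 0 = 0" by (rule linear_0[OF linear_bd])
  moreover have "(0 :: nat \<Rightarrow> 'a \<Rightarrow> complex) \<in> tuples" by (rule tp.V_zero)
  ultimately show ?case
    unfolding funpow.simps id_def
    by (intro exI[of _ 0] conjI ballI bexI[of _ 0]) (intro order_refl | fact)+
next
  case (Suc n)
  let ?C = "\<lambda>x. x - r *\<^sub>R Lap x"
  obtain K where K: "K \<ge> 0" and IH: "\<And>x. x \<in> tuples \<Longrightarrow>
      \<exists>z\<in>tuples. bd a z = 0 \<and> tp.nrm (x - z - (?C ^^ n) x) \<le> K * gr.nrm (bd a x)"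
    using Suc by blast
  obtain b where b: "b \<ge> 0" "\<And>x. x \<in> tuples \<Longrightarrow> tp.nrm (D1' x) \<le> b * tp.nrm x"
    using gr_op_bounded[OF gr_op_swap[OF op_D1]] by blast
  define c where "c = 2 * real (card {..m})"
  have c: "c \<ge> 0" "\<And>x. x \<in> tuples \<Longrightarrow> gr.nrm (bd a x) \<le> c * tp.nrm x"
    unfolding c_def using nrm_bd_le[of a] by (auto simp: a_carrier)
  \<comment> \<open>A heat step enlarges the boundary by at most the factor
    \<open>1 + r * c * b\<close>; the last summand pays for the term \<open>r *\<^sub>R u\<close>
    dropped in this step.\<close>
  define K' where "K' = K * (1 + r * c * b) + r * b"
  have "\<exists>z\<in>tuples. bd a z = 0 \<and> tp.nrm (x - z - (?C ^^ Suc n) x) \<le> K' * gr.nrm (bd a x)"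
    if x: "x \<in> tuples" for x
  proof -
    define u v where "u = D1' (D1 x)" and "v = D2 (D2' x)"
    have uV: "u \<in> tuples" and vV: "v \<in> tuples" unfolding u_def v_def using x by (intro tuples_D; assumption)+
    have Cx: "?C x = x - r *\<^sub>R u - r *\<^sub>R v"
      by (simp only: Lap_def u_def v_def scaleR_add_right diff_diff_eq)
    then have CV: "?C x \<in> tuples"
      using x uV vV by (simp only: tp.V_diff tp.V_scale)
    have bdG: "bd a y \<in> GR" if "y \<in> tuples" for y
      using that by (intro bd_GR) (auto simp: a_carrier)
    have D1: "tp.nrm (D1 x) = gr.nrm (bd a x)"
      unfolding D1_eq[OF x] using bdG[OF x] by (intro nrm_single) auto
    have u: "tp.nrm u \<le> b * gr.nrm (bd a x)"
      unfolding u_def D1[symmetric] by (intro b(2) tuples_D x)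
    have bdv: "bd a v = 0" unfolding v_def by (intro bd_D2 tuples_D x)
    have "bd a (?C x) = bd a x - r *\<^sub>R bd a u"
      unfolding Cx linear_diff[OF linear_bd] linear_scale[OF linear_bd] bdv
      by (simp only: scaleR_zero_right diff_zero)
    then have s1: "gr.nrm (bd a (?C x)) \<le> gr.nrm (bd a x) + gr.nrm (r *\<^sub>R bd a u)"
      by (simp only:) (intro gr.nrm_triangle_diff gr.V_scale bdG x uV)
    have s2: "gr.nrm (r *\<^sub>R bd a u) = r * gr.nrm (bd a u)"
      unfolding gr.nrm_scale[OF bdG[OF uV]] using r by simp
    have s3: "gr.nrm (bd a u) \<le> c * (b * gr.nrm (bd a x))"
      using c(2)[OF uV] mult_left_mono[OF u c(1)] by linarith
    have bdC: "gr.nrm (bd a (?C x)) \<le> gr.nrm (bd a x) + r * (c * (b * gr.nrm (bd a x)))"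
      using s1 s2 mult_left_mono[OF s3, of r] r by linarith
    obtain z where z: "z \<in> tuples" "bd a z = 0"
      and zn: "tp.nrm (?C x - z - (?C ^^ n) (?C x)) \<le> K * gr.nrm (bd a (?C x))"
      using IH[OF CV] by blast
    have split: "x - (z + r *\<^sub>R v) - (?C ^^ Suc n) x = (?C x - z - (?C ^^ n) (?C x)) + r *\<^sub>R u"
      unfolding funpow_Suc_right comp_def unfolding Cx by (simp only: algebra_simps)
    have t1: "tp.nrm (x - (z + r *\<^sub>R v) - (?C ^^ Suc n) x)
        \<le> tp.nrm (?C x - z - (?C ^^ n) (?C x)) + tp.nrm (r *\<^sub>R u)"
      unfolding split by (intro tp.nrm_triangle tp.V_diff tp.V_scale CV z uV heat_tuples)
    have t2: "tp.nrm (r *\<^sub>R u) = r * tp.nrm u"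
      unfolding tp.nrm_scale[OF uV] using r by simp
    have t3: "r * tp.nrm u \<le> r * (b * gr.nrm (bd a x))"
      using u r by simp
    have t4: "tp.nrm (?C x - z - (?C ^^ n) (?C x))
        \<le> K * (gr.nrm (bd a x) + r * (c * (b * gr.nrm (bd a x))))"
      using zn mult_left_mono[OF bdC K] by linarith
    have t5: "K * (gr.nrm (bd a x) + r * (c * (b * gr.nrm (bd a x)))) + r * (b * gr.nrm (bd a x))
        = K' * gr.nrm (bd a x)"
      unfolding K'_def by (simp add: algebra_simps)
    have "tp.nrm (x - (z + r *\<^sub>R v) - (?C ^^ Suc n) x) \<le> K' * gr.nrm (bd a x)"
      using t1 t2 t3 t4 t5 by linarith
    moreover have "bd a (z + r *\<^sub>R v) = 0"
      unfolding linear_add[OF linear_bd] linear_scale[OF linear_bd] z bdv by simp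
    moreover have "z + r *\<^sub>R v \<in> tuples" by (intro tp.V_add tp.V_scale z vV)
    ultimately show ?thesis by blast
  qed
  moreover have "K' \<ge> 0" unfolding K'_def using K r b(1) c(1) by simp
  ultimately show ?case by blast
qed

text \<open>The order of choices matters: a late element \<open>x N0\<close>, then a power
  \<open>j\<close> of the heat operator that makes it small, then the constant \<open>K\<close> for
  that power, and only then \<open>x p\<close> with a boundary small compared to
  \<open>K\<close>.\<close>

lemma cauchy_near_cycle:
  assumes x: "tp.cauchy x" and lim: "(\<lambda>n. gr.nrm (bd a (x n))) \<longlonglongrightarrow> 0" and e: "0 < e"
  shows "\<exists>z\<in>tuples. bd a z = 0 \<and> (\<exists>N. \<forall>n\<ge>N. tp.nrm (x n - z) < e)"
proof -
  obtain r where r: "0 < r"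
    and heat: "\<And>x. x \<in> tuples \<Longrightarrow> (\<lambda>n. tp.nrm (((\<lambda>x. x - r *\<^sub>R Lap x) ^^ n) x)) \<longlonglongrightarrow> 0"
    and contr: "\<And>n x. x \<in> tuples \<Longrightarrow> tp.nrm (((\<lambda>x. x - r *\<^sub>R Lap x) ^^ n) x) \<le> tp.nrm x"
    and lin: "\<And>n. linear ((\<lambda>x. x - r *\<^sub>R Lap x) ^^ n)"
    using heat_tendsto by blast
  let ?C = "\<lambda>x. x - r *\<^sub>R Lap x"
  have xV: "x n \<in> tuples" for n using x by simp
  have e4: "e / 4 > 0" using e by simp
  obtain N0 where N0: "\<And>m n. m \<ge> N0 \<Longrightarrow> n \<ge> N0 \<Longrightarrow> tp.nrm (x m - x n) < e / 4"
    using x e4 unfolding tp.cauchy_def by blast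
  obtain j where "norm (tp.nrm ((?C ^^ j) (x N0)) - 0) < e / 4"
    using LIMSEQ_D[OF heat[OF xV[of N0]] e4] by blast
  then have j: "tp.nrm ((?C ^^ j) (x N0)) < e / 4" by simp
  obtain K where K: "K \<ge> 0" and Kz: "\<And>x. x \<in> tuples \<Longrightarrow>
      \<exists>z\<in>tuples. bd a z = 0 \<and> tp.nrm (x - z - (?C ^^ j) x) \<le> K * gr.nrm (bd a x)"
    using modulo_cycles[OF r, of j] by blast
  obtain N1 where N1: "\<And>n. n \<ge> N1 \<Longrightarrow> norm (K * gr.nrm (bd a (x n)) - 0) < e / 4"
    using LIMSEQ_D[OF tendsto_mult_right_zero[OF lim, of K] e4] by blast
  define p where "p = max N0 N1"
  obtain z where z: "z \<in> tuples" "bd a z = 0"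
    and zp: "tp.nrm (x p - z - (?C ^^ j) (x p)) \<le> K * gr.nrm (bd a (x p))"
    using Kz[OF xV[of p]] by blast
  have 1: "tp.nrm (x p - z - (?C ^^ j) (x p)) < e / 4"
    using zp N1[of p] by (simp add: p_def)
  \<comment> \<open>\<open>j\<close> was chosen for \<open>x N0\<close>; contractivity of the heat
    operator carries the smallness over to \<open>x p\<close>.\<close>
  have "tp.nrm ((?C ^^ j) (x p)) \<le> tp.nrm ((?C ^^ j) (x p) - (?C ^^ j) (x N0)) + tp.nrm ((?C ^^ j) (x N0))"
    by (intro tp.nrm_triangle_sub heat_tuples xV)
  also have "tp.nrm ((?C ^^ j) (x p) - (?C ^^ j) (x N0)) \<le> tp.nrm (x p - x N0)"
    unfolding linear_diff[OF lin, symmetric] by (intro contr tp.V_diff xV)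
  also have "tp.nrm (x p - x N0) < e / 4" by (intro N0) (auto simp: p_def)
  finally have 2: "tp.nrm ((?C ^^ j) (x p)) < e / 4 + e / 4" using j by linarith
  have "tp.nrm (x p - z) \<le> tp.nrm (x p - z - (?C ^^ j) (x p)) + tp.nrm ((?C ^^ j) (x p))"
    by (intro tp.nrm_triangle_sub tp.V_diff xV z heat_tuples)
  with 1 2 have 3: "tp.nrm (x p - z) < 3 * (e / 4)" by linarith
  have "tp.nrm (x n - z) < e" if "n \<ge> N0" for n
  proof -
    have "tp.nrm (x n - z) \<le> tp.nrm (x n - x p) + tp.nrm (x p - z)"
      using tp.nrm_triangle[of "x n - x p" "x p - z"] xV z by simp
    moreover have "tp.nrm (x n - x p) < e / 4"
      using that by (intro N0) (auto simp: p_def)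
    ultimately show ?thesis using 3 by linarith
  qed
  then show ?thesis using z by blast
qed

end

section \<open>Change of generators\<close>

context group_ring_tuples
begin

text \<open>Fox calculus along a word for \<open>g\<close>: gh - 1 = (g - 1) + g(h - 1) treats
  products, and a^-1 - 1 = -a^-1 (a - 1) treats inverses. Linearity and a bound are carried along so
  that Cauchy sequences are lifted to Cauchy sequences.\<close>

lemma lift_element:
  assumes a: "\<And>i. i \<in> I \<Longrightarrow> a i \<in> carrier G" and g: "g \<in> generate G (a ` I)"
  shows "\<exists>\<kappa> B. 0 \<le> B \<and> linear \<kappa> \<and> (\<forall>x\<in>GR. \<kappa> x \<in> tuples \<and> bd a (\<kappa> x) = R g x - x
    \<and> tp.nrm (\<kappa> x) \<le> B * gr.nrm x)"
  using g
proof (induction rule: generate.induct)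
  case one
  have "linear (\<lambda>x. 0 :: 'i \<Rightarrow> 'a \<Rightarrow> complex)" by (rule linear_zero)
  moreover have "bd a 0 = R \<one> x - x" if "x \<in> GR" for x
    by (simp only: R_one that diff_self linear_0[OF linear_bd])
  moreover have "tp.nrm 0 \<le> 0 * gr.nrm x" for x
    by (simp only: tp.nrm_zero mult_zero_left order_refl)
  ultimately show ?case
    using tp.V_zero order_refl[of "0::real"] by blast
next
  case (incl h)
  then obtain i where i: "i \<in> I" "h = a i" by blast
  have "tp.nrm (single i x) \<le> 1 * gr.nrm x" if "x \<in> GR" for x
    using nrm_single[OF that i(1)] by simp
  moreover have "bd a (single i x) = R h x - x" for x
    unfolding i(2) by (rule bd_single[OF i(1)])
  ultimately show ?case
    using linear_single single_tuples zero_le_one by blast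
next
  case (inv h)
  then obtain i where i: "i \<in> I" "h = a i" by blast
  have ai: "a i \<in> carrier G" "inv (a i) \<in> carrier G" using a[OF i(1)] by auto
  let ?\<kappa> = "\<lambda>x. single i ((-1) *\<^sub>R R (inv (a i)) x)"
  have lin: "linear ?\<kappa>"
    by (rule linearI)
      (simp_all only: linear_add[OF linear_R] linear_add[OF linear_single] scaleR_add_right
        linear_scale[OF linear_R] linear_scale[OF linear_single] scaleR_scaleR mult.commute)
  have V: "(-1) *\<^sub>R R (inv (a i)) x \<in> GR" if "x \<in> GR" for x
    using that ai by (intro gr.V_scale R_GR)
  have "tp.nrm (?\<kappa> x) \<le> 1 * gr.nrm x" if "x \<in> GR" for x
    unfolding nrm_single[OF V[OF that] i(1)] gr.nrm_scale[OF R_GR[OF ai(2) that]]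
    by (simp add: nrm_R[OF ai(2) that])
  moreover have "bd a (?\<kappa> x) = R (inv h) x - x" if "x \<in> GR" for x
    unfolding i(2) bd_single[OF i(1)] linear_scale[OF linear_R] R_R[OF ai(2,1)] l_inv[OF ai(1)] R_one[OF that]
    by (simp only: scaleR_minus1_left diff_minus_eq_add minus_diff_eq add.commute[of "- x"]
        uminus_add_conv_diff)
  ultimately show ?case
    using lin V single_tuples[OF V] zero_le_one by blast
next
  case (eng g h)
  have gh: "g \<in> carrier G" "h \<in> carrier G"
    using eng.hyps a generate_in_carrier[of "a ` I"] by blast+
  obtain \<kappa> B where g: "0 \<le> B" "linear \<kappa>" "\<And>x. x \<in> GR \<Longrightarrow> \<kappa> x \<in> tuples"
    "\<And>x. x \<in> GR \<Longrightarrow> bd a (\<kappa> x) = R g x - x" "\<And>x. x \<in> GR \<Longrightarrow> tp.nrm (\<kappa> x) \<le> B * gr.nrm x"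
    using eng.IH(1) by blast
  obtain \<mu> D where h: "0 \<le> D" "linear \<mu>" "\<And>x. x \<in> GR \<Longrightarrow> \<mu> x \<in> tuples"
    "\<And>x. x \<in> GR \<Longrightarrow> bd a (\<mu> x) = R h x - x" "\<And>x. x \<in> GR \<Longrightarrow> tp.nrm (\<mu> x) \<le> D * gr.nrm x"
    using eng.IH(2) by blast
  let ?\<kappa> = "\<lambda>x. \<kappa> x + \<mu> (R g x)"
  have "linear ?\<kappa>"
    by (rule linear_compose_add[OF g(2) linear_compose[OF linear_R h(2), unfolded comp_def]])
  moreover have "?\<kappa> x \<in> tuples" if "x \<in> GR" for x
    using that gh by (intro tp.V_add g(3) h(3) R_GR)
  moreover have "bd a (?\<kappa> x) = R (g \<otimes> h) x - x" if "x \<in> GR" for x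
    unfolding linear_add[OF linear_bd] g(4)[OF that] h(4)[OF R_GR[OF gh(1) that]] R_R[OF gh]
    by (rule ext) simp
  moreover have "tp.nrm (?\<kappa> x) \<le> (B + D) * gr.nrm x" if "x \<in> GR" for x
    using tp.nrm_triangle[OF g(3)[OF that] h(3)[OF R_GR[OF gh(1) that]]] g(5)[OF that]
      h(5)[OF R_GR[OF gh(1) that], unfolded nrm_R[OF gh(1) that]]
    unfolding distrib_right by linarith
  moreover have "0 \<le> B + D" using g(1) h(1) by simp
  ultimately show ?case by blast
qed

text \<open>A bounded chain map between the complexes of two generating families, lying over the
  identity of the group ring.\<close>

lemma lift_family:
  assumes a: "\<And>i. i \<in> I \<Longrightarrow> a i \<in> carrier G" and "finite J"
    and "\<And>j. j \<in> J \<Longrightarrow> b j \<in> generate G (a ` I)"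
  shows "\<exists>\<Phi> B. 0 \<le> B \<and> linear \<Phi> \<and> (\<forall>x. (\<forall>j. x j \<in> GR) \<longrightarrow> \<Phi> x \<in> tuples
    \<and> bd a (\<Phi> x) = (\<Sum>j\<in>J. R (b j) (x j) - x j)
    \<and> tp.nrm (\<Phi> x) \<le> B * (\<Sum>j\<in>J. gr.nrm (x j)))"
  using assms(2,3)
proof (induction J rule: finite_induct)
  case empty
  have "linear (\<lambda>x. 0 :: 'i \<Rightarrow> 'a \<Rightarrow> complex)" by (rule linear_zero)
  moreover have "bd a 0 = (\<Sum>j\<in>{}. R (b j) (x j) - x j)" for x
    by (simp only: sum.empty linear_0[OF linear_bd])
  moreover have "tp.nrm 0 \<le> 0 * (\<Sum>j\<in>{}. gr.nrm (x j))" for x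
    by (simp only: tp.nrm_zero mult_zero_left order_refl)
  ultimately show ?case
    using tp.V_zero order_refl[of "0::real"] by blast
next
  case (insert j J)
  have bJ: "\<And>j. j \<in> J \<Longrightarrow> b j \<in> generate G (a ` I)" and bj: "b j \<in> generate G (a ` I)"
    using insert.prems by simp_all
  obtain \<Phi> B where P: "0 \<le> B" "linear \<Phi>" "\<And>x. \<forall>j. x j \<in> GR \<Longrightarrow> \<Phi> x \<in> tuples"
    "\<And>x. \<forall>j. x j \<in> GR \<Longrightarrow> bd a (\<Phi> x) = (\<Sum>j\<in>J. R (b j) (x j) - x j)"
    "\<And>x. \<forall>j. x j \<in> GR \<Longrightarrow> tp.nrm (\<Phi> x) \<le> B * (\<Sum>j\<in>J. gr.nrm (x j))"
    using insert.IH[OF bJ] by blast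
  obtain \<mu> D where h: "0 \<le> D" "linear \<mu>" "\<And>x. x \<in> GR \<Longrightarrow> \<mu> x \<in> tuples"
    "\<And>x. x \<in> GR \<Longrightarrow> bd a (\<mu> x) = R (b j) x - x" "\<And>x. x \<in> GR \<Longrightarrow> tp.nrm (\<mu> x) \<le> D * gr.nrm x"
    using lift_element[of a "b j", OF a bj] by blast
  let ?\<Phi> = "\<lambda>x. \<mu> (x j) + \<Phi> x"
  have "linear ?\<Phi>"
  proof (rule linearI)
    show "?\<Phi> (x + y) = ?\<Phi> x + ?\<Phi> y" for x y
      unfolding plus_fun_apply[of x y] linear_add[OF h(2)] linear_add[OF P(2)]
      by (simp only: add_ac)
    show "?\<Phi> (r *\<^sub>R x) = r *\<^sub>R ?\<Phi> x" for r x
      unfolding scaleR_fun_apply[of r x] linear_scale[OF h(2)] linear_scale[OF P(2)]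
      by (simp only: scaleR_add_right)
  qed
  moreover have "?\<Phi> x \<in> tuples" if "\<forall>j. x j \<in> GR" for x
    using that by (intro tp.V_add h(3) P(3)) auto
  moreover have "bd a (?\<Phi> x) = (\<Sum>j\<in>insert j J. R (b j) (x j) - x j)" if "\<forall>j. x j \<in> GR" for x
    unfolding linear_add[OF linear_bd] P(4)[OF that] h(4)[OF that[rule_format]]
    by (simp only: sum.insert[OF insert.hyps])
  moreover have "tp.nrm (?\<Phi> x) \<le> (B + D) * (\<Sum>j\<in>insert j J. gr.nrm (x j))" if x: "\<forall>j. x j \<in> GR" for x
  proof -
    have "0 \<le> D * (\<Sum>j\<in>J. gr.nrm (x j))" "0 \<le> B * gr.nrm (x j)"
      using P(1) h(1) x by (auto intro!: mult_nonneg_nonneg sum_nonneg)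
    then show ?thesis
      using tp.nrm_triangle[OF h(3)[OF x[rule_format, of j]] P(3)[OF x]] P(5)[OF x]
        h(5)[OF x[rule_format, of j]]
      unfolding sum.insert[OF insert.hyps] distrib_right distrib_left by linarith
  qed
  moreover have "0 \<le> B + D" using P(1) h(1) by simp
  ultimately show ?case by blast
qed

lemma sum_nrm_le:
  assumes "x \<in> tuples"
  shows "(\<Sum>i\<in>I. gr.nrm (x i)) \<le> real (card I) * tp.nrm x"
  using sum_bounded_above[of I "\<lambda>i. gr.nrm (x i)" "tp.nrm x"] nrm_component_le[OF assms] by simp

end

locale change_of_generators = commuting_path G \<psi> m a + t: group_ring_tuples G \<psi> T
  for G :: "('a, 'b) monoid_scheme" (structure) and \<psi> m a and T :: "'a set" +
  assumes a_generate: "carrier G \<subseteq> generate G (a ` {..m})"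
    and T_carrier: "T \<subseteq> carrier G" and T_generate: "carrier G \<subseteq> generate G T"
begin

text \<open>The sequence is sent to the walk by \<open>\<Phi>\<close>, approximated there, and
  brought back by \<open>\<Theta>\<close>. Both maps preserve the boundary, so although their
  composite is not the identity, it changes a tuple only by a cycle.\<close>

lemma cauchy_near_cycle_generators:
  assumes x: "t.tp.cauchy x" and lim: "(\<lambda>n. gr.nrm (t.bd (\<lambda>t. t) (x n))) \<longlonglongrightarrow> 0" and e: "0 < e"
  shows "\<exists>z\<in>t.tuples. t.bd (\<lambda>t. t) z = 0 \<and> (\<exists>N. \<forall>n\<ge>N. t.tp.nrm (x n - z) < e)"
proof -
  have aT: "\<And>t. t \<in> T \<Longrightarrow> t \<in> generate G (a ` {..m})"
    using T_carrier a_generate by blast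
  have Ta: "\<And>k. k \<in> {..m} \<Longrightarrow> a k \<in> generate G ((\<lambda>t. t) ` T)"
    using a_carrier T_generate by auto
  have ac: "\<And>k. k \<in> {..m} \<Longrightarrow> a k \<in> carrier G" by (simp add: a_carrier)
  have Tc: "\<And>t. t \<in> T \<Longrightarrow> t \<in> carrier G" using T_carrier by blast
  obtain \<Phi> B where P: "0 \<le> B" "linear \<Phi>" "\<And>x. \<forall>j. x j \<in> GR \<Longrightarrow> \<Phi> x \<in> tuples"
    "\<And>x. \<forall>j. x j \<in> GR \<Longrightarrow> bd a (\<Phi> x) = (\<Sum>j\<in>T. R j (x j) - x j)"
    "\<And>x. \<forall>j. x j \<in> GR \<Longrightarrow> tp.nrm (\<Phi> x) \<le> B * (\<Sum>j\<in>T. gr.nrm (x j))"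
    using lift_family[of a T "\<lambda>t. t", OF ac t.finite_I aT] by blast
  obtain \<Theta> D where \<Theta>: "0 \<le> D" "linear \<Theta>" "\<And>x. \<forall>j. x j \<in> GR \<Longrightarrow> \<Theta> x \<in> t.tuples"
    "\<And>x. \<forall>j. x j \<in> GR \<Longrightarrow> t.bd (\<lambda>t. t) (\<Theta> x) = (\<Sum>j\<in>{..m}. R (a j) (x j) - x j)"
    "\<And>x. \<forall>j. x j \<in> GR \<Longrightarrow> t.tp.nrm (\<Theta> x) \<le> D * (\<Sum>j\<in>{..m}. gr.nrm (x j))"
    using t.lift_family[of "\<lambda>t. t" "{..m}" a, OF Tc finite_I Ta] by blast
  have xV: "x n \<in> t.tuples" for n using x by simp
  have comp: "\<forall>j. y j \<in> GR" if "y \<in> t.tuples" for y using that by simp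
  have comp': "\<forall>j. y j \<in> GR" if "y \<in> tuples" for y using that by simp
  define b where "b = B * real (card T)"
  define d where "d = D * real (card {..m})"
  have bd0: "0 \<le> b" "0 \<le> d" using P(1) \<Theta>(1) by (simp_all add: b_def d_def)
  have Pb: "tp.nrm (\<Phi> y) \<le> b * t.tp.nrm y" if y: "y \<in> t.tuples" for y
    using P(5)[OF comp[OF y]] mult_left_mono[OF t.sum_nrm_le[OF y] P(1)]
    unfolding b_def mult.assoc by linarith
  have Xd: "t.tp.nrm (\<Theta> y) \<le> d * tp.nrm y" if y: "y \<in> tuples" for y
    using \<Theta>(5)[OF comp'[OF y]] mult_left_mono[OF sum_nrm_le[OF y] \<Theta>(1)]
    unfolding d_def mult.assoc by linarith
  have PV: "\<Phi> y \<in> tuples" if "y \<in> t.tuples" for y using P(3)[OF comp[OF that]] .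
  have XV: "\<Theta> y \<in> t.tuples" if "y \<in> tuples" for y using \<Theta>(3)[OF comp'[OF that]] .
  have Pbd: "bd a (\<Phi> y) = t.bd (\<lambda>t. t) y" if "y \<in> t.tuples" for y
    unfolding P(4)[OF comp[OF that]] t.bd_def ..
  have Xbd: "t.bd (\<lambda>t. t) (\<Theta> y) = bd a y" if "y \<in> tuples" for y
    unfolding \<Theta>(4)[OF comp'[OF that]] bd_def ..
  have "tp.cauchy (\<lambda>n. \<Phi> (x n))"
    unfolding tp.cauchy_def
  proof (intro conjI allI impI)
    show "\<Phi> (x n) \<in> tuples" for n by (intro PV xV)
    fix e :: real assume "e > 0"
    then have "e / (b + 1) > 0" using bd0 by simp
    then obtain N where N: "\<And>p q. p \<ge> N \<Longrightarrow> q \<ge> N \<Longrightarrow> t.tp.nrm (x p - x q) < e / (b + 1)"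
      using x unfolding t.tp.cauchy_def by blast
    have "tp.nrm (\<Phi> (x p) - \<Phi> (x q)) < e" if "p \<ge> N" "q \<ge> N" for p q
    proof -
      have dV: "x p - x q \<in> t.tuples" by (intro t.tp.V_diff xV)
      have "tp.nrm (\<Phi> (x p) - \<Phi> (x q)) \<le> b * t.tp.nrm (x p - x q)"
        unfolding linear_diff[OF P(2), symmetric] by (rule Pb[OF dV])
      also have "\<dots> \<le> (b + 1) * t.tp.nrm (x p - x q)"
        using t.tp.nrm_nonneg[OF dV] by (simp add: distrib_right)
      also have "\<dots> < e"
        using N[OF that] bd0 by (simp add: pos_less_divide_eq mult.commute)
      finally show ?thesis .
    qed
    then show "\<exists>N. \<forall>p\<ge>N. \<forall>q\<ge>N. tp.nrm (\<Phi> (x p) - \<Phi> (x q)) < e" by blast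
  qed
  moreover have "(\<lambda>n. gr.nrm (bd a (\<Phi> (x n)))) \<longlonglongrightarrow> 0"
    using lim unfolding Pbd[OF xV] .
  \<comment> \<open>The error is multiplied by at most \<open>d\<close> under
    \<open>\<Theta>\<close>; \<open>d + 1\<close> is positive even if \<open>d\<close>
    vanishes.\<close>
  moreover have e': "0 < e / (2 * (d + 1))" using e bd0 by simp
  ultimately obtain z N1 where z: "z \<in> tuples" "bd a z = 0"
    and N1: "\<And>n. n \<ge> N1 \<Longrightarrow> tp.nrm (\<Phi> (x n) - z) < e / (2 * (d + 1))"
    using cauchy_near_cycle by blast
  have "e / 2 > 0" using e by simp
  then obtain N2 where N2: "\<And>p q. p \<ge> N2 \<Longrightarrow> q \<ge> N2 \<Longrightarrow> t.tp.nrm (x p - x q) < e / 2"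
    using x unfolding t.tp.cauchy_def by blast
  define N where "N = max N1 N2"
  \<comment> \<open>The second summand is the cycle by which the round trip changes
    \<open>x N\<close>; adding it back makes \<open>z'\<close> close to \<open>x N\<close>.\<close>
  define z' where "z' = \<Theta> z + (x N - \<Theta> (\<Phi> (x N)))"
  have z'V: "z' \<in> t.tuples"
    unfolding z'_def by (intro t.tp.V_add t.tp.V_diff XV PV xV z)
  have "t.bd (\<lambda>t. t) z' = 0"
    unfolding z'_def linear_add[OF t.linear_bd] linear_diff[OF t.linear_bd]
    by (simp only: Xbd z PV xV Pbd diff_self add_0_left)
  moreover have "t.tp.nrm (x n - z') < e" if n: "n \<ge> N" for n
  proof -
    have dV: "\<Phi> (x N) - z \<in> tuples" by (intro tp.V_diff PV xV z)
    have eq: "x n - z' = (x n - x N) + \<Theta> (\<Phi> (x N) - z)"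
      unfolding z'_def linear_diff[OF \<Theta>(2)] by (simp only: algebra_simps)
    have "t.tp.nrm (x n - z') \<le> t.tp.nrm (x n - x N) + t.tp.nrm (\<Theta> (\<Phi> (x N) - z))"
      unfolding eq by (intro t.tp.nrm_triangle t.tp.V_diff xV XV dV)
    moreover have "t.tp.nrm (x n - x N) < e / 2"
      using n by (intro N2) (auto simp: N_def)
    moreover have "t.tp.nrm (\<Theta> (\<Phi> (x N) - z)) \<le> e / 2"
    proof -
      have "t.tp.nrm (\<Theta> (\<Phi> (x N) - z)) \<le> d * tp.nrm (\<Phi> (x N) - z)" by (rule Xd[OF dV])
      also have "\<dots> \<le> (d + 1) * tp.nrm (\<Phi> (x N) - z)"
        using tp.nrm_nonneg[OF dV] by (simp add: distrib_right)
      also have "\<dots> \<le> (d + 1) * (e / (2 * (d + 1)))"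
        using N1[of N] bd0 by (intro mult_left_mono less_imp_le) (auto simp: N_def)
      also have "\<dots> = e / 2"
      proof -
        have q: "q * (e / (2 * q)) = e / 2" if "q \<noteq> 0" for q using that by simp
        show ?thesis by (rule q) (use bd0 in simp)
      qed
      finally show ?thesis .
    qed
    ultimately show ?thesis by linarith
  qed
  ultimately show ?thesis using z'V by blast
qed

end

section \<open>Generators of quotients of right-angled Artin groups\<close>

lemma raag_step_context:
  assumes "raag_step \<Gamma> u v"
  shows "raag_step \<Gamma> (p @ u @ q) (p @ v @ q)"
  using assms
proof cases
  case (cancel i u' b v')
  then show ?thesis using raag_step.cancel[of i \<Gamma> "p @ u'" b "v' @ q"] by simp
next
  case (commute i j u' v')
  then show ?thesis using raag_step.commute[of i j \<Gamma> "p @ u'" "v' @ q"] by simp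
qed

lemma equivclp_raag_step_context:
  assumes "equivclp (raag_step \<Gamma>) u v"
  shows "equivclp (raag_step \<Gamma>) (p @ u @ q) (p @ v @ q)"
  using assms
proof (induction rule: equivclp_induct)
  case (step y z)
  then have "raag_step \<Gamma> (p @ y @ q) (p @ z @ q) \<or> raag_step \<Gamma> (p @ z @ q) (p @ y @ q)"
    using raag_step_context by blast
  then show ?case using step.IH equivclp_into_equivclp by metis
qed simp

definition raag_class :: "'i pair_pre_digraph \<Rightarrow> ('i \<times> bool) list \<Rightarrow> ('i \<times> bool) list set" where
  "raag_class \<Gamma> w = raag_rel \<Gamma> `` {w}"

lemma raag_words_append: "u \<in> raag_words \<Gamma> \<Longrightarrow> v \<in> raag_words \<Gamma> \<Longrightarrow> u @ v \<in> raag_words \<Gamma>"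
  by (auto simp: raag_words_def)

lemma equiv_raag_rel: "equiv (raag_words \<Gamma>) (raag_rel \<Gamma>)"
proof (rule equivI)
  show "raag_rel \<Gamma> \<subseteq> raag_words \<Gamma> \<times> raag_words \<Gamma>" by (auto simp: raag_rel_def)
  show "refl_on (raag_words \<Gamma>) (raag_rel \<Gamma>)" by (auto simp: refl_on_def raag_rel_def)
  show "sym (raag_rel \<Gamma>)" by (auto simp: sym_def raag_rel_def intro: equivclp_sym)
  show "trans (raag_rel \<Gamma>)" by (auto simp: trans_def raag_rel_def intro: equivclp_trans)
qed

lemma raag_class_carrier: "w \<in> raag_words \<Gamma> \<Longrightarrow> raag_class \<Gamma> w \<in> carrier (raag \<Gamma>)"
  by (simp add: raag_def raag_class_def quotientI)

lemma raag_carrierE: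
  assumes "A \<in> carrier (raag \<Gamma>)"
  obtains w where "w \<in> raag_words \<Gamma>" "A = raag_class \<Gamma> w"
  using assms by (auto simp: raag_def raag_class_def elim: quotientE)

lemma raag_class_eqI:
  "u \<in> raag_words \<Gamma> \<Longrightarrow> v \<in> raag_words \<Gamma> \<Longrightarrow> raag_step \<Gamma> u v \<Longrightarrow> raag_class \<Gamma> u = raag_class \<Gamma> v"
  unfolding raag_class_def
  by (rule equiv_class_eq[OF equiv_raag_rel]) (auto simp: raag_rel_def)

text \<open>The product is defined on whole classes; since the congruence is stable under context,
  every concatenation of representatives lies in one class.\<close>

lemma raag_mult:
  assumes "u \<in> raag_words \<Gamma>" "v \<in> raag_words \<Gamma>"
  shows "raag_class \<Gamma> u \<otimes>\<^bsub>raag \<Gamma>\<^esub> raag_class \<Gamma> v = raag_class \<Gamma> (u @ v)"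
proof -
  let ?S = "{x @ y | x y. x \<in> raag_class \<Gamma> u \<and> y \<in> raag_class \<Gamma> v}"
  have "raag_class \<Gamma> x = raag_class \<Gamma> (u @ v)" if "x \<in> ?S" for x
  proof -
    obtain p q where x: "x = p @ q" and p: "(u, p) \<in> raag_rel \<Gamma>" and q: "(v, q) \<in> raag_rel \<Gamma>"
      using \<open>x \<in> ?S\<close> by (auto simp: raag_class_def)
    have "equivclp (raag_step \<Gamma>) (u @ v) (p @ v)"
      using p equivclp_raag_step_context[of \<Gamma> u p "[]" v] by (simp add: raag_rel_def)
    moreover have "equivclp (raag_step \<Gamma>) (p @ v) (p @ q)"
      using q equivclp_raag_step_context[of \<Gamma> v q p "[]"] by (simp add: raag_rel_def)
    ultimately have "(u @ v, x) \<in> raag_rel \<Gamma>"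
      using p q x by (auto simp: raag_rel_def intro: raag_words_append equivclp_trans)
    then show ?thesis
      unfolding raag_class_def by (rule equiv_class_eq[OF equiv_raag_rel, symmetric])
  qed
  moreover have "u \<in> raag_class \<Gamma> u" "v \<in> raag_class \<Gamma> v"
    using assms by (auto simp: raag_class_def raag_rel_def)
  then have "u @ v \<in> ?S" by blast
  ultimately have "raag_rel \<Gamma> `` ?S = raag_class \<Gamma> (u @ v)"
    unfolding raag_class_def by blast
  then show ?thesis by (simp add: raag_def)
qed

locale raag_quotient = group G for G :: "('a, 'b) monoid_scheme" (structure) +
  fixes \<Gamma> :: "'i pair_pre_digraph" and \<pi> :: "('i \<times> bool) list set \<Rightarrow> 'a"
  assumes epi: "\<pi> \<in> epi (raag \<Gamma>) G"
    and wf: "pair_wf_digraph \<Gamma>"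
begin

abbreviation ev :: "('i \<times> bool) list \<Rightarrow> 'a" where
  "ev w \<equiv> \<pi> (raag_class \<Gamma> w)"

lemma ev_carrier: "w \<in> raag_words \<Gamma> \<Longrightarrow> ev w \<in> carrier G"
  using epi raag_class_carrier by (auto simp: epi_def hom_def)

lemma ev_append: "u \<in> raag_words \<Gamma> \<Longrightarrow> v \<in> raag_words \<Gamma> \<Longrightarrow> ev (u @ v) = ev u \<otimes> ev v"
  using epi raag_class_carrier[of u \<Gamma>] raag_class_carrier[of v \<Gamma>]
    hom_mult[of \<pi> "raag \<Gamma>" G "raag_class \<Gamma> u" "raag_class \<Gamma> v"] raag_mult[of u \<Gamma> v]
  by (simp add: epi_def)

text \<open>By multiplicativity the value is idempotent, and the only idempotent of a group is the
  identity.\<close>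

lemma ev_Nil: "ev [] = \<one>"
proof -
  have "[] \<in> raag_words \<Gamma>" by (simp add: raag_words_def)
  then have "ev [] \<otimes> ev [] = ev []" "ev [] \<in> carrier G"
    using ev_append[of "[]" "[]"] ev_carrier by simp_all
  then show ?thesis by simp
qed

lemma letter: "i \<in> pverts \<Gamma> \<Longrightarrow> [(i, b)] \<in> raag_words \<Gamma>"
  by (simp add: raag_words_def)

lemma ev_inverse:
  assumes i: "i \<in> pverts \<Gamma>"
  shows "ev [(i, False)] = inv (ev [(i, True)])"
proof -
  have "raag_class \<Gamma> ([(i, False)] @ [(i, True)]) = raag_class \<Gamma> []"
    using raag_step.cancel[OF i, of "[]" False "[]"] i
    by (intro raag_class_eqI) (auto simp: raag_words_def)
  then have "ev [(i, False)] \<otimes> ev [(i, True)] = \<one>"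
    using i ev_Nil by (simp flip: ev_append add: letter)
  then show ?thesis
    using i ev_carrier letter by (metis inv_equality)
qed

lemma ev_generator_carrier: "i \<in> pverts \<Gamma> \<Longrightarrow> \<pi> (raag_gen \<Gamma> i) \<in> carrier G"
  using ev_carrier[OF letter] by (simp add: raag_gen_def raag_class_def)

lemma ev_generator_commute:
  assumes "(i, j) \<in> parcs \<Gamma>"
  shows "\<pi> (raag_gen \<Gamma> i) \<otimes> \<pi> (raag_gen \<Gamma> j) = \<pi> (raag_gen \<Gamma> j) \<otimes> \<pi> (raag_gen \<Gamma> i)"
proof -
  have ij: "i \<in> pverts \<Gamma>" "j \<in> pverts \<Gamma>"
    using assms wf by (auto dest: pair_wf_digraph.in_arcsD1 pair_wf_digraph.in_arcsD2)
  have "raag_class \<Gamma> ([(i, True)] @ [(j, True)]) = raag_class \<Gamma> ([(j, True)] @ [(i, True)])"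
    using raag_step.commute[OF assms, of "[]" "[]"] ij
    by (intro raag_class_eqI) (auto simp: raag_words_def)
  then have "ev [(i, True)] \<otimes> ev [(j, True)] = ev [(j, True)] \<otimes> ev [(i, True)]"
    using ij by (simp flip: ev_append add: letter)
  then show ?thesis by (simp add: raag_gen_def raag_class_def)
qed

lemma generators_generate: "carrier G \<subseteq> generate G ((\<lambda>i. \<pi> (raag_gen \<Gamma> i)) ` pverts \<Gamma>)"
proof
  fix g assume "g \<in> carrier G"
  then obtain A where "A \<in> carrier (raag \<Gamma>)" "g = \<pi> A"
    using epi by (auto simp: epi_def)
  then obtain w where w: "w \<in> raag_words \<Gamma>" "g = ev w"
    by (auto elim: raag_carrierE)
  have "ev w \<in> generate G ((\<lambda>i. \<pi> (raag_gen \<Gamma> i)) ` pverts \<Gamma>)" if "w \<in> raag_words \<Gamma>" for w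
    using that
  proof (induction w)
    case Nil
    then show ?case by (simp add: ev_Nil generate.one)
  next
    case (Cons x w)
    obtain i b where x: "x = (i, b)" by fastforce
    have i: "i \<in> pverts \<Gamma>" and w: "w \<in> raag_words \<Gamma>"
      using Cons.prems x by (auto simp: raag_words_def)
    have T: "ev [(i, True)] = \<pi> (raag_gen \<Gamma> i)" by (simp add: raag_gen_def raag_class_def)
    have "ev [(i, b)] \<in> generate G ((\<lambda>i. \<pi> (raag_gen \<Gamma> i)) ` pverts \<Gamma>)"
    proof (cases b)
      case True
      then show ?thesis using i T by (auto intro: generate.incl)
    next
      case False
      then show ?thesis using i T ev_inverse[OF i] by (auto intro: generate.inv)
    qed
    then show ?case
      using Cons.IH[OF w] ev_append[OF letter[OF i] w, of b] x by (simp add: generate.eng)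
  qed
  then show "g \<in> generate G ((\<lambda>i. \<pi> (raag_gen \<Gamma> i)) ` pverts \<Gamma>)" using w by simp
qed

end

section \<open>Walks in a connected graph\<close>

lemma rtrancl_on_path:
  assumes "(u, v) \<in> rtrancl_on V E"
  shows "\<exists>q. successively (\<lambda>x y. (x, y) \<in> E) (u # q) \<and> last (u # q) = v \<and> set q \<subseteq> V"
  using assms
proof (induction rule: rtrancl_on_induct)
  case base
  show ?case by (rule exI[of _ "[]"]) simp
next
  case (step y z)
  then obtain q where "successively (\<lambda>x y. (x, y) \<in> E) (u # q)" "last (u # q) = y" "set q \<subseteq> V"
    by blast
  then show ?case
    using step by (intro exI[of _ "q @ [z]"]) (simp add: successively_append_iff flip: append_Cons)
qed

text \<open>The walk is prolonged by a path from its last vertex to each vertex still missing, so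
  repetitions are allowed. For a single vertex \<open>m = 0\<close> and there is no edge
  condition.\<close>

lemma covering_walk:
  assumes \<Gamma>: "pair_graph \<Gamma>" and conn: "Digraph_Component.connected (with_proj \<Gamma>)"
  shows "\<exists>(m::nat) a. a ` {..m} = pverts \<Gamma> \<and> (\<forall>k<m. (a k, a (Suc k)) \<in> parcs \<Gamma>)"
proof -
  interpret pair_graph \<Gamma> by (rule \<Gamma>)
  \<comment> \<open>Connectedness is defined through the symmetric closure, which changes nothing
    for a symmetric arc relation.\<close>
  have arcs: "parcs (mk_symmetric (with_proj \<Gamma>)) = parcs \<Gamma>"
    using adj_mk_symmetric_eq pair_sym_arcs by simp
  have reach: "(u, v) \<in> rtrancl_on (pverts \<Gamma>) (parcs \<Gamma>)" if "u \<in> pverts \<Gamma>" "v \<in> pverts \<Gamma>" for u v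
    using conn that unfolding connected_def strongly_connected_def reachable_def by (simp add: arcs)
  obtain u where u: "u \<in> pverts \<Gamma>"
    using conn unfolding connected_def strongly_connected_def by auto
  have "\<exists>p. p \<noteq> [] \<and> set p \<subseteq> pverts \<Gamma> \<and> F \<subseteq> set p \<and> successively (\<lambda>x y. (x, y) \<in> parcs \<Gamma>) p"
    if "F \<subseteq> pverts \<Gamma>" for F
    using finite_subset[OF that pair_finite_verts] that
  proof (induction F rule: finite_induct)
    case empty
    show ?case using u by (intro exI[of _ "[u]"]) simp
  next
    case (insert v F)
    then obtain p where p: "p \<noteq> []" "set p \<subseteq> pverts \<Gamma>" "F \<subseteq> set p"
      "successively (\<lambda>x y. (x, y) \<in> parcs \<Gamma>) p" by auto
    then have "last p \<in> pverts \<Gamma>" by auto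
    then obtain q where q: "successively (\<lambda>x y. (x, y) \<in> parcs \<Gamma>) (last p # q)"
      "last (last p # q) = v" "set q \<subseteq> pverts \<Gamma>"
      using rtrancl_on_path[OF reach[of "last p" v]] insert.prems by blast
    have "v \<in> set (p @ q)"
      using q(2) p(1) last_in_set[of "last p # q"] by (auto split: if_splits)
    then show ?case
      using p q by (intro exI[of _ "p @ q"]) (auto simp: successively_append_iff successively_Cons)
  qed
  from this[OF order_refl] obtain p where p: "p \<noteq> []" "set p = pverts \<Gamma>"
    "successively (\<lambda>x y. (x, y) \<in> parcs \<Gamma>) p" by auto
  have "{..length p - 1} = {..<length p}" using p(1) by (cases p) auto
  then have "(!) p ` {..length p - 1} = pverts \<Gamma>"
    using p(2) by (auto simp: set_conv_nth)
  moreover have "\<forall>k < length p - 1. (p ! k, p ! Suc k) \<in> parcs \<Gamma>"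
    using p(3) by (auto simp: successively_conv_nth)
  ultimately show ?thesis by blast
qed

section \<open>The Hilbert space completions\<close>

context character_group
begin

lemma psi_cauchy_iff: "x \<in> psi_cauchy G \<psi> \<longleftrightarrow> gr.cauchy x"
  unfolding psi_cauchy_def gr.cauchy_def psi_seminorm_eq mem_Collect_eq fun_diff_def by (rule refl)

lemma psi_null_rel_iff:
  "(x, y) \<in> psi_null_rel G \<psi> \<longleftrightarrow>
    gr.cauchy x \<and> gr.cauchy y \<and> (\<lambda>n. gr.nrm (x n - y n)) \<longlonglongrightarrow> 0"
  unfolding psi_null_rel_def psi_seminorm_eq fun_diff_def by (simp add: psi_cauchy_iff)

lemma cauchy_const: "x \<in> GR \<Longrightarrow> gr.cauchy (\<lambda>n. x)"
  unfolding gr.cauchy_def by (simp only: diff_self gr.nrm_zero) blast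

lemma cauchy_diff:
  assumes "gr.cauchy x" "gr.cauchy y"
  shows "gr.cauchy (\<lambda>n. x n - y n)"
  unfolding gr.cauchy_def
proof (intro conjI allI impI)
  have V: "x n \<in> GR" "y n \<in> GR" for n using assms by simp_all
  show "x n - y n \<in> GR" for n using V by (intro gr.V_diff)
  fix e :: real assume "e > 0"
  then have e: "e / 2 > 0" by simp
  obtain N1 where N1: "\<And>m n. m \<ge> N1 \<Longrightarrow> n \<ge> N1 \<Longrightarrow> gr.nrm (x m - x n) < e / 2"
    using assms(1) e unfolding gr.cauchy_def by blast
  obtain N2 where N2: "\<And>m n. m \<ge> N2 \<Longrightarrow> n \<ge> N2 \<Longrightarrow> gr.nrm (y m - y n) < e / 2"
    using assms(2) e unfolding gr.cauchy_def by blast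
  have "gr.nrm (x m - y m - (x n - y n)) < e" if mn: "m \<ge> max N1 N2" "n \<ge> max N1 N2" for m n
  proof -
    have "x m - y m - (x n - y n) = (x m - x n) - (y m - y n)" by (rule ext) simp
    then have "gr.nrm (x m - y m - (x n - y n)) \<le> gr.nrm (x m - x n) + gr.nrm (y m - y n)"
      by (simp only:) (intro gr.nrm_triangle_diff gr.V_diff V)
    then show ?thesis using N1[of m n] N2[of m n] mn by simp
  qed
  then show "\<exists>N. \<forall>m\<ge>N. \<forall>n\<ge>N. gr.nrm (x m - y m - (x n - y n)) < e" by blast
qed

lemma nrm_diff_abs_le:
  assumes "x \<in> GR" "y \<in> GR"
  shows "\<bar>gr.nrm x - gr.nrm y\<bar> \<le> gr.nrm (x - y)"
  using gr.nrm_triangle_sub[OF assms] gr.nrm_triangle_sub[OF assms(2,1)]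
    gr.nrm_diff_commute[OF assms] by linarith

lemma cauchy_nrm_convergent:
  assumes "gr.cauchy x"
  shows "convergent (\<lambda>n. gr.nrm (x n))"
proof -
  have V: "x n \<in> GR" for n using assms by simp
  have "Cauchy (\<lambda>n. gr.nrm (x n))"
  proof (rule CauchyI)
    fix e :: real assume "e > 0"
    then obtain N where "\<And>m n. m \<ge> N \<Longrightarrow> n \<ge> N \<Longrightarrow> gr.nrm (x m - x n) < e"
      using assms unfolding gr.cauchy_def by blast
    then show "\<exists>M. \<forall>m\<ge>M. \<forall>n\<ge>M. norm (gr.nrm (x m) - gr.nrm (x n)) < e"
      using nrm_diff_abs_le[OF V V] unfolding real_norm_def by (meson le_less_trans)
  qed
  then show ?thesis by (simp add: Cauchy_convergent_iff)
qed

lemma equiv_psi_null_rel: "equiv (psi_cauchy G \<psi>) (psi_null_rel G \<psi>)"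
proof (rule equivI)
  show "psi_null_rel G \<psi> \<subseteq> psi_cauchy G \<psi> \<times> psi_cauchy G \<psi>"
    by (auto simp: psi_null_rel_def)
  show "refl_on (psi_cauchy G \<psi>) (psi_null_rel G \<psi>)"
    by (auto simp only: refl_on_def psi_null_rel_iff psi_cauchy_iff diff_self gr.nrm_zero tendsto_const)
  show "sym (psi_null_rel G \<psi>)"
  proof (rule symI)
    fix x y assume xy: "(x, y) \<in> psi_null_rel G \<psi>"
    then have V: "x n \<in> GR" "y n \<in> GR" for n by (simp_all add: psi_null_rel_iff)
    show "(y, x) \<in> psi_null_rel G \<psi>"
      using xy unfolding psi_null_rel_iff gr.nrm_diff_commute[OF V] by blast
  qed
  show "trans (psi_null_rel G \<psi>)"
  proof (rule transI)
    fix x y z assume xy: "(x, y) \<in> psi_null_rel G \<psi>" and yz: "(y, z) \<in> psi_null_rel G \<psi>"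
    have V: "x n \<in> GR" "y n \<in> GR" "z n \<in> GR" for n
      using xy yz by (simp_all add: psi_null_rel_iff)
    have le: "gr.nrm (x n - z n) \<le> gr.nrm (x n - y n) + gr.nrm (y n - z n)" for n
    proof -
      have "x n - z n = (x n - y n) + (y n - z n)" by (rule ext) simp
      then show ?thesis by (simp only:) (intro gr.nrm_triangle gr.V_diff V)
    qed
    have lim: "(\<lambda>n. gr.nrm (x n - y n) + gr.nrm (y n - z n)) \<longlonglongrightarrow> 0"
      using xy yz unfolding psi_null_rel_iff by (intro tendsto_add_zero) blast+
    have "(\<lambda>n. gr.nrm (x n - z n)) \<longlonglongrightarrow> 0"
      by (rule gr.tendsto_sandwich_nrm[OF gr.V_diff[OF V(1,3)] le lim])
    then show "(x, z) \<in> psi_null_rel G \<psi>"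
      using xy yz unfolding psi_null_rel_iff by blast
  qed
qed

lemma lpsi_class_eq_iff:
  assumes "gr.cauchy x" "gr.cauchy y"
  shows "lpsi_class G \<psi> x = lpsi_class G \<psi> y \<longleftrightarrow> (\<lambda>n. gr.nrm (x n - y n)) \<longlonglongrightarrow> 0"
  unfolding lpsi_class_def
  using eq_equiv_class_iff[OF equiv_psi_null_rel, of x y] assms
  by (simp only: psi_cauchy_iff psi_null_rel_iff simp_thms)

lemma lpsi_class_lpsi: "gr.cauchy x \<Longrightarrow> lpsi_class G \<psi> x \<in> lpsi G \<psi>"
  unfolding lpsi_class_def lpsi_def by (rule quotientI) (simp add: psi_cauchy_iff)

lemma lpsi_rep:
  assumes "\<xi> \<in> lpsi G \<psi>"
  shows "gr.cauchy (lpsi_rep \<xi>)" and "lpsi_class G \<psi> (lpsi_rep \<xi>) = \<xi>"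
proof -
  obtain x where x: "x \<in> psi_cauchy G \<psi>" "\<xi> = psi_null_rel G \<psi> `` {x}"
    using assms unfolding lpsi_def by (rule quotientE)
  have "x \<in> \<xi>" unfolding x(2) by (rule equiv_class_self[OF equiv_psi_null_rel x(1)])
  then have "lpsi_rep \<xi> \<in> \<xi>" unfolding lpsi_rep_def by (rule someI[of "\<lambda>x. x \<in> \<xi>"])
  then have r: "(x, lpsi_rep \<xi>) \<in> psi_null_rel G \<psi>" unfolding x(2) by simp
  then show "gr.cauchy (lpsi_rep \<xi>)" by (simp only: psi_null_rel_iff)
  show "lpsi_class G \<psi> (lpsi_rep \<xi>) = \<xi>"
    using equiv_class_eq[OF equiv_psi_null_rel r] unfolding lpsi_class_def x(2) by simp
qed

lemma lpsi_rep_class: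
  assumes "gr.cauchy x"
  shows "(\<lambda>n. gr.nrm (lpsi_rep (lpsi_class G \<psi> x) n - x n)) \<longlonglongrightarrow> 0"
  using lpsi_rep[OF lpsi_class_lpsi[OF assms]] lpsi_class_eq_iff[OF _ assms] by blast

lemma tendsto_nrm_eq:
  assumes "gr.cauchy x" "gr.cauchy y" "(\<lambda>n. gr.nrm (x n - y n)) \<longlonglongrightarrow> 0" "(\<lambda>n. gr.nrm (y n)) \<longlonglongrightarrow> l"
  shows "(\<lambda>n. gr.nrm (x n)) \<longlonglongrightarrow> l"
proof -
  have "(\<lambda>n. gr.nrm (x n) - gr.nrm (y n)) \<longlonglongrightarrow> 0"
    by (rule tendsto_0_le[OF assms(3), of _ 1], rule always_eventually)
      (use nrm_diff_abs_le assms(1,2) in simp)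
  from tendsto_add[OF this assms(4)] show ?thesis by simp
qed

lemma psi_form_self: "x \<in> GR \<Longrightarrow> psi_form G \<psi> x x = complex_of_real ((gr.nrm x)\<^sup>2)"
  using psi_form_nonneg[of x]
  by (auto simp: gr.nrm_sq ipr_def complex_nonneg_Reals_iff complex_eq_iff)

text \<open>The inner product is a limit along chosen representatives; these differ from
  \<open>x\<close> by a null sequence, so the limit of the norms can be read off from
  \<open>x\<close>.\<close>

lemma lpsi_inner_self:
  assumes x: "gr.cauchy x" and l: "(\<lambda>n. gr.nrm (x n)) \<longlonglongrightarrow> l"
  shows "lpsi_inner G \<psi> (lpsi_class G \<psi> x) (lpsi_class G \<psi> x) = complex_of_real (l\<^sup>2)"
proof -
  let ?r = "lpsi_rep (lpsi_class G \<psi> x)"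
  have r: "gr.cauchy ?r" using lpsi_rep(1)[OF lpsi_class_lpsi[OF x]] .
  have "(\<lambda>n. gr.nrm (?r n)) \<longlonglongrightarrow> l"
    by (rule tendsto_nrm_eq[OF r x lpsi_rep_class[OF x] l])
  then have "(\<lambda>n. complex_of_real ((gr.nrm (?r n))\<^sup>2)) \<longlonglongrightarrow> complex_of_real (l\<^sup>2)"
    by (intro tendsto_of_real tendsto_power)
  then have "(\<lambda>n. psi_form G \<psi> (?r n) (?r n)) \<longlonglongrightarrow> complex_of_real (l\<^sup>2)"
    using r by (simp add: psi_form_self)
  then show ?thesis unfolding lpsi_inner_def by (rule limI)
qed

text \<open>Rewrites the sum over the support as an operator on functions, the form in which
  isometry and linearity are available.\<close>

lemma boundary_summand:
  assumes t: "t \<in> carrier G" and x: "x \<in> GR"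
  shows "(\<Sum>g | x g \<noteq> 0. x g * (gr_basis (g \<otimes> t) k - gr_basis g k)) = (R t x - x) k"
proof -
  have fin: "finite {g. x g \<noteq> 0}" using GR_finite[OF x] .
  have 1: "(\<Sum>g | x g \<noteq> 0. x g * gr_basis g k) = x k"
  proof -
    have "(\<Sum>g | x g \<noteq> 0. x g * gr_basis g k) = (\<Sum>g | x g \<noteq> 0. if g = k then x g else 0)"
      by (intro sum.cong) (auto simp: gr_basis_def)
    then show ?thesis using fin by simp
  qed
  have 2: "(\<Sum>g | x g \<noteq> 0. x g * gr_basis (g \<otimes> t) k) = R t x k"
  proof (cases "k \<in> carrier G")
    case True
    have "(\<Sum>g | x g \<noteq> 0. x g * gr_basis (g \<otimes> t) k)
        = (\<Sum>g | x g \<noteq> 0. if g = k \<otimes> inv t then x g else 0)"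
    proof (intro sum.cong refl)
      fix g assume "g \<in> {g. x g \<noteq> 0}"
      then have g: "g \<in> carrier G" using GR_nonzero[OF x] by simp
      have "k = g \<otimes> t \<longleftrightarrow> g = k \<otimes> inv t"
        using g t True by (metis inv_solve_right)
      then show "x g * gr_basis (g \<otimes> t) k = (if g = k \<otimes> inv t then x g else 0)"
        by (simp add: gr_basis_def)
    qed
    also have "\<dots> = x (k \<otimes> inv t)" using fin by simp
    finally show ?thesis using True by (simp add: R_def move_def)
  next
    case False
    have "(\<Sum>g | x g \<noteq> 0. x g * gr_basis (g \<otimes> t) k) = 0"
    proof (intro sum.neutral ballI)
      fix g assume "g \<in> {g. x g \<noteq> 0}"
      then have "g \<otimes> t \<in> carrier G" using GR_nonzero[OF x] t by simp
      then show "x g * gr_basis (g \<otimes> t) k = 0" using False by (auto simp: gr_basis_def)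
    qed
    then show ?thesis using False by (simp add: R_def move_def)
  qed
  show ?thesis
    unfolding right_diff_distrib sum_subtractf 1 2 by simp
qed

end

section \<open>Kernel of the boundary map and closure of the cycles\<close>

locale character_generators = group_ring_tuples G \<psi> T
  for G :: "('a, 'b) monoid_scheme" (structure) and \<psi> and T :: "'a set" +
  assumes T_subset: "T \<subseteq> carrier G"
begin

abbreviation bdT :: "('a \<Rightarrow> 'a \<Rightarrow> complex) \<Rightarrow> 'a \<Rightarrow> complex" where
  "bdT \<equiv> bd (\<lambda>t. t)"

lemma gr_boundary_eq:
  assumes "\<And>t. t \<in> T \<Longrightarrow> x t \<in> GR" "\<And>t. t \<in> T \<Longrightarrow> y t = x t"
  shows "gr_boundary G T x = bdT y"
proof (rule ext)
  fix k
  have "bdT y k = (\<Sum>t\<in>T. (R t (y t) - y t) k)"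
    unfolding bd_def by (rule sum_fun_apply)
  also have "\<dots> = (\<Sum>t\<in>T. \<Sum>g | x t g \<noteq> 0. x t g * (gr_basis (g \<otimes> t) k - gr_basis g k))"
    using assms T_subset by (intro sum.cong refl) (subst boundary_summand, auto)
  finally show "gr_boundary G T x k = bdT y k" by (simp add: gr_boundary_def)
qed

lemma cauchy_tuple:
  assumes x: "\<And>n. x n \<in> tuples" and c: "\<And>t. t \<in> T \<Longrightarrow> gr.cauchy (\<lambda>n. x n t)"
  shows "tp.cauchy x"
  unfolding tp.cauchy_def
proof (intro conjI allI impI x)
  fix e :: real assume "e > 0"
  define d where "d = e / (real (card T) + 1)"
  have d: "d > 0" using \<open>e > 0\<close> by (simp add: d_def)
  have "\<forall>t\<in>T. \<exists>N. \<forall>m\<ge>N. \<forall>n\<ge>N. gr.nrm (x m t - x n t) < d"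
    using c d unfolding gr.cauchy_def by blast
  then obtain N where N: "\<And>t m n. t \<in> T \<Longrightarrow> m \<ge> N t \<Longrightarrow> n \<ge> N t \<Longrightarrow> gr.nrm (x m t - x n t) < d"
    using bchoice by metis
  \<comment> \<open>The sum dominates each of the finitely many thresholds, and makes sense also for
    empty \<open>T\<close>.\<close>
  define M where "M = (\<Sum>t\<in>T. N t)"
  have M: "N t \<le> M" if "t \<in> T" for t
    unfolding M_def using that finite_I by (intro member_le_sum) auto
  have "tp.nrm (x m - x n) < e" if mn: "m \<ge> M" "n \<ge> M" for m n
  proof -
    have "tp.nrm (x m - x n) \<le> (\<Sum>t\<in>T. gr.nrm ((x m - x n) t))"
      by (intro nrm_tuple_le tp.V_diff x)
    also have "\<dots> \<le> (\<Sum>t\<in>T. d)"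
    proof (rule sum_mono)
      fix t assume t: "t \<in> T"
      show "gr.nrm ((x m - x n) t) \<le> d"
        using N[OF t, of m n] M[OF t] mn by simp
    qed
    also have "\<dots> < e"
      using \<open>e > 0\<close> by (simp add: d_def pos_divide_less_eq)
    finally show ?thesis .
  qed
  then show "\<exists>N. \<forall>m\<ge>N. \<forall>n\<ge>N. tp.nrm (x m - x n) < e" by blast
qed

text \<open>Outside \<open>T\<close> an element of the power is \<open>undefined\<close>, whose
  representative need not be in the group ring; the default 0 makes it a member of
  \<open>tuples\<close>.\<close>

definition reps :: "('a \<Rightarrow> 'a lpsi_elem) \<Rightarrow> nat \<Rightarrow> 'a \<Rightarrow> 'a \<Rightarrow> complex" where
  "reps \<xi> n t = (if t \<in> T then lpsi_rep (\<xi> t) n else 0)"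

lemma
  assumes "\<xi> \<in> lpsi_pow G \<psi> T"
  shows lpsi_pow_component: "\<And>t. t \<in> T \<Longrightarrow> \<xi> t \<in> lpsi G \<psi>"
    and reps_tuples: "\<And>n. reps \<xi> n \<in> tuples"
    and reps_cauchy: "tp.cauchy (reps \<xi>)"
proof -
  show c: "\<xi> t \<in> lpsi G \<psi>" if "t \<in> T" for t
    using assms that by (auto simp: lpsi_pow_def)
  show V: "reps \<xi> n \<in> tuples" for n
    using lpsi_rep(1)[OF c] by (intro tuplesI) (simp add: reps_def)
  show "tp.cauchy (reps \<xi>)"
    using lpsi_rep(1)[OF c] by (intro cauchy_tuple V) (simp add: reps_def)
qed

text \<open>The bridge to the Hilbert space: distances to the image of a group ring tuple are limits
  of seminorm distances along representatives.\<close>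

lemma lpsi_pow_norm_diff:
  assumes \<xi>: "\<xi> \<in> lpsi_pow G \<psi> T" and z: "z \<in> tuples" and y: "\<And>t. t \<in> T \<Longrightarrow> y t = z t"
  shows "(\<lambda>n. tp.nrm (reps \<xi> n - z)) \<longlonglongrightarrow>
    lpsi_pow_norm G \<psi> T (lpsi_pow_diff G \<psi> T \<xi> (lpsi_pow_of G \<psi> T y))"
proof -
  let ?d = "\<lambda>t n. lpsi_rep (\<xi> t) n - z t"
  have rep: "gr.cauchy (lpsi_rep (\<xi> t))" if "t \<in> T" for t
    using lpsi_rep(1)[OF lpsi_pow_component[OF \<xi> that]] .
  have cz: "gr.cauchy (\<lambda>n. z t)" for t using z by (intro cauchy_const) simp
  have cd: "gr.cauchy (?d t)" if "t \<in> T" for t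
    by (rule cauchy_diff[OF rep[OF that] cz])
  define l where "l t = lim (\<lambda>n. gr.nrm (?d t n))" for t
  have l: "(\<lambda>n. gr.nrm (?d t n)) \<longlonglongrightarrow> l t" if "t \<in> T" for t
    using cauchy_nrm_convergent[OF cd[OF that]] unfolding l_def by (simp only: convergent_LIMSEQ_iff)
  have comp: "lpsi_pow_diff G \<psi> T \<xi> (lpsi_pow_of G \<psi> T y) t = lpsi_class G \<psi> (?d t)" if t: "t \<in> T" for t
  proof -
    let ?w = "lpsi_rep (lpsi_class G \<psi> (\<lambda>n. z t))"
    have w: "gr.cauchy ?w" using lpsi_rep(1)[OF lpsi_class_lpsi[OF cz]] .
    have V: "lpsi_rep (\<xi> t) n \<in> GR" "?w n \<in> GR" "z t \<in> GR" for n
      using rep[OF t] w z by simp_all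
    have eq: "(lpsi_rep (\<xi> t) n - ?w n) - ?d t n = z t - ?w n" for n
      by (rule ext) simp
    have "(\<lambda>n. gr.nrm ((lpsi_rep (\<xi> t) n - ?w n) - ?d t n)) \<longlonglongrightarrow> 0"
      unfolding eq gr.nrm_diff_commute[OF V(3,2)] by (rule lpsi_rep_class[OF cz])
    then have "lpsi_class G \<psi> (\<lambda>n. lpsi_rep (\<xi> t) n - ?w n) = lpsi_class G \<psi> (?d t)"
      using lpsi_class_eq_iff[OF cauchy_diff[OF rep[OF t] w] cd[OF t]] by blast
    then show ?thesis
      using t y[OF t] by (simp add: lpsi_pow_diff_def lpsi_pow_of_def lpsi_of_def lpsi_diff_def fun_diff_def)
  qed
  have "lpsi_pow_inner G \<psi> T (lpsi_pow_diff G \<psi> T \<xi> (lpsi_pow_of G \<psi> T y))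
      (lpsi_pow_diff G \<psi> T \<xi> (lpsi_pow_of G \<psi> T y)) = (\<Sum>t\<in>T. complex_of_real ((l t)\<^sup>2))"
    unfolding lpsi_pow_inner_def
    by (intro sum.cong refl) (simp only: comp lpsi_inner_self[OF cd l])
  then have norm: "lpsi_pow_norm G \<psi> T (lpsi_pow_diff G \<psi> T \<xi> (lpsi_pow_of G \<psi> T y))
      = sqrt (\<Sum>t\<in>T. (l t)\<^sup>2)"
    unfolding lpsi_pow_norm_def by simp
  have V: "reps \<xi> n - z \<in> tuples" for n by (intro tp.V_diff reps_tuples[OF \<xi>] z)
  have "tp.nrm (reps \<xi> n - z) = sqrt (\<Sum>t\<in>T. (gr.nrm (?d t n))\<^sup>2)" for n
  proof -
    have "(tp.nrm (reps \<xi> n - z))\<^sup>2 = (\<Sum>t\<in>T. (gr.nrm (?d t n))\<^sup>2)"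
      unfolding nrm_tuple_sq[OF V] by (intro sum.cong refl) (simp add: reps_def)
    then show ?thesis
      using real_sqrt_unique[of "tp.nrm (reps \<xi> n - z)"] tp.nrm_nonneg[OF V] by metis
  qed
  moreover have "(\<lambda>n. sqrt (\<Sum>t\<in>T. (gr.nrm (?d t n))\<^sup>2)) \<longlonglongrightarrow> sqrt (\<Sum>t\<in>T. (l t)\<^sup>2)"
    by (intro tendsto_real_sqrt tendsto_sum tendsto_power l)
  ultimately show ?thesis unfolding norm by simp
qed

text \<open>Boundedness of the boundary map makes the image of the representing sequence Cauchy, so
  equality with the zero class becomes convergence of norms.\<close>

lemma lpsi_boundary_zero_iff:
  assumes \<xi>: "\<xi> \<in> lpsi_pow G \<psi> T"
  shows "lpsi_boundary G \<psi> T \<xi> = lpsi_of G \<psi> (\<lambda>k. 0) \<longleftrightarrow> (\<lambda>n. gr.nrm (bdT (reps \<xi> n))) \<longlonglongrightarrow> 0"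
proof -
  note V = reps_tuples[OF \<xi>]
  have Tc: "\<And>t. t \<in> T \<Longrightarrow> t \<in> carrier G" using T_subset by blast
  have rep: "lpsi_rep (\<xi> t) n \<in> GR" if "t \<in> T" for t n
    using lpsi_rep(1)[OF lpsi_pow_component[OF \<xi> that]] by simp
  have "gr_boundary G T (\<lambda>t. lpsi_rep (\<xi> t) n) = bdT (reps \<xi> n)" for n
    by (rule gr_boundary_eq) (auto simp: rep reps_def)
  then have b: "lpsi_boundary G \<psi> T \<xi> = lpsi_class G \<psi> (\<lambda>n. bdT (reps \<xi> n))"
    by (simp add: lpsi_boundary_def)
  define c where "c = 2 * real (card T)"
  have c: "c \<ge> 0" by (simp add: c_def)
  have "gr.cauchy (\<lambda>n. bdT (reps \<xi> n))"
    unfolding gr.cauchy_def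
  proof (intro conjI allI impI)
    show "bdT (reps \<xi> n) \<in> GR" for n by (intro bd_GR Tc V)
    fix e :: real assume "e > 0"
    then have "e / (c + 1) > 0" using c by simp
    then obtain N where N: "\<And>p q. p \<ge> N \<Longrightarrow> q \<ge> N \<Longrightarrow> tp.nrm (reps \<xi> p - reps \<xi> q) < e / (c + 1)"
      using reps_cauchy[OF \<xi>] unfolding tp.cauchy_def by blast
    have "gr.nrm (bdT (reps \<xi> p) - bdT (reps \<xi> q)) < e" if "p \<ge> N" "q \<ge> N" for p q
    proof -
      have dV: "reps \<xi> p - reps \<xi> q \<in> tuples" by (intro tp.V_diff V)
      have "gr.nrm (bdT (reps \<xi> p) - bdT (reps \<xi> q)) \<le> c * tp.nrm (reps \<xi> p - reps \<xi> q)"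
        unfolding linear_diff[OF linear_bd, symmetric] c_def by (intro nrm_bd_le Tc dV)
      also have "\<dots> \<le> (c + 1) * tp.nrm (reps \<xi> p - reps \<xi> q)"
        using tp.nrm_nonneg[OF dV] by (simp add: distrib_right)
      also have "\<dots> < e"
        using N[OF that] c by (simp add: pos_less_divide_eq mult.commute)
      finally show ?thesis .
    qed
    then show "\<exists>N. \<forall>p\<ge>N. \<forall>q\<ge>N. gr.nrm (bdT (reps \<xi> p) - bdT (reps \<xi> q)) < e" by blast
  qed
  then have "lpsi_class G \<psi> (\<lambda>n. bdT (reps \<xi> n)) = lpsi_class G \<psi> (\<lambda>n. 0)
      \<longleftrightarrow> (\<lambda>n. gr.nrm (bdT (reps \<xi> n) - 0)) \<longlonglongrightarrow> 0"
    by (rule lpsi_class_eq_iff[OF _ cauchy_const[OF gr.V_zero]])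
  then show ?thesis unfolding b lpsi_of_def zero_fun_def[symmetric] diff_zero .
qed

text \<open>\<open>near\<close> gives the inclusion of the kernel in the closure. The converse
  inclusion is continuity: the boundary of an approximant differs from that of a cycle, which is 0,
  by at most a constant times their distance.\<close>

lemma kernel_eq_closure:
  assumes near: "\<And>x e. tp.cauchy x \<Longrightarrow> (\<lambda>n. gr.nrm (bdT (x n))) \<longlonglongrightarrow> 0 \<Longrightarrow> 0 < e \<Longrightarrow>
    \<exists>z\<in>tuples. bdT z = 0 \<and> (\<exists>N. \<forall>n\<ge>N. tp.nrm (x n - z) < e)"
  shows "{\<xi> \<in> lpsi_pow G \<psi> T. lpsi_boundary G \<psi> T \<xi> = lpsi_of G \<psi> (\<lambda>k. 0)}
    = lpsi_closure G \<psi> T (lpsi_pow_of G \<psi> T ` gr_cycles G T)"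
proof (intro equalityI subsetI)
  fix \<xi> assume "\<xi> \<in> {\<xi> \<in> lpsi_pow G \<psi> T. lpsi_boundary G \<psi> T \<xi> = lpsi_of G \<psi> (\<lambda>k. 0)}"
  then have \<xi>: "\<xi> \<in> lpsi_pow G \<psi> T" and b: "(\<lambda>n. gr.nrm (bdT (reps \<xi> n))) \<longlonglongrightarrow> 0"
    using lpsi_boundary_zero_iff by auto
  have "\<exists>\<eta>\<in>lpsi_pow_of G \<psi> T ` gr_cycles G T. lpsi_pow_norm G \<psi> T (lpsi_pow_diff G \<psi> T \<xi> \<eta>) < e"
    if e: "e > 0" for e
  proof -
    \<comment> \<open>Halved because strict bounds along the sequence become weak ones in the
      limit.\<close>
    have "e / 2 > 0" using e by simp
    then obtain z N where z: "z \<in> tuples" "bdT z = 0"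
      and N: "\<And>n. n \<ge> N \<Longrightarrow> tp.nrm (reps \<xi> n - z) < e / 2"
      using near[OF reps_cauchy[OF \<xi>] b] by blast
    \<comment> \<open>Cycles of the group ring are extensional on \<open>T\<close>, while members of
      \<open>tuples\<close> are defined everywhere.\<close>
    define y where "y = restrict z T"
    have yz: "\<And>t. t \<in> T \<Longrightarrow> y t = z t" by (simp add: y_def)
    have "gr_boundary G T y = bdT z"
      using z yz by (intro gr_boundary_eq) auto
    then have "y \<in> gr_cycles G T"
      using z unfolding gr_cycles_def y_def zero_fun_def by (auto simp: restrict_PiE_iff)
    moreover have "lpsi_pow_norm G \<psi> T (lpsi_pow_diff G \<psi> T \<xi> (lpsi_pow_of G \<psi> T y)) \<le> e / 2"
    proof (rule LIMSEQ_le_const2[OF lpsi_pow_norm_diff[OF \<xi> z(1) yz]])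
      show "\<exists>N. \<forall>n\<ge>N. tp.nrm (reps \<xi> n - z) \<le> e / 2"
        using N less_imp_le by blast
    qed
    ultimately show ?thesis using e by (intro bexI[of _ "lpsi_pow_of G \<psi> T y"]) auto
  qed
  then show "\<xi> \<in> lpsi_closure G \<psi> T (lpsi_pow_of G \<psi> T ` gr_cycles G T)"
    using \<xi> by (simp add: lpsi_closure_def)
next
  fix \<xi> assume cl: "\<xi> \<in> lpsi_closure G \<psi> T (lpsi_pow_of G \<psi> T ` gr_cycles G T)"
  then have \<xi>: "\<xi> \<in> lpsi_pow G \<psi> T" by (simp add: lpsi_closure_def)
  have Tc: "\<And>t. t \<in> T \<Longrightarrow> t \<in> carrier G" using T_subset by blast
  define c where "c = 2 * real (card T)"
  have c: "c \<ge> 0" by (simp add: c_def)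
  have "(\<lambda>n. gr.nrm (bdT (reps \<xi> n))) \<longlonglongrightarrow> 0"
  proof (rule LIMSEQ_I)
    fix e :: real assume e: "e > 0"
    then have "e / (c + 1) > 0" using c by simp
    then obtain y where y: "y \<in> gr_cycles G T"
      and ny: "lpsi_pow_norm G \<psi> T (lpsi_pow_diff G \<psi> T \<xi> (lpsi_pow_of G \<psi> T y)) < e / (c + 1)"
      using cl unfolding lpsi_closure_def by blast
    define z where "z t = (if t \<in> T then y t else 0)" for t
    have yG: "\<And>t. t \<in> T \<Longrightarrow> y t \<in> GR" using y by (auto simp: gr_cycles_def)
    have z: "z \<in> tuples" using yG by (intro tuplesI) (simp add: z_def)
    have yz: "\<And>t. t \<in> T \<Longrightarrow> y t = z t" by (simp add: z_def)
    have "bdT z = gr_boundary G T y" using yG yz by (intro gr_boundary_eq[symmetric]) auto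
    then have bz: "bdT z = 0" using y unfolding gr_cycles_def zero_fun_def by simp
    have "\<forall>\<^sub>F n in sequentially. tp.nrm (reps \<xi> n - z) < e / (c + 1)"
      by (rule order_tendstoD(2)[OF lpsi_pow_norm_diff[OF \<xi> z yz] ny])
    then obtain N where N: "\<And>n. n \<ge> N \<Longrightarrow> tp.nrm (reps \<xi> n - z) < e / (c + 1)"
      unfolding eventually_sequentially by blast
    have "norm (gr.nrm (bdT (reps \<xi> n)) - 0) < e" if "n \<ge> N" for n
    proof -
      have dV: "reps \<xi> n - z \<in> tuples" by (intro tp.V_diff reps_tuples[OF \<xi>] z)
      have "bdT (reps \<xi> n - z) = bdT (reps \<xi> n)"
        unfolding linear_diff[OF linear_bd] bz by (rule diff_zero)
      then have "gr.nrm (bdT (reps \<xi> n)) \<le> c * tp.nrm (reps \<xi> n - z)"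
        using nrm_bd_le[of "\<lambda>t. t", OF Tc dV] unfolding c_def by simp
      also have "\<dots> \<le> (c + 1) * tp.nrm (reps \<xi> n - z)"
        using tp.nrm_nonneg[OF dV] by (simp add: distrib_right)
      also have "\<dots> < e"
        using N[OF that] c by (simp add: pos_less_divide_eq mult.commute)
      finally have "gr.nrm (bdT (reps \<xi> n)) < e" .
      moreover have "bdT (reps \<xi> n) \<in> GR" by (intro bd_GR Tc reps_tuples[OF \<xi>])
      ultimately show ?thesis by simp
    qed
    then show "\<exists>N. \<forall>n\<ge>N. norm (gr.nrm (bdT (reps \<xi> n)) - 0) < e" by blast
  qed
  then show "\<xi> \<in> {\<xi> \<in> lpsi_pow G \<psi> T. lpsi_boundary G \<psi> T \<xi> = lpsi_of G \<psi> (\<lambda>k. 0)}"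
    using \<xi> lpsi_boundary_zero_iff[OF \<xi>] by simp
qed

end

section \<open>Right-angled groups\<close>

lemma (in group) infinite_order_powers:
  fixes k l :: nat
  assumes x: "x \<in> carrier G" "ord x = 0" and kl: "k \<noteq> l"
  shows "inv (x [^] l) \<otimes> x [^] k \<noteq> \<one>"
proof
  assume eq: "inv (x [^] l) \<otimes> x [^] k = \<one>"
  have "x [^] k = x [^] l \<otimes> (inv (x [^] l) \<otimes> x [^] k)"
    using x(1) by (simp flip: m_assoc)
  then have "x [^] k = x [^] l" using x(1) by (simp add: eq)
  \<comment> \<open>Subtraction is truncated, so both directions are taken: order 0 makes both
    differences 0, hence \<open>k = l\<close>.\<close>
  then have "ord x dvd k - l" "ord x dvd l - k"
    using x(1) pow_eq_div2[of x k l] pow_eq_div2[of x l k] by (simp_all flip: pow_eq_id)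
  then show False using x(2) kl by simp
qed

theorem theorem3p6:
  fixes G :: "('a, 'b) monoid_scheme"
    and \<Gamma> :: "'i pair_pre_digraph"
    and s :: "'i \<Rightarrow> 'a"
    and \<psi> :: "'a \<Rightarrow> complex"
    and T :: "'a set"
  assumes "group G"
    and "right_angled_generators G \<Gamma> s"
    and "group_character G \<psi>"
    and "\<And>i. i \<in> pverts \<Gamma> \<Longrightarrow> regular_subgroup G \<psi> (generate G {s i})"
    and "finite T" and "T \<subseteq> carrier G" and "generate G T = carrier G"
  shows "psi_betti1 G \<psi> T = 0"
proof -
  interpret group G by (rule assms(1))
  obtain \<pi> where \<pi>: "\<pi> \<in> epi (raag \<Gamma>) G" and s: "\<And>i. i \<in> pverts \<Gamma> \<Longrightarrow> s i = \<pi> (raag_gen \<Gamma> i)"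
    and \<Gamma>: "pair_graph \<Gamma>" "Digraph_Component.connected (with_proj \<Gamma>)"
    and ord: "\<And>i. i \<in> pverts \<Gamma> \<Longrightarrow> ord (s i) = 0"
    using assms(2) unfolding right_angled_generators_def by blast
  have wf: "pair_wf_digraph \<Gamma>"
  proof -
    interpret pair_graph \<Gamma> by (rule \<Gamma>(1))
    show ?thesis by (rule pair_wf_digraph_axioms)
  qed
  interpret raag_quotient G \<Gamma> \<pi>
    by (intro raag_quotient.intro raag_quotient_axioms.intro) (fact assms(1) \<pi> wf)+
  obtain m :: nat and v where v: "v ` {..m} = pverts \<Gamma>"
    and edge: "\<And>k. k < m \<Longrightarrow> (v k, v (Suc k)) \<in> parcs \<Gamma>"
    using covering_walk[OF \<Gamma>] by blast
  \<comment> \<open>The generators are listed in the order of the walk, so consecutive ones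
    commute.\<close>
  define a where "a k = s (v k)" for k
  have vert: "v k \<in> pverts \<Gamma>" if "k \<le> m" for k using v that by auto
  have carr: "s i \<in> carrier G" if "i \<in> pverts \<Gamma>" for i
    using that s ev_generator_carrier by simp
  interpret change_of_generators G \<psi> m a T
  proof (unfold_locales)
    show "group_character G \<psi>" by (rule assms(3))
    show "finite {..m}" by simp
    show "finite T" by (rule assms(5))
    show "T \<subseteq> carrier G" by (rule assms(6))
    show "carrier G \<subseteq> generate G T" using assms(7) by simp
    show "a k \<in> carrier G" if "k \<le> m" for k
      using carr[OF vert[OF that]] by (simp add: a_def)
    show "a k \<otimes>\<^bsub>G\<^esub> a (Suc k) = a (Suc k) \<otimes>\<^bsub>G\<^esub> a k" if "k < m" for k
      using ev_generator_commute[OF edge[OF that]] s vert that by (simp add: a_def)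
    have "a ` {..m} = (\<lambda>i. \<pi> (raag_gen \<Gamma> i)) ` pverts \<Gamma>"
      unfolding v[symmetric] image_image using s vert by (intro image_cong) (auto simp: a_def)
    then show "carrier G \<subseteq> generate G (a ` {..m})" using generators_generate by simp
    show "\<psi> (inv\<^bsub>G\<^esub> (a i [^]\<^bsub>G\<^esub> l) \<otimes>\<^bsub>G\<^esub> a i [^]\<^bsub>G\<^esub> k) = 0" if "i \<le> m" "k \<noteq> l" for i and k l :: nat
    proof -
      note i = vert[OF that(1)]
      have reg: "regular_subgroup G \<psi> (generate G {a i})"
        using assms(4)[OF i] by (simp add: a_def)
      have sub: "subgroup (generate G {a i}) G" using reg by (simp add: regular_subgroup_def)
      have "a i \<in> generate G {a i}" by (simp add: generate.incl)
      then have "a i [^]\<^bsub>G\<^esub> n \<in> generate G {a i}" for n :: nat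
        by (induction n) (auto intro: subgroup.m_closed[OF sub] subgroup.one_closed[OF sub])
      then have "inv\<^bsub>G\<^esub> (a i [^]\<^bsub>G\<^esub> l) \<otimes>\<^bsub>G\<^esub> a i [^]\<^bsub>G\<^esub> k \<in> generate G {a i}"
        by (intro subgroup.m_closed[OF sub] subgroup.m_inv_closed[OF sub])
      moreover have "inv\<^bsub>G\<^esub> (a i [^]\<^bsub>G\<^esub> l) \<otimes>\<^bsub>G\<^esub> a i [^]\<^bsub>G\<^esub> k \<noteq> \<one>\<^bsub>G\<^esub>"
        using infinite_order_powers[OF carr[OF i] ord[OF i] that(2)] by (simp add: a_def)
      ultimately show ?thesis
        using reg unfolding regular_subgroup_def by blast
    qed
  qed
  interpret c: character_generators G \<psi> T
    by unfold_locales (rule assms(6))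
  have "{\<xi> \<in> lpsi_pow G \<psi> T. lpsi_boundary G \<psi> T \<xi> = lpsi_of G \<psi> (\<lambda>k. 0)}
      = lpsi_closure G \<psi> T (lpsi_pow_of G \<psi> T ` gr_cycles G T)"
    by (rule c.kernel_eq_closure) (rule cauchy_near_cycle_generators)
  \<comment> \<open>The same set stands in both terms of the Betti number, so they cancel whatever
    its dimension is.\<close>
  then show ?thesis by (simp add: psi_betti1_def)
qed

end
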